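(* Fix $\mu\in\mathbb{C}$ with $\mathrm{Re}(\mu)>0$ and let $H(x)=\int_0^1\frac{1-t^x}{1-t}dt$. For $a,b\in\mathbb{Q}_{>0}$ put $c_{a,b}=H(b/\mu-1)-H(a/\mu-1)$. Then for all $m,m'\in\mathbb{Q}_{>0}$: (1) The $\mathbb{C}$-linear map $\varrho^{\mu,*}_{m,m'}:\mathbb{C}[T]\to\mathbb{C}[T]$, $T^s\mapsto(T+c_{m,m'})^s$ ($s\ge0$), satisfies $\zeta^{\mu,T}_{*,m'}(w)=\varrho^{\mu,*}_{m,m'}(\zeta^{\mu,T}_{*,m}(w))$ for all $w\in\mathbb{Q}[\mu]\langle Y\rangle$, and it is the unique $\mathbb{C}$-linear map with this property. (2) The $\mathbb{C}$-linear map $\varrho^{\mu,\sqcup\!\sqcup}_{m,m'}:\mathbb{C}[T]\to\mathbb{C}[T]$, $T^s\mapsto(T+c_{m,m'})^s$, satisfies $\zeta^{\mu,T}_{\sqcup\!\sqcup,m'}(w)=\varrho^{\mu,\sqcup\!\sqcup}_{m,m'}(\zeta^{\mu,T}_{\sqcup\!\sqcup,m}(w))$ for all $w\in\mathbb{Q}[\mu]\langle X^\mu\rangle^1$, and it is the unique $\mathbb{C}$-linear map with this property. (3) There exists a unique $\mathbb{C}$-linear map $\rho^\mu_{m,m'}:\mathbb{C}[T]\to\mathbb{C}[T]$ such that $\zeta^{\mu,T}_{\sqcup\!\sqcup,m'}(\varphi_\mu(w))=\rho^\mu_{m,m'}(\zeta^{\mu,T}_{*,m}(w))$ for all $w\in\mathbb{Q}[\mu]\langle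 Y\rangle$.
   Context: $\mathbb{Q}[\mu]\subset\mathbb{C}$ is the ring generated by $\mu$. Bi-indices $(\mathbf{k};\mathbf{m})\in\mathbb{N}^r\times\mathbb{Q}^r$: positive if all $m_i>0$, admissible if positive and $k_r>1$; $\zeta^{\mu}(\mathbf{k};\mathbf{m})=\sum_{0\le n_1\le\cdots\le n_r}\mu^r\prod_i(n_i\mu+m_i)^{-k_i}$ for admissible ones. Special triple $(\mathbf{k};\mathbf{m};\tilde{\mathbf{m}})$: $\mathbf{k}=(k_1,\dots,k_{r-1},1)$, $\tilde{\mathbf{m}}$ equals $\mathbf{m}$ except last entry $\tilde m_r\ne m_r$, all entries in $\mathbb{Q}_{>0}$; $\mathcal{D}^{\mu}(\mathbf{k};\mathbf{m};\tilde{\mathbf{m}})=(\tilde m_r-m_r)\sum_{0\le n_1\le\cdots\le n_r}\frac{\mu^r}{\prod_{i<r}(n_i\mu+m_i)^{k_i}(n_r\mu+m_r)(n_r\mu+\tilde m_r)}$. $\mathcal{Z}^\mu\subset\mathbb{C}$ = $\mathbb{Q}[\mu]$-span of $1$, admissible $\zeta^\mu$'s and $\mathcal{D}^\mu$'s. Stuffle side: $Y=\{y_{k,m}:k\in\mathbb{N},m\in\mathbb{Q}_{>0}\}$; $\mathbb{Q}[\mu]\langle Y\rangle$ free noncommutative algebra on words, $y_{\mathbf{k};\mathbf{m}}=y_{k_1,m_1}\cdots y_{k_r,m_r}$. Product $\odot$ on letters: $y_{k_1,m}\odot y_{k_2,m}=y_{k_1+k_2,m}$; for $m_1\ne m_2$,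 $y_{k_1,m_1}\odot y_{k_2,m_2}=\sum_{i\le k_1}a_iy_{i,m_1}+\sum_{j\le k_2}b_jy_{j,m_2}$ with $\frac{1}{(x+m_1)^{k_1}(x+m_2)^{k_2}}=\sum\frac{a_i}{(x+m_1)^i}+\sum\frac{b_j}{(x+m_2)^j}$. $\ast_\mu$: bilinear, $1\ast_\mu w=w\ast_\mu1=w$, $ux\ast_\mu vy=(u\ast_\mu vy)x+(ux\ast_\mu v)y-\mu(u\ast_\mu v)(x\odot y)$ ($x,y$ letters). $\mathbb{Q}[\mu]\langle Y\rangle^0$ = span of $1$, $y_{\mathbf{k};\mathbf{m}}$ ($(\mathbf{k};\mathbf{m})$ admissible) and $y_{\mathbf{k};\mathbf{m}}-y_{\mathbf{k};\tilde{\mathbf{m}}}$ (special triples). $\zeta^\mu_*$ on it: $w\mapsto\lim_{M\to\infty}\zeta^\mu_{*,M}(w)$, where $\zeta^\mu_{*,M}$ is linear with $y_{\mathbf{k};\mathbf{m}}\mapsto\sum_{0\le n_1\le\cdots\le n_r\le M}\mu^r\prod(n_i\mu+m_i)^{-k_i}$. For $m\in\mathbb{Q}_{>0}$, $\zeta^{\mu,T}_{*,m}:\mathbb{Q}[\mu]\langle Y\rangle\to\mathcal{Z}^\mu[T]$ is the unique $\mathbb{Q}[\mu]$-linear map extending $\zeta^\mu_*$, sending $y_{1,m}\mapsto T$ and multiplicative for $\ast_\mu$ (it exists and is unique). Shuffle side: $X^\mu=\{x\}\cup\{y^\mu_l:l\in\mathbb{Q}\}$, shuffle $\sqcup\!\sqcup$: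 bilinear, $1\sqcup\!\sqcup w=w\sqcup\!\sqcup1=w$, $w_1u\sqcup\!\sqcup w_2v=(w_1\sqcup\!\sqcup w_2v)u+(w_1u\sqcup\!\sqcup w_2)v$. $(y,x)^\mu_{\mathbf{k};\mathbf{m}}=y^\mu_{m_1}x^{k_1-1}y^\mu_{m_2-m_1}x^{k_2-1}\cdots y^\mu_{m_r-m_{r-1}}x^{k_r-1}$. $\mathbb{Q}[\mu]\langle X^\mu\rangle^1$ = span of $1$ and $(y,x)^\mu_{\mathbf{k};\mathbf{m}}$, $(\mathbf{k};\mathbf{m})$ positive; $\mathbb{Q}[\mu]\langle X^\mu\rangle^0$ = span of $1$, $(y,x)^\mu_{\mathbf{k};\mathbf{m}}$ (admissible) and $(y,x)^\mu_{\mathbf{k};\mathbf{m}}-(y,x)^\mu_{\mathbf{k};\tilde{\mathbf{m}}}$ (special triples); $\zeta^\mu_{\sqcup\!\sqcup}$ is the linear map on it sending these to $1$, $\zeta^\mu(\mathbf{k};\mathbf{m})$, $\mathcal{D}^\mu(\mathbf{k};\mathbf{m};\tilde{\mathbf{m}})$. $\zeta^{\mu,T}_{\sqcup\!\sqcup,m}:\mathbb{Q}[\mu]\langle X^\mu\rangle^1\to\mathcal{Z}^\mu[T]$ is the unique $\mathbb{Q}[\mu]$-linear map extending $\zeta^\mu_{\sqcup\!\sqcup}$, sending $y^\mu_m\mapsto T$ and multiplicative for $\sqcup\!\sqcup$ (it exists and is unique). $\varphi_\mu:\mathbb{Q}[\mu]\langle Y\rangle\to\mathbb{Q}[\mu]\langle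 X^\mu\rangle^1$ is the $\mathbb{Q}[\mu]$-linear bijection $y_{\mathbf{k};\mathbf{m}}\mapsto(y,x)^\mu_{\mathbf{k};\mathbf{m}}$, $1\mapsto1$. *)

theory Defs
  imports
    "HOL-Analysis.Analysis"
    "HOL-Library.FuncSet"
    "HOL-Library.Poly_Mapping"
    "HOL-Computational_Algebra.Polynomial"
begin

section \<open>Coefficients, spans and linear maps\<close>

definition Q_adjoin :: "complex \<Rightarrow> complex set" where
  "Q_adjoin \<mu> = range (\<lambda>p :: rat poly. poly (map_poly of_rat p) \<mu>)"

text \<open>The ring \<^term>\<open>Q_adjoin \<mu>\<close> is a subset of the complex numbers rather than a type, so spans and
  linearity over it take the set of scalars and the scalar multiplication as arguments.\<close>

definition span_over :: "complex set \<Rightarrow> (complex \<Rightarrow> 'v \<Rightarrow> 'v) \<Rightarrow> 'v set \<Rightarrow> 'v :: comm_monoid_add set" where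
  "span_over R sc S = {(\<Sum>v\<in>A. sc (c v) v) | A c. finite A \<and> A \<subseteq> S \<and> (\<forall>v\<in>A. c v \<in> R)}"

definition linear_over ::
  "complex set \<Rightarrow> (complex \<Rightarrow> 'v \<Rightarrow> 'v) \<Rightarrow> (complex \<Rightarrow> 'w \<Rightarrow> 'w) \<Rightarrow>
    'v :: plus set \<Rightarrow> ('v \<Rightarrow> 'w :: plus) \<Rightarrow> bool" where
  "linear_over R sc sc' V F \<longleftrightarrow>
     (\<forall>u\<in>V. \<forall>v\<in>V. F (u + v) = F u + F v) \<and> (\<forall>c\<in>R. \<forall>v\<in>V. F (sc c v) = sc' c (F v))"

text \<open>Noncommutative polynomials over an alphabet \<^typ>\<open>'a\<close> are finitely supported functions
  \<^typ>\<open>'a list \<Rightarrow>\<^sub>0 complex\<close>; the coefficients are restricted to \<^term>\<open>Q_adjoin \<mu>\<close> by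
  the carrier sets below.\<close>

definition scale :: "complex \<Rightarrow> ('a \<Rightarrow>\<^sub>0 complex) \<Rightarrow> ('a \<Rightarrow>\<^sub>0 complex)" where
  "scale c p = Poly_Mapping.map ((*) c) p"

abbreviation basis_elt :: "'a \<Rightarrow> ('a \<Rightarrow>\<^sub>0 complex)" where
  "basis_elt a \<equiv> Poly_Mapping.single a 1"

definition lin_ext :: "('a \<Rightarrow> ('b \<Rightarrow>\<^sub>0 complex)) \<Rightarrow> ('a \<Rightarrow>\<^sub>0 complex) \<Rightarrow> ('b \<Rightarrow>\<^sub>0 complex)" where
  "lin_ext f p = (\<Sum>u\<in>Poly_Mapping.keys p. scale (Poly_Mapping.lookup p u) (f u))"

definition bilin_ext ::
  "('a \<Rightarrow> 'b \<Rightarrow> ('c \<Rightarrow>\<^sub>0 complex)) \<Rightarrow> ('a \<Rightarrow>\<^sub>0 complex) \<Rightarrow> ('b \<Rightarrow>\<^sub>0 complex) \<Rightarrow> ('c \<Rightarrow>\<^sub>0 complex)" where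
  "bilin_ext f p q = (\<Sum>u\<in>Poly_Mapping.keys p. \<Sum>v\<in>Poly_Mapping.keys q.
     scale (Poly_Mapping.lookup p u * Poly_Mapping.lookup q v) (f u v))"

definition append_letters :: "('a list \<Rightarrow>\<^sub>0 complex) \<Rightarrow> ('a \<Rightarrow>\<^sub>0 complex) \<Rightarrow> ('a list \<Rightarrow>\<^sub>0 complex)" where
  "append_letters = bilin_ext (\<lambda>w a. basis_elt (w @ [a]))"


section \<open>Bi-indices and the values \<open>\<zeta>\<^sup>\<mu>\<close> and \<open>\<D>\<^sup>\<mu>\<close>\<close>

text \<open>The bi-index \<open>(k\<^sub>1, \<dots>, k\<^sub>r; m\<^sub>1, \<dots>, m\<^sub>r)\<close> is the list \<open>[(k\<^sub>1, m\<^sub>1), \<dots>, (k\<^sub>r, m\<^sub>r)]\<close>, and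
  the pair \<open>(k, m)\<close> also serves as the letter \<open>y\<^bsub>k,m\<^esub>\<close>, so that positive bi-indices are exactly
  the words over \<open>Y\<close>.\<close>

type_synonym biindex = "(nat \<times> rat) list"

definition positive :: "biindex \<Rightarrow> bool" where
  "positive w \<longleftrightarrow> (\<forall>(k, m)\<in>set w. k \<ge> 1 \<and> m > 0)"

definition admissible :: "biindex \<Rightarrow> bool" where
  "admissible w \<longleftrightarrow> positive w \<and> w \<noteq> [] \<and> fst (last w) > 1"

text \<open>A special triple is given by its common first \<open>r - 1\<close> entries \<open>u\<close> together with the two last
  entries \<open>m\<close> and \<open>m'\<close> of the second and third component.\<close>

definition special :: "biindex \<Rightarrow> rat \<Rightarrow> rat \<Rightarrow> bool" where
  "special u m m' \<longleftrightarrow> positive (u @ [(1, m)]) \<and> positive (u @ [(1, m')]) \<and> m \<noteq> m'"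

definition mono_tuples :: "nat \<Rightarrow> nat list set" where
  "mono_tuples r = {ns. length ns = r \<and> sorted ns}"

definition denom :: "complex \<Rightarrow> biindex \<Rightarrow> nat list \<Rightarrow> complex" where
  "denom \<mu> w ns = (\<Prod>i<length w. (of_nat (ns ! i) * \<mu> + of_rat (snd (w ! i))) ^ fst (w ! i))"

definition zeta_mu :: "complex \<Rightarrow> biindex \<Rightarrow> complex" where
  "zeta_mu \<mu> w = (\<Sum>\<^sub>\<infinity>ns\<in>mono_tuples (length w). \<mu> ^ length w / denom \<mu> w ns)"

definition D_mu :: "complex \<Rightarrow> biindex \<Rightarrow> rat \<Rightarrow> rat \<Rightarrow> complex" where
  "D_mu \<mu> u m m' = of_rat (m' - m) *
     (\<Sum>\<^sub>\<infinity>ns\<in>mono_tuples (length u + 1).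
        \<mu> ^ (length u + 1) /
        (denom \<mu> u ns * (of_nat (last ns) * \<mu> + of_rat m) * (of_nat (last ns) * \<mu> + of_rat m')))"

definition Z_mu :: "complex \<Rightarrow> complex set" where
  "Z_mu \<mu> = span_over (Q_adjoin \<mu>) (*)
     ({1} \<union> {zeta_mu \<mu> w | w. admissible w} \<union> {D_mu \<mu> u m m' | u m m'. special u m m'})"

definition Z_mu_T :: "complex \<Rightarrow> complex poly set" where
  "Z_mu_T \<mu> = {p. \<forall>i. coeff p i \<in> Z_mu \<mu>}"


section \<open>The stuffle side\<close>

definition QY :: "complex \<Rightarrow> (biindex \<Rightarrow>\<^sub>0 complex) set" where
  "QY \<mu> = {p. (\<forall>w\<in>Poly_Mapping.keys p. positive w) \<and> (\<forall>w. Poly_Mapping.lookup p w \<in> Q_adjoin \<mu>)}"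

definition QY0 :: "complex \<Rightarrow> (biindex \<Rightarrow>\<^sub>0 complex) set" where
  "QY0 \<mu> = span_over (Q_adjoin \<mu>) scale
     ({basis_elt []} \<union> {basis_elt w | w. admissible w} \<union>
      {basis_elt (u @ [(1, m)]) - basis_elt (u @ [(1, m')]) | u m m'. special u m m'})"

text \<open>For distinct \<open>m\<^sub>1\<close>, \<open>m\<^sub>2\<close> the partial fraction identity determines \<open>a i\<close> for \<open>1 \<le> i \<le> k\<^sub>1\<close> and
  \<open>b j\<close> for \<open>1 \<le> j \<le> k\<^sub>2\<close>; the other values are arbitrary and never used.\<close>

definition partial_fraction :: "nat \<Rightarrow> rat \<Rightarrow> nat \<Rightarrow> rat \<Rightarrow> (nat \<Rightarrow> rat) \<times> (nat \<Rightarrow> rat)" where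
  "partial_fraction k1 m1 k2 m2 = (SOME (a, b).
     \<forall>x. x + m1 \<noteq> 0 \<longrightarrow> x + m2 \<noteq> 0 \<longrightarrow>
       1 / ((x + m1) ^ k1 * (x + m2) ^ k2) =
         (\<Sum>i = 1..k1. a i / (x + m1) ^ i) + (\<Sum>j = 1..k2. b j / (x + m2) ^ j))"

definition odot :: "nat \<times> rat \<Rightarrow> nat \<times> rat \<Rightarrow> (nat \<times> rat \<Rightarrow>\<^sub>0 complex)" where
  "odot = (\<lambda>(k1, m1) (k2, m2).
     if m1 = m2 then basis_elt (k1 + k2, m1)
     else let (a, b) = partial_fraction k1 m1 k2 m2 in
       (\<Sum>i = 1..k1. Poly_Mapping.single (i, m1) (of_rat (a i))) +
       (\<Sum>j = 1..k2. Poly_Mapping.single (j, m2) (of_rat (b j))))"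

function stuffle_words :: "complex \<Rightarrow> biindex \<Rightarrow> biindex \<Rightarrow> (biindex \<Rightarrow>\<^sub>0 complex)" where
  "stuffle_words \<mu> [] w = basis_elt w"
| "stuffle_words \<mu> (u @ [x]) [] = basis_elt (u @ [x])"
| "stuffle_words \<mu> (u @ [x]) (v @ [y]) =
     append_letters (stuffle_words \<mu> u (v @ [y])) (basis_elt x) +
     append_letters (stuffle_words \<mu> (u @ [x]) v) (basis_elt y) -
     scale \<mu> (append_letters (stuffle_words \<mu> u v) (odot x y))"
  by (atomize_elim, metis prod_cases3 rev_exhaust) simp_all
termination by (relation "Wellfounded.measure (\<lambda>(\<mu>, u, v). length u + length v)") auto

definition stuffle ::
  "complex \<Rightarrow> (biindex \<Rightarrow>\<^sub>0 complex) \<Rightarrow> (biindex \<Rightarrow>\<^sub>0 complex) \<Rightarrow> (biindex \<Rightarrow>\<^sub>0 complex)" where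
  "stuffle \<mu> = bilin_ext (stuffle_words \<mu>)"

definition zeta_star_trunc :: "complex \<Rightarrow> nat \<Rightarrow> (biindex \<Rightarrow>\<^sub>0 complex) \<Rightarrow> complex" where
  "zeta_star_trunc \<mu> M p = (\<Sum>w\<in>Poly_Mapping.keys p. Poly_Mapping.lookup p w *
     (\<Sum>ns\<in>{ns \<in> mono_tuples (length w). \<forall>n\<in>set ns. n \<le> M}. \<mu> ^ length w / denom \<mu> w ns))"

definition zeta_star :: "complex \<Rightarrow> (biindex \<Rightarrow>\<^sub>0 complex) \<Rightarrow> complex" where
  "zeta_star \<mu> p = lim (\<lambda>M. zeta_star_trunc \<mu> M p)"

text \<open>The maps characterised by a definite description below are made unique as total functions by
  requiring the value \<^const>\<open>undefined\<close> outside their domain.\<close>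

definition zeta_star_reg :: "complex \<Rightarrow> rat \<Rightarrow> (biindex \<Rightarrow>\<^sub>0 complex) \<Rightarrow> complex poly" where
  "zeta_star_reg \<mu> m = (THE F.
     F \<in> QY \<mu> \<rightarrow>\<^sub>E Z_mu_T \<mu> \<and>
     linear_over (Q_adjoin \<mu>) scale smult (QY \<mu>) F \<and>
     (\<forall>w\<in>QY0 \<mu>. F w = [:zeta_star \<mu> w:]) \<and>
     F (basis_elt [(1, m)]) = [:0, 1:] \<and>
     (\<forall>u\<in>QY \<mu>. \<forall>v\<in>QY \<mu>. F (stuffle \<mu> u v) = F u * F v))"


section \<open>The shuffle side\<close>

datatype xletter = Lx | Ly rat

function shuffle_words :: "'a list \<Rightarrow> 'a list \<Rightarrow> ('a list \<Rightarrow>\<^sub>0 complex)" where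
  "shuffle_words [] w = basis_elt w"
| "shuffle_words (u @ [x]) [] = basis_elt (u @ [x])"
| "shuffle_words (u @ [x]) (v @ [y]) =
     append_letters (shuffle_words u (v @ [y])) (basis_elt x) +
     append_letters (shuffle_words (u @ [x]) v) (basis_elt y)"
  by (atomize_elim, metis surj_pair rev_exhaust) simp_all
termination by (relation "Wellfounded.measure (\<lambda>(u, v). length u + length v)") auto

definition shuffle ::
  "('a list \<Rightarrow>\<^sub>0 complex) \<Rightarrow> ('a list \<Rightarrow>\<^sub>0 complex) \<Rightarrow> ('a list \<Rightarrow>\<^sub>0 complex)" where
  "shuffle = bilin_ext shuffle_words"

text \<open>The first argument of \<open>yx_from\<close> is the preceding entry \<open>m\<^bsub>i-1\<^esub>\<close>, with \<open>m\<^sub>0 = 0\<close>.\<close>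

fun yx_from :: "rat \<Rightarrow> biindex \<Rightarrow> xletter list" where
  "yx_from l [] = []"
| "yx_from l ((k, m) # w) = Ly (m - l) # replicate (k - 1) Lx @ yx_from m w"

definition yx :: "biindex \<Rightarrow> xletter list" where
  "yx w = yx_from 0 w"

definition QX1 :: "complex \<Rightarrow> (xletter list \<Rightarrow>\<^sub>0 complex) set" where
  "QX1 \<mu> = span_over (Q_adjoin \<mu>) scale ({basis_elt []} \<union> {basis_elt (yx w) | w. positive w})"

definition QX0 :: "complex \<Rightarrow> (xletter list \<Rightarrow>\<^sub>0 complex) set" where
  "QX0 \<mu> = span_over (Q_adjoin \<mu>) scale
     ({basis_elt []} \<union> {basis_elt (yx w) | w. admissible w} \<union>
      {basis_elt (yx (u @ [(1, m)])) - basis_elt (yx (u @ [(1, m')])) | u m m'. special u m m'})"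

definition zeta_sh :: "complex \<Rightarrow> (xletter list \<Rightarrow>\<^sub>0 complex) \<Rightarrow> complex" where
  "zeta_sh \<mu> = (THE F.
     F \<in> extensional (QX0 \<mu>) \<and>
     linear_over (Q_adjoin \<mu>) scale (*) (QX0 \<mu>) F \<and>
     F (basis_elt []) = 1 \<and>
     (\<forall>w. admissible w \<longrightarrow> F (basis_elt (yx w)) = zeta_mu \<mu> w) \<and>
     (\<forall>u m m'. special u m m' \<longrightarrow>
        F (basis_elt (yx (u @ [(1, m)])) - basis_elt (yx (u @ [(1, m')]))) = D_mu \<mu> u m m'))"

definition zeta_sh_reg :: "complex \<Rightarrow> rat \<Rightarrow> (xletter list \<Rightarrow>\<^sub>0 complex) \<Rightarrow> complex poly" where
  "zeta_sh_reg \<mu> m = (THE F.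
     F \<in> QX1 \<mu> \<rightarrow>\<^sub>E Z_mu_T \<mu> \<and>
     linear_over (Q_adjoin \<mu>) scale smult (QX1 \<mu>) F \<and>
     (\<forall>w\<in>QX0 \<mu>. F w = [:zeta_sh \<mu> w:]) \<and>
     F (basis_elt [Ly m]) = [:0, 1:] \<and>
     (\<forall>u\<in>QX1 \<mu>. \<forall>v\<in>QX1 \<mu>. F (shuffle u v) = F u * F v))"


section \<open>The comparison maps\<close>

text \<open>As a formal map, \<open>\<phi>\<^sub>\<mu>\<close> is the restriction of this one to \<^term>\<open>QY \<mu>\<close>.\<close>

definition phi :: "(biindex \<Rightarrow>\<^sub>0 complex) \<Rightarrow> (xletter list \<Rightarrow>\<^sub>0 complex)" where
  "phi = lin_ext (\<lambda>w. basis_elt (yx w))"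

definition H :: "complex \<Rightarrow> complex" where
  "H x = integral {0..1} (\<lambda>t :: real. (1 - of_real t powr x) / (1 - of_real t))"

definition c_mu :: "complex \<Rightarrow> rat \<Rightarrow> rat \<Rightarrow> complex" where
  "c_mu \<mu> a b = H (of_rat b / \<mu> - 1) - H (of_rat a / \<mu> - 1)"

definition rho_mu :: "complex \<Rightarrow> rat \<Rightarrow> rat \<Rightarrow> complex poly \<Rightarrow> complex poly" where
  "rho_mu \<mu> m m' p = (\<Sum>s\<le>degree p. smult (coeff p s) ([:c_mu \<mu> m m', 1:] ^ s))"

abbreviation C_linear :: "(complex poly \<Rightarrow> complex poly) \<Rightarrow> bool" where
  "C_linear \<equiv> Vector_Spaces.linear smult smult"

end

theory Submission
  imports Defs "HOL-Real_Asymp.Real_Asymp"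
begin

text \<open>
  Both regularised maps are read off from asymptotic expansions. On the stuffle side a word \<open>w\<close> is
  evaluated by its truncated sums \<open>S\<^sub>N(w)\<close> for \<open>N \<rightarrow> \<infinity>\<close>, on the shuffle side by the value
  \<open>L\<^sub>w(e\<^bsup>-s\<^esup>)\<close> of its iterated integral for \<open>s \<rightarrow> 0\<close>. Both evaluations are multiplicative, and the
  evaluation \<open>t\<close> of the letter attached to \<open>m\<close> tends to infinity, more slowly than any power of
  \<open>N\<close> or \<open>1/s\<close>. A word that already converges equals its limit up to an error that beats every power of \<open>t\<close>, and every word is
  generated by convergent ones and that letter. So the evaluation of every word is a polynomial in \<open>t\<close> up
  to such an error, and this polynomial is the value of the regularised map.

  Replacing \<open>m\<close> by \<open>m'\<close> changes \<open>t\<close> by the constant \<open>\<Sum>\<^sub>n (\<mu>/(n\<mu>+m) - \<mu>/(n\<mu>+m'))\<close>, which is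
  \<open>c\<^bsub>m,m'\<^esub>\<close> by expanding \<open>1/(1-t)\<close> in the integral defining \<open>H\<close>; this gives the first two parts.

  For the third part, \<open>L\<^bsub>\<phi>(w)\<^esub>(e\<^bsup>-s\<^esup>)\<close> is, up to a vanishing error, the Abel mean
  \<open>(1-q) \<Sum>\<^sub>N S\<^sub>N(w) q\<^sup>N\<close> with \<open>q = e\<^bsup>-\<mu>s\<^esup>\<close>. Abel means are linear and send null sequences to null
  functions. If \<open>w\<close> has stuffle polynomial \<open>\<Sum>\<^sub>j p\<^sub>j T\<^sup>j\<close> and \<open>v\<^sub>j\<close> has stuffle polynomial \<open>T\<^sup>j\<close>, then
  \<open>\<phi>(w)\<close> therefore has the same shuffle polynomial as \<open>\<Sum>\<^sub>j p\<^sub>j \<phi>(v\<^sub>j)\<close>.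
\<close>

section \<open>Linear extensions and spans\<close>

text \<open>The stuffle polynomial of \<open>w\<close> has coefficients in \<open>Z_mu\<close>,
  which need not lie in \<open>Q_adjoin\<close>. A combination of the \<open>v j\<close> with these
  coefficients need therefore not be an element of \<open>QY\<close>, and \<open>zeta_sh_reg\<close>
  cannot be applied to its image. This is why the third part compares sequences of complex numbers,
  on which Abel means are linear over all of C, and returns to polynomials only in the limit. Abel
  means fit because the coefficients of the power series of \<open>yx w\<close> have the truncated
  sums of \<open>w\<close> as partial sums, and division by 1 - q forms partial sums.

  The regularised maps and \<open>zeta_sh\<close> are definite descriptions. For the former,
  expansions give existence and generation by one letter gives uniqueness. For
  \<open>zeta_sh\<close>, the limit shows that the prescribed values respect every linear relation
  among the spanning elements.

  The maps of T are unique because the j-th power of the divergent letter has value T^j, so every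
  monomial is attained.

  The shuffle identity is proved for formal power series, where integration divides coefficients and
  no branch of a complex power enters.\<close>

lemma lookup_scale [simp]: "Poly_Mapping.lookup (scale c p) w = c * Poly_Mapping.lookup p w"
  unfolding scale_def by (simp add: Poly_Mapping.map.rep_eq when_def)

interpretation scale: vector_space "scale :: complex \<Rightarrow> ('a \<Rightarrow>\<^sub>0 complex) \<Rightarrow> ('a \<Rightarrow>\<^sub>0 complex)"
  by standard (auto intro!: poly_mapping_eqI simp: lookup_add algebra_simps)

lemma scale_single [simp]: "scale c (Poly_Mapping.single w d) = Poly_Mapping.single w (c * d)"
  by (rule poly_mapping_eqI) (simp add: lookup_single when_def)

lemma keys_scale_subset: "Poly_Mapping.keys (scale c p) \<subseteq> Poly_Mapping.keys p"
  by (auto simp: in_keys_iff)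

lemma sum_scale_basis_elt:
  "p = (\<Sum>w\<in>Poly_Mapping.keys p. scale (Poly_Mapping.lookup p w) (basis_elt w))"
proof (rule poly_mapping_eqI)
  fix v
  show "Poly_Mapping.lookup p v = Poly_Mapping.lookup
      (\<Sum>w\<in>Poly_Mapping.keys p. scale (Poly_Mapping.lookup p w) (basis_elt w)) v"
    by (auto simp: lookup_sum lookup_single when_def in_keys_iff)
qed

definition lin_val :: "('a \<Rightarrow> complex) \<Rightarrow> ('a \<Rightarrow>\<^sub>0 complex) \<Rightarrow> complex" where
  "lin_val f p = (\<Sum>w\<in>Poly_Mapping.keys p. Poly_Mapping.lookup p w * f w)"

lemma lin_val_superset:
  assumes "finite S" "Poly_Mapping.keys p \<subseteq> S"
  shows "lin_val f p = (\<Sum>w\<in>S. Poly_Mapping.lookup p w * f w)"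
  unfolding lin_val_def using assms by (intro sum.mono_neutral_left) (auto simp: in_keys_iff)

lemma lin_val_add [simp]: "lin_val f (p + q) = lin_val f p + lin_val f q"
proof -
  let ?S = "Poly_Mapping.keys p \<union> Poly_Mapping.keys q"
  have "lin_val f (p + q) = (\<Sum>w\<in>?S. Poly_Mapping.lookup (p + q) w * f w)"
    by (rule lin_val_superset) (simp_all add: Poly_Mapping.keys_add)
  then show ?thesis
    by (simp add: lin_val_superset[of ?S p] lin_val_superset[of ?S q] lookup_add
        algebra_simps sum.distrib)
qed

lemma lin_val_scale [simp]: "lin_val f (scale c p) = c * lin_val f p"
  using lin_val_superset[OF _ keys_scale_subset, of p f c]
  by (simp add: lin_val_def[of _ p] sum_distrib_left mult.assoc)

lemma lin_val_0 [simp]: "lin_val f 0 = 0"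
  by (simp add: lin_val_def)

lemma lin_val_single [simp]: "lin_val f (Poly_Mapping.single w c) = c * f w"
  by (simp add: lin_val_def)

lemma lin_val_uminus [simp]: "lin_val f (- p) = - lin_val f p"
  using lin_val_add[of f p "- p"] by (simp add: eq_neg_iff_add_eq_0 add.commute)

lemma lin_val_diff [simp]: "lin_val f (p - q) = lin_val f p - lin_val f q"
  using lin_val_add[of f p "- q"] by simp

lemma lin_val_sum: "lin_val f (\<Sum>i\<in>A. p i) = (\<Sum>i\<in>A. lin_val f (p i))"
  by (induction A rule: infinite_finite_induct) auto

lemma lin_val_bilin_ext:
  "lin_val f (bilin_ext g p q) = (\<Sum>u\<in>Poly_Mapping.keys p. \<Sum>v\<in>Poly_Mapping.keys q.
     Poly_Mapping.lookup p u * Poly_Mapping.lookup q v * lin_val f (g u v))"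
  by (simp add: bilin_ext_def lin_val_sum)

lemma lin_val_bilin_ext_mult:
  assumes "\<And>u v. u \<in> Poly_Mapping.keys p \<Longrightarrow> v \<in> Poly_Mapping.keys q \<Longrightarrow>
    lin_val f (g u v) = h u * k v"
  shows "lin_val f (bilin_ext g p q) = lin_val h p * lin_val k q"
  unfolding lin_val_bilin_ext lin_val_def[of h] lin_val_def[of k] sum_product
  by (intro sum.cong refl) (simp add: assms)

lemma lin_val_append_letters:
  assumes "\<And>w a. w \<in> Poly_Mapping.keys p \<Longrightarrow> a \<in> Poly_Mapping.keys q \<Longrightarrow> f (w @ [a]) = h w * k a"
  shows "lin_val f (append_letters p q) = lin_val h p * lin_val k q"
  unfolding append_letters_def by (rule lin_val_bilin_ext_mult) (simp add: assms)

lemma lin_val_lin_ext: "lin_val f (lin_ext g p) = lin_val (\<lambda>w. lin_val f (g w)) p"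
  by (simp add: lin_ext_def lin_val_sum lin_val_def[of _ p])

lemma bilin_ext_basis_elt [simp]: "bilin_ext g (basis_elt u) (basis_elt v) = g u v"
  by (simp add: bilin_ext_def)

lemma append_letters_single:
  "append_letters (basis_elt u) (basis_elt x) = basis_elt (u @ [x])"
  by (simp add: append_letters_def)

lemma lookup_eq_lin_val: "Poly_Mapping.lookup p w = lin_val (\<lambda>v. if v = w then 1 else 0) p"
  by (auto simp: lin_val_def if_distrib in_keys_iff cong: if_cong)

text \<open>Coordinates are themselves functionals of the form \<open>lin_val f\<close>, so these
  functionals separate points. Identities for \<open>append_letters\<close> thus reduce to
  identities between sums of numbers.\<close>

lemma poly_mapping_eq_lin_valI: "(\<And>f. lin_val f p = lin_val f q) \<Longrightarrow> p = q"
  by (rule poly_mapping_eqI) (simp add: lookup_eq_lin_val)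

lemma append_letters_add_left:
  "append_letters (p + q) r = append_letters p r + append_letters q r"
proof (rule poly_mapping_eq_lin_valI)
  fix f :: "'a list \<Rightarrow> complex"
  have *: "lin_val f (append_letters p r) = lin_val (\<lambda>w. lin_val (\<lambda>a. f (w @ [a])) r) p" for p
    by (simp add: append_letters_def lin_val_bilin_ext lin_val_def[of _ p] lin_val_def[of _ r]
        sum_distrib_left mult.assoc)
  show "lin_val f (append_letters (p + q) r) =
      lin_val f (append_letters p r + append_letters q r)"
    by (simp add: *)
qed

lemma append_letters_zero_left [simp]: "append_letters 0 r = 0"
  by (simp add: append_letters_def bilin_ext_def)

lemma append_letters_sum_left:
  "append_letters (\<Sum>i\<in>A. p i) r = (\<Sum>i\<in>A. append_letters (p i) r)"
  by (induction A rule: infinite_finite_induct) (auto simp: append_letters_add_left)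

lemma append_letters_diff_left:
  "append_letters (p - q) r = append_letters p r - append_letters q r"
  using append_letters_add_left[of "p - q" q r] by (simp add: algebra_simps)

section \<open>Submodules over a set of scalars\<close>

definition submod :: "complex set \<Rightarrow> (complex \<Rightarrow> 'v \<Rightarrow> 'v) \<Rightarrow> 'v :: ab_group_add set \<Rightarrow> bool" where
  "submod R sc G \<longleftrightarrow>
     0 \<in> G \<and> (\<forall>x\<in>G. \<forall>y\<in>G. x + y \<in> G) \<and> (\<forall>c\<in>R. \<forall>x\<in>G. sc c x \<in> G)"

lemma submodD:
  assumes "submod R sc G"
  shows "0 \<in> G" and "x \<in> G \<Longrightarrow> y \<in> G \<Longrightarrow> x + y \<in> G" and "c \<in> R \<Longrightarrow> x \<in> G \<Longrightarrow> sc c x \<in> G"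
  using assms by (auto simp: submod_def)

lemma submod_sum:
  assumes "submod R sc G" "\<And>i. i \<in> A \<Longrightarrow> f i \<in> G"
  shows "(\<Sum>i\<in>A. f i) \<in> G"
  using assms(2) by (induction A rule: infinite_finite_induct) (auto intro: submodD[OF assms(1)])

lemma span_over_subset:
  assumes "submod R sc G" "S \<subseteq> G"
  shows "span_over R sc S \<subseteq> G"
  using assms by (auto simp: span_over_def intro!: submod_sum[OF assms(1)] submodD(3)[OF assms(1)])

lemma span_over_base:
  assumes "module sc" "1 \<in> R" "x \<in> S"
  shows "x \<in> span_over R sc S"
  unfolding span_over_def using assms
  by (auto intro!: exI[of _ "{x}"] exI[of _ "\<lambda>_. 1"] simp: module.scale_one)

text \<open>The rationals are included because the generation argument below divides by a
  multiplicity; they also supply 0, 1 and -1.\<close>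

definition scalar_ring :: "complex set \<Rightarrow> bool" where
  "scalar_ring R \<longleftrightarrow> (\<forall>q. of_rat q \<in> R) \<and> (\<forall>a\<in>R. \<forall>b\<in>R. a + b \<in> R \<and> a * b \<in> R)"

lemma scalar_ringD:
  assumes "scalar_ring R"
  shows "of_rat q \<in> R" "a \<in> R \<Longrightarrow> b \<in> R \<Longrightarrow> a + b \<in> R" "a \<in> R \<Longrightarrow> b \<in> R \<Longrightarrow> a * b \<in> R"
    "0 \<in> R" "1 \<in> R" "- 1 \<in> R" "a \<in> R \<Longrightarrow> - a \<in> R"
proof -
  show 1: "of_rat q \<in> R" "a \<in> R \<Longrightarrow> b \<in> R \<Longrightarrow> a + b \<in> R" "a \<in> R \<Longrightarrow> b \<in> R \<Longrightarrow> a * b \<in> R" for a b q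
    using assms by (auto simp: scalar_ring_def)
  show "0 \<in> R" "1 \<in> R" using 1(1)[of 0] 1(1)[of 1] by auto
  show 2: "- 1 \<in> R" using 1(1)[of "- 1"] by (simp add: of_rat_minus)
  show "a \<in> R \<Longrightarrow> - a \<in> R" using 1(3)[OF 2, of a] by simp
qed

lemma submod_span_over:
  fixes sc :: "complex \<Rightarrow> 'v \<Rightarrow> 'v :: ab_group_add"
  assumes "module sc" and R: "scalar_ring R"
  shows "submod R sc (span_over R sc S)"
proof -
  interpret module sc by fact
  note R = scalar_ringD[OF R]
  show ?thesis
    unfolding submod_def
  proof (intro conjI ballI)
    show "0 \<in> span_over R sc S"
      by (auto simp: span_over_def intro!: exI[of _ "{}"])
  next
    fix x y assume "x \<in> span_over R sc S" "y \<in> span_over R sc S"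
    then obtain A c B d where
      A: "x = (\<Sum>v\<in>A. sc (c v) v)" "finite A" "A \<subseteq> S" "\<forall>v\<in>A. c v \<in> R" and
      B: "y = (\<Sum>v\<in>B. sc (d v) v)" "finite B" "B \<subseteq> S" "\<forall>v\<in>B. d v \<in> R"
      unfolding span_over_def by blast
    \<comment> \<open>The two representations may have different supports, so both are extended by 0
      to the union.\<close>
    let ?c = "\<lambda>v. if v \<in> A then c v else 0" and ?d = "\<lambda>v. if v \<in> B then d v else 0"
    have x: "x = (\<Sum>v\<in>A \<union> B. sc (?c v) v)"
      unfolding A(1) using A(2) B(2) by (intro sum.mono_neutral_cong_left) auto
    have y: "y = (\<Sum>v\<in>A \<union> B. sc (?d v) v)"
      unfolding B(1) using A(2) B(2) by (intro sum.mono_neutral_cong_left) auto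
    have "x + y = (\<Sum>v\<in>A \<union> B. sc (?c v + ?d v) v)"
      unfolding x y by (simp add: scale_left_distrib sum.distrib)
    moreover have "\<forall>v\<in>A \<union> B. ?c v + ?d v \<in> R"
      using A(4) B(4) R by auto
    ultimately show "x + y \<in> span_over R sc S"
      unfolding span_over_def using A(2,3) B(2,3)
      by (intro CollectI exI[of _ "A \<union> B"] exI[of _ "\<lambda>v. ?c v + ?d v"]) auto
  next
    fix a x assume a: "a \<in> R" and "x \<in> span_over R sc S"
    then obtain A c where
      A: "x = (\<Sum>v\<in>A. sc (c v) v)" "finite A" "A \<subseteq> S" "\<forall>v\<in>A. c v \<in> R"
      unfolding span_over_def by blast
    have "sc a x = (\<Sum>v\<in>A. sc (a * c v) v)"
      unfolding A(1) by (simp add: scale_sum_right)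
    then show "sc a x \<in> span_over R sc S"
      unfolding span_over_def using A(2,3,4) a R
      by (intro CollectI exI[of _ A] exI[of _ "\<lambda>v. a * c v"]) auto
  qed
qed

lemma submod_uminus:
  assumes "submod R scale G" "scalar_ring R" "x \<in> G"
  shows "- x \<in> G"
  using submodD(3)[OF assms(1) scalar_ringD(6)[OF assms(2)] assms(3)] by simp

lemma submod_diff:
  assumes "submod R scale G" "scalar_ring R" "x \<in> G" "y \<in> G"
  shows "x - y \<in> G"
  using submodD(2)[OF assms(1) assms(3) submod_uminus[OF assms(1,2,4)]] by simp

text \<open>Uniqueness tool: two linear maps that agree on spanning elements agree on the whole
  span, because the set of agreement is closed.\<close>

lemma linear_over_cong_span:
  assumes sc: "module (sc :: complex \<Rightarrow> 'w \<Rightarrow> 'w :: ab_group_add)" and V: "submod R scale V"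
    and F: "linear_over R scale sc V F" and F': "linear_over R scale sc V F'"
  shows "submod R scale {x \<in> V. F x = F' x}"
proof -
  have "F 0 + F 0 = F (0 + 0)" "F' 0 + F' 0 = F' (0 + 0)"
    using F F' submodD(1)[OF V] unfolding linear_over_def by metis+
  then have "F 0 = F' 0" by simp
  then show ?thesis
    using assms unfolding submod_def linear_over_def by auto
qed

text \<open>Both \<open>QY\<close> and \<open>QX1\<close> have this form, for positive bi-indices
  and for valid words respectively, so one locale can serve both sides.\<close>

definition words_over :: "complex set \<Rightarrow> 'a set \<Rightarrow> ('a \<Rightarrow>\<^sub>0 complex) set" where
  "words_over R V = {p. Poly_Mapping.keys p \<subseteq> V \<and> (\<forall>w. Poly_Mapping.lookup p w \<in> R)}"

lemma submod_words_over: "scalar_ring R \<Longrightarrow> submod R scale (words_over R V)"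
  unfolding submod_def words_over_def
proof (intro conjI ballI)
  fix x y assume "scalar_ring R"
    "x \<in> {p. Poly_Mapping.keys p \<subseteq> V \<and> (\<forall>w. Poly_Mapping.lookup p w \<in> R)}"
    "y \<in> {p. Poly_Mapping.keys p \<subseteq> V \<and> (\<forall>w. Poly_Mapping.lookup p w \<in> R)}"
  then show "x + y \<in> {p. Poly_Mapping.keys p \<subseteq> V \<and> (\<forall>w. Poly_Mapping.lookup p w \<in> R)}"
    using Poly_Mapping.keys_add[of x y] by (auto simp: lookup_add scalar_ringD)
next
  fix c x assume "scalar_ring R" "c \<in> R"
    "x \<in> {p. Poly_Mapping.keys p \<subseteq> V \<and> (\<forall>w. Poly_Mapping.lookup p w \<in> R)}"
  then show "scale c x \<in> {p. Poly_Mapping.keys p \<subseteq> V \<and> (\<forall>w. Poly_Mapping.lookup p w \<in> R)}"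
    using keys_scale_subset[of c x] by (auto simp: scalar_ringD)
qed (auto simp: scalar_ringD)

lemma basis_elt_words_over: "scalar_ring R \<Longrightarrow> w \<in> V \<Longrightarrow> basis_elt w \<in> words_over R V"
  by (auto simp: words_over_def lookup_single when_def scalar_ringD)

lemma words_over_subset:
  assumes "submod R scale G" "\<And>w. w \<in> V \<Longrightarrow> basis_elt w \<in> G"
  shows "words_over R V \<subseteq> G"
proof
  fix p assume p: "p \<in> words_over R V"
  have "(\<Sum>w\<in>Poly_Mapping.keys p. scale (Poly_Mapping.lookup p w) (basis_elt w)) \<in> G"
    using p assms by (intro submod_sum[OF assms(1)] submodD(3)[OF assms(1)]) (auto simp: words_over_def)
  then show "p \<in> G"
    by (subst sum_scale_basis_elt)
qed

lemma span_over_basis_elt: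
  assumes "scalar_ring R"
  shows "span_over R scale (basis_elt ` V) = words_over R V"
proof
  show "span_over R scale (basis_elt ` V) \<subseteq> words_over R V"
    using assms by (intro span_over_subset submod_words_over) (auto intro: basis_elt_words_over)
  show "words_over R V \<subseteq> span_over R scale (basis_elt ` V)"
    using assms by (intro words_over_subset submod_span_over span_over_base)
      (auto simp: scale.module_axioms scalar_ringD)
qed

lemma bilin_ext_in_submod:
  assumes R: "scalar_ring R" and G: "submod R scale G"
    and "p \<in> words_over R U" "q \<in> words_over R V"
    and "\<And>u v. u \<in> U \<Longrightarrow> v \<in> V \<Longrightarrow> g u v \<in> G"
  shows "bilin_ext g p q \<in> G"
  unfolding bilin_ext_def using assms(3,4)
  by (intro submod_sum[OF G] submodD(3)[OF G] scalar_ringD(3)[OF R] assms(5))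
    (auto simp: words_over_def)

lemma append_letters_words_over:
  assumes "scalar_ring R" "p \<in> words_over R U" "q \<in> words_over R V"
    and "\<And>u a. u \<in> U \<Longrightarrow> a \<in> V \<Longrightarrow> u @ [a] \<in> W"
  shows "append_letters p q \<in> words_over R W"
  unfolding append_letters_def using assms
  by (intro bilin_ext_in_submod[of R _ p U q V]) (auto intro: submod_words_over basis_elt_words_over)

section \<open>Generation by one letter\<close>

text \<open>\<open>S u\<close> stands for the product of \<open>u\<close> with the letter
  \<open>y\<close>; its part of top length inserts \<open>y\<close> at every position of
  \<open>u\<close>. The induction is lexicographic in the length, the number of letters other than
  \<open>y\<close>, and the number of trailing letters \<open>y\<close>. A word ending in another
  letter lies in \<open>G\<close> or is congruent modulo \<open>G\<close> to a word with one more
  \<open>y\<close>. For a word p y^(d+1) with p not ending in \<open>y\<close>, the product of p y^d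
  with \<open>y\<close> contains it d+1 times; the other insertions have fewer trailing letters
  \<open>y\<close> and the remaining terms are shorter. Dividing by d+1 isolates the word.\<close>

lemma generated_by_letter:
  fixes y :: 'a and S :: "'a list \<Rightarrow> ('a list \<Rightarrow>\<^sub>0 complex)"
  assumes R: "scalar_ring R" and G: "submod R scale G" and nil: "basis_elt [] \<in> G"
    and prefix: "\<And>u x. u @ [x] \<in> V \<Longrightarrow> u \<in> V"
    and ins: "\<And>u v. u @ v \<in> V \<Longrightarrow> u @ y # v \<in> V"
    and S_ins: "\<And>u. u \<in> V \<Longrightarrow>
      S u - (\<Sum>i\<le>length u. basis_elt (take i u @ y # drop i u)) \<in>
        words_over R {v \<in> V. length v \<le> length u}"
    and SG: "\<And>u. u \<in> V \<Longrightarrow> basis_elt u \<in> G \<Longrightarrow> S u \<in> G"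
    and last: "\<And>u x. u @ [x] \<in> V \<Longrightarrow> x \<noteq> y \<Longrightarrow>
      basis_elt (u @ [x]) \<in> G \<or> basis_elt (u @ [x]) - basis_elt (u @ [y]) \<in> G"
    and "w \<in> V"
  shows "basis_elt w \<in> G"
  using \<open>w \<in> V\<close>
proof (induction w rule: wf_induct_rule[OF wf_inv_image[of "less_than <*lex*> less_than <*lex*> less_than"
        "\<lambda>w. (length w, length w - count_list w y, length (takeWhile ((=) y) (rev w)))"]])
  case 1
  show ?case by (intro wf_lex_prod wf_less_than)
next
  case (2 w)
  have short: "basis_elt v \<in> G" if "v \<in> V" "length v < length w" for v
    using 2 that by simp
  have more: "basis_elt v \<in> G"
    if "v \<in> V" "length v = length w" "count_list v y > count_list w y" for v
  proof -
    have "length v - count_list v y < length w - count_list w y"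
      using that(2,3) count_le_length[of v y] by linarith
    with that show ?thesis using 2(1)[of v] by simp
  qed
  have trail: "basis_elt v \<in> G"
    if "v \<in> V" "length v = length w" "count_list v y = count_list w y"
      "length (takeWhile ((=) y) (rev v)) < length (takeWhile ((=) y) (rev w))" for v
    using 2(1)[of v] that by simp
  show ?case
  proof (cases w rule: rev_cases)
    case Nil
    then show ?thesis using nil by simp
  next
    case (snoc u x)
    show ?thesis
    proof (cases "x = y")
      case False
      have "u @ [y] \<in> V"
        using ins[of u "[]"] prefix[of u x] 2(2) snoc by simp
      then have "basis_elt (u @ [y]) \<in> G"
        using False snoc by (intro more) auto
      then have "basis_elt (u @ [x]) - basis_elt (u @ [y]) \<in> G \<Longrightarrow> basis_elt (u @ [x]) \<in> G"
        using submodD(2)[OF G, of "basis_elt (u @ [x]) - basis_elt (u @ [y])"] by fastforce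
      then show ?thesis
        using last[of u x] 2(2) False snoc by blast
    next
      case True
      define e where "e = length (takeWhile ((=) y) (rev w))"
      define p where "p = rev (dropWhile ((=) y) (rev w))"
      have tw: "takeWhile ((=) y) (rev w) = replicate e y"
        unfolding e_def by (rule replicate_length_same[symmetric]) (metis set_takeWhileD)
      have "rev w = replicate e y @ dropWhile ((=) y) (rev w)"
        by (simp flip: tw)
      from arg_cong[OF this, of rev] have "w = p @ replicate e y"
        by (simp only: p_def rev_append rev_replicate rev_rev_ident)
      moreover have "e > 0" using True snoc by (simp add: e_def)
      then obtain d where d: "e = Suc d" by (cases e) auto
      ultimately have w: "w = (p @ replicate d y) @ [y]" by (simp add: replicate_append_same)
      define v where "v = p @ replicate d y"
      have v: "v \<in> V" using prefix 2(2) w unfolding v_def by blast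
      have p: "List.last p \<noteq> y" if "p \<noteq> []"
        using that hd_dropWhile[of "(=) y" "rev w"] unfolding p_def by (auto simp: last_rev)
      let ?b = "\<lambda>i. basis_elt (take i v @ y # drop i v) :: 'a list \<Rightarrow>\<^sub>0 complex"
      \<comment> \<open>An insertion inside \<open>p\<close> leaves the last letter of
        \<open>p\<close>, which differs from \<open>y\<close>, in front of the final block. That
        block then has length d instead of d+1.\<close>
      have "?b i \<in> G" if i: "i < length p" for i
      proof (rule trail)
        show "take i v @ y # drop i v \<in> V"
          using ins[of "take i v" "drop i v"] v by simp
        show "length (take i v @ y # drop i v) = length w"
          using i by (simp add: v_def w)
        have "count_list v y = count_list (take i v) y + count_list (drop i v) y"
          by (metis append_take_drop_id count_list_append)
        then show "count_list (take i v @ y # drop i v) y = count_list w y"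
          by (simp add: w v_def[symmetric])
        obtain a q where aq: "drop i p = q @ [a]"
          using i by (cases "drop i p" rule: rev_cases) auto
        have "List.last p = a" using last_drop[OF i] aq by simp
        moreover have "p \<noteq> []" using i by auto
        ultimately have "a \<noteq> y" using p by simp
        then have "takeWhile ((=) y) (rev (take i v @ y # drop i v)) = replicate d y"
          using i aq by (simp add: v_def takeWhile_append)
        then show "length (takeWhile ((=) y) (rev (take i v @ y # drop i v)))
            < length (takeWhile ((=) y) (rev w))"
          by (simp add: e_def[symmetric] d)
      qed
      then have 1: "(\<Sum>i<length p. ?b i) \<in> G"
        by (intro submod_sum[OF G]) auto
      have "basis_elt v \<in> G" using v w by (intro short) (auto simp: v_def)
      then have 2: "S v \<in> G" using SG v by blast
      have 3: "S v - (\<Sum>i\<le>length v. ?b i) \<in> G"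
      proof (rule subsetD[OF words_over_subset[OF G] S_ins[OF v]])
        fix u assume "u \<in> {u \<in> V. length u \<le> length v}"
        then show "basis_elt u \<in> G" using w by (intro short) (auto simp: v_def)
      qed
      \<comment> \<open>Each of the d+1 insertions into the final block of letters \<open>y\<close>
        gives \<open>w\<close> again.\<close>
      have 4: "?b i = basis_elt w" if "i \<in> {length p..length v}" for i
      proof -
        obtain j where j: "i = length p + j" "j \<le> d"
          using \<open>i \<in> _\<close> le_iff_add[of "length p" i] by (auto simp: v_def)
        have "take i v @ y # drop i v = p @ replicate j y @ y # replicate (d - j) y"
          using j by (simp add: v_def min_def)
        also have "replicate j y @ y # replicate (d - j) y = replicate (j + Suc (d - j)) y"
          by (subst replicate_add) simp
        also have "p @ \<dots> = w" using j w by (simp add: replicate_append_same flip: replicate_Suc)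
        finally show ?thesis by simp
      qed
      have "(\<Sum>i\<le>length v. ?b i) = (\<Sum>i<length p. ?b i) + (\<Sum>i\<in>{length p..length v}. ?b i)"
        by (subst sum.union_disjoint[symmetric]) (auto simp: v_def intro!: sum.cong)
      also have "(\<Sum>i\<in>{length p..length v}. ?b i) = (\<Sum>i\<in>{length p..length v}. basis_elt w)"
        using 4 by (intro sum.cong refl)
      also have "\<dots> = scale (of_nat (Suc d)) (basis_elt w)"
        by (subst scale.sum_constant_scale) (simp add: v_def)
      finally have "scale (of_nat (Suc d)) (basis_elt w) =
          S v - (S v - (\<Sum>i\<le>length v. ?b i)) - (\<Sum>i<length p. ?b i)"
        by simp
      then have "scale (of_nat (Suc d)) (basis_elt w) \<in> G"
        by (simp only: submod_diff[OF G R] 1 2 3)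
      then have "scale (of_rat (1 / of_nat (Suc d))) (scale (of_nat (Suc d)) (basis_elt w)) \<in> G"
        using submodD(3)[OF G scalar_ringD(1)[OF R]] by blast
      moreover have "of_rat (1 / of_nat (Suc d)) * (of_nat (Suc d) :: complex) = 1"
        by (simp add: of_rat_divide of_rat_add del: of_nat_Suc)
      ultimately show ?thesis
        by (simp del: of_nat_Suc)
    qed
  qed
qed

section \<open>Regularisation by asymptotic expansion\<close>

text \<open>A nonconstant polynomial tends to infinity along \<open>t\<close>, and a constant one
  equals its limit. This makes the polynomial in an asymptotic expansion unique.\<close>

lemma poly_filterlim_at_infinity_eq_0:
  fixes p :: "complex poly"
  assumes "((\<lambda>i. poly p (t i)) \<longlongrightarrow> 0) Fl" "filterlim t at_infinity Fl" "Fl \<noteq> bot"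
  shows "p = 0"
proof (cases "degree p = 0")
  case True
  then obtain c where p: "p = [:c:]" by (metis degree_eq_zeroE)
  then have "((\<lambda>_. c) \<longlongrightarrow> 0) Fl" using assms(1) by simp
  then have "c = 0" using tendsto_unique[OF assms(3)] tendsto_const by blast
  then show ?thesis using p by simp
next
  case False
  then have "filterlim (poly p) at_infinity at_infinity"
    by (simp add: filterlim_poly_at_infinity)
  then have "filterlim (\<lambda>i. poly p (t i)) at_infinity Fl"
    using assms(2) filterlim_compose by blast
  then show ?thesis
    using assms(1,3) not_tendsto_and_filterlim_at_infinity by blast
qed

text \<open>\<open>val i\<close> evaluates words at stage \<open>i\<close>, which is a truncation
  bound on the stuffle side and the parameter s on the shuffle side. \<open>A0\<close> holds the
  convergent elements, \<open>z\<close> their limits, and \<open>y\<close> is the divergent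
  one-letter word. \<open>val_mul\<close> holds only eventually because the iterated integrals need
  s > 0; \<open>generated\<close> is an induction principle; \<open>unit\<close> provides the power
  T^0.\<close>

locale regularisation =
  fixes R :: "complex set" and V :: "'a set" and A0 :: "('a \<Rightarrow>\<^sub>0 complex) set"
    and mul :: "('a \<Rightarrow>\<^sub>0 complex) \<Rightarrow> ('a \<Rightarrow>\<^sub>0 complex) \<Rightarrow> ('a \<Rightarrow>\<^sub>0 complex)"
    and val :: "'i \<Rightarrow> 'a \<Rightarrow> complex" and Fl :: "'i filter"
    and z :: "('a \<Rightarrow>\<^sub>0 complex) \<Rightarrow> complex" and Z :: "complex set" and y :: 'a
  assumes R: "scalar_ring R" and Fl: "Fl \<noteq> bot"
    and A0: "A0 \<subseteq> words_over R V" and y: "y \<in> V"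
    and mul: "u \<in> words_over R V \<Longrightarrow> v \<in> words_over R V \<Longrightarrow> mul u v \<in> words_over R V"
    and val_mul: "u \<in> words_over R V \<Longrightarrow> v \<in> words_over R V \<Longrightarrow>
      \<forall>\<^sub>F i in Fl. lin_val (val i) (mul u v) = lin_val (val i) u * lin_val (val i) v"
    and generated: "submod R scale G \<Longrightarrow> G \<subseteq> words_over R V \<Longrightarrow> A0 \<subseteq> G \<Longrightarrow>
      (\<And>u. u \<in> G \<Longrightarrow> mul u (basis_elt y) \<in> G) \<Longrightarrow> words_over R V \<subseteq> G"
    and y_infinity: "filterlim (\<lambda>i. val i y) at_infinity Fl"
    and A0_val: "w \<in> A0 \<Longrightarrow> ((\<lambda>i. (lin_val (val i) w - z w) * val i y ^ j) \<longlongrightarrow> 0) Fl"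
    and Z: "submod R (*) Z" and z_in_Z: "w \<in> A0 \<Longrightarrow> z w \<in> Z"
    and unit: "\<exists>w\<in>A0. z w = 1"
begin

abbreviation "A \<equiv> words_over R V"

text \<open>The error is required to beat every power of \<^term>\<open>val i y\<close>, not just to tend to \<open>0\<close>: this
  is what makes the relation multiplicative.\<close>

definition asym :: "('a \<Rightarrow>\<^sub>0 complex) \<Rightarrow> complex poly \<Rightarrow> bool" where
  "asym w P \<longleftrightarrow> (\<forall>j. ((\<lambda>i. (lin_val (val i) w - poly P (val i y)) * val i y ^ j) \<longlongrightarrow> 0) Fl)"

lemma asym_poly_mult:
  assumes "asym w P"
  shows "((\<lambda>i. (lin_val (val i) w - poly P (val i y)) * poly Q (val i y)) \<longlongrightarrow> 0) Fl"
proof -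
  have "((\<lambda>i. \<Sum>j\<le>degree Q. coeff Q j *
      ((lin_val (val i) w - poly P (val i y)) * val i y ^ j)) \<longlongrightarrow> (\<Sum>j\<le>degree Q. coeff Q j * 0)) Fl"
    using assms unfolding asym_def by (intro tendsto_sum tendsto_mult tendsto_const) auto
  then show ?thesis
    by (simp add: poly_altdef[of Q] sum_distrib_left mult.left_commute)
qed

lemma asym_unique:
  assumes "((\<lambda>i. lin_val (val i) w - poly P (val i y)) \<longlongrightarrow> 0) Fl"
    and "((\<lambda>i. lin_val (val i) w - poly Q (val i y)) \<longlongrightarrow> 0) Fl"
  shows "P = Q"
proof -
  have "((\<lambda>i. poly (P - Q) (val i y)) \<longlongrightarrow> 0) Fl"
    using tendsto_diff[OF assms(2,1)] by simp
  from poly_filterlim_at_infinity_eq_0[OF this y_infinity Fl] show ?thesis by simp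
qed

lemma asymD:
  assumes "asym w P"
  shows "((\<lambda>i. lin_val (val i) w - poly P (val i y)) \<longlongrightarrow> 0) Fl"
  using assms[unfolded asym_def, rule_format, of 0] by simp

lemma asym_add: "asym u P \<Longrightarrow> asym v Q \<Longrightarrow> asym (u + v) (P + Q)"
  unfolding asym_def using tendsto_add[where a = 0 and b = 0 and F = Fl]
  by (fastforce simp: algebra_simps)

lemma asym_scale: "asym u P \<Longrightarrow> asym (scale c u) (smult c P)"
  unfolding asym_def using tendsto_mult[OF tendsto_const[of c], where b = 0 and F = Fl]
  by (fastforce simp: algebra_simps)

lemma asym_mul:
  assumes u: "u \<in> A" "asym u P" and v: "v \<in> A" "asym v Q"
  shows "asym (mul u v) (P * Q)"
  unfolding asym_def
proof
  fix j
  let ?t = "\<lambda>i. val i y"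
  let ?e = "\<lambda>i. lin_val (val i) u - poly P (?t i)" and ?f = "\<lambda>i. lin_val (val i) v - poly Q (?t i)"
  \<comment> \<open>With u = P + e and v = Q + f one has uv - PQ = ef + fP + eQ. In each of the
    three terms an error is multiplied by a polynomial in t or by another error.\<close>
  have "((\<lambda>i. ?e i * (?f i * poly (monom 1 j) (?t i)) + ?f i * poly (P * monom 1 j) (?t i) +
      ?e i * poly (Q * monom 1 j) (?t i)) \<longlongrightarrow> 0 * 0 + 0 + 0) Fl"
    by (intro tendsto_intros asymD asym_poly_mult u v)
  moreover have "\<forall>\<^sub>F i in Fl. ?e i * (?f i * poly (monom 1 j) (?t i)) +
      ?f i * poly (P * monom 1 j) (?t i) + ?e i * poly (Q * monom 1 j) (?t i) =
      (lin_val (val i) (mul u v) - poly (P * Q) (?t i)) * ?t i ^ j"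
    using val_mul[OF u(1) v(1)]
    by eventually_elim (simp add: poly_monom algebra_simps)
  ultimately show "((\<lambda>i. (lin_val (val i) (mul u v) - poly (P * Q) (?t i)) * ?t i ^ j) \<longlongrightarrow> 0) Fl"
    using tendsto_cong by force
qed

lemma asym_A0: "w \<in> A0 \<Longrightarrow> asym w [:z w:]"
  unfolding asym_def using A0_val by simp

lemma asym_y: "asym (basis_elt y) [:0, 1:]"
  by (simp add: asym_def)

lemma basis_y: "basis_elt y \<in> A"
  using basis_elt_words_over[OF R y] .

text \<open>Expansions pass to linear combinations and to products with \<open>y\<close>, so
  \<open>generated\<close> applies. Generating with \<open>y\<close> alone also keeps the
  coefficients in the module \<open>Z\<close>, since multiplication by T merely shifts them.\<close>

lemma ex_asym:
  assumes "w \<in> A"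
  shows "\<exists>P. asym w P \<and> (\<forall>i. coeff P i \<in> Z)"
proof -
  let ?G = "{w \<in> A. \<exists>P. asym w P \<and> (\<forall>i. coeff P i \<in> Z)}"
  note sub = submodD[OF submod_words_over[OF R, of V]] and Z = submodD[OF Z]
  have "A \<subseteq> ?G"
  proof (rule generated)
    show "submod R scale ?G"
      unfolding submod_def
    proof (intro conjI ballI)
      show "0 \<in> ?G"
        using sub(1) Z(1) by (auto simp: asym_def intro!: exI[of _ 0])
    next
      fix u v assume "u \<in> ?G" "v \<in> ?G"
      then obtain P Q where "asym u P" "asym v Q" "\<forall>i. coeff P i \<in> Z" "\<forall>i. coeff Q i \<in> Z" "u \<in> A" "v \<in> A"
        by blast
      then show "u + v \<in> ?G"
        using asym_add[of u P v Q] sub(2) Z(2) by auto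
    next
      fix c u assume "u \<in> ?G" and c: "c \<in> R"
      then obtain P where "asym u P" "\<forall>i. coeff P i \<in> Z" "u \<in> A" by blast
      then show "scale c u \<in> ?G"
        using asym_scale[of u P c] sub(3)[OF c] Z(3)[OF c] by auto
    qed
  next
    show "A0 \<subseteq> ?G"
    proof
      fix w assume "w \<in> A0"
      moreover from this have "coeff [:z w:] i \<in> Z" for i
        using z_in_Z Z(1) by (cases i) auto
      ultimately show "w \<in> ?G"
        using A0 asym_A0 by blast
    qed
  next
    fix u assume "u \<in> ?G"
    then obtain P where P: "asym u P" "\<forall>i. coeff P i \<in> Z" "u \<in> A" by blast
    have "coeff (P * [:0, 1:]) i \<in> Z" for i
      using P(2) Z(1) by (cases i) (auto simp: mult_pCons_right)
    then show "mul u (basis_elt y) \<in> ?G"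
      using asym_mul[OF P(3,1) basis_y asym_y] mul[OF P(3) basis_y] by blast
  qed auto
  then show ?thesis using assms by blast
qed

text \<open>This repeats the property in the definite descriptions of \<open>zeta_star_reg\<close>
  and \<open>zeta_sh_reg\<close>, so that both can be resolved inside the locale.\<close>

definition is_reg :: "(('a \<Rightarrow>\<^sub>0 complex) \<Rightarrow> complex poly) \<Rightarrow> bool" where
  "is_reg F \<longleftrightarrow> F \<in> A \<rightarrow>\<^sub>E {p. \<forall>i. coeff p i \<in> Z} \<and> linear_over R scale smult A F \<and>
     (\<forall>w\<in>A0. F w = [:z w:]) \<and> F (basis_elt y) = [:0, 1:] \<and>
     (\<forall>u\<in>A. \<forall>v\<in>A. F (mul u v) = F u * F v)"

lemma eq_on_A:
  assumes "linear_over R scale smult A F" "linear_over R scale smult A F'"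
    and "\<And>w. w \<in> A0 \<Longrightarrow> F w = F' w" "F (basis_elt y) = F' (basis_elt y)"
    and "\<And>u v. u \<in> A \<Longrightarrow> v \<in> A \<Longrightarrow> F (mul u v) = F u * F v"
    and "\<And>u v. u \<in> A \<Longrightarrow> v \<in> A \<Longrightarrow> F' (mul u v) = F' u * (F' v :: complex poly)"
    and "w \<in> A"
  shows "F w = F' w"
proof -
  have "module (smult :: complex \<Rightarrow> complex poly \<Rightarrow> complex poly)"
    by standard (auto simp: smult_add_left smult_add_right)
  then have "A \<subseteq> {w \<in> A. F w = F' w}"
    using assms A0 mul basis_y
    by (intro generated linear_over_cong_span submod_words_over R) auto
  then show ?thesis using assms(7) by blast
qed

lemma is_regD:
  assumes "is_reg F"
  shows "linear_over R scale smult A F" and "w \<in> A0 \<Longrightarrow> F w = [:z w:]"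
    and "F (basis_elt y) = [:0, 1:]" and "u \<in> A \<Longrightarrow> v \<in> A \<Longrightarrow> F (mul u v) = F u * F v"
    and "w \<notin> A \<Longrightarrow> F w = undefined"
proof -
  note F = assms[unfolded is_reg_def]
  show "linear_over R scale smult A F" "F (basis_elt y) = [:0, 1:]" using F by simp_all
  show "w \<in> A0 \<Longrightarrow> F w = [:z w:]" using F by simp
  show "u \<in> A \<Longrightarrow> v \<in> A \<Longrightarrow> F (mul u v) = F u * F v" using F by simp
  show "w \<notin> A \<Longrightarrow> F w = undefined" using PiE_arb[OF F[THEN conjunct1]] .
qed

text \<open>For existence, every element is sent to its asymptotic polynomial. That polynomial is
  unique, so each required law follows by exhibiting an expansion of the element in question.
  Uniqueness is \<open>eq_on_A\<close>.\<close>

lemma ex1_is_reg: "\<exists>!F. is_reg F"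
proof (rule ex_ex1I)
  define F where "F = (\<lambda>w\<in>A. SOME P. asym w P \<and> (\<forall>i. coeff P i \<in> Z))"
  have F: "asym w (F w)" "\<forall>i. coeff (F w) i \<in> Z" if "w \<in> A" for w
    using someI_ex[OF ex_asym[OF that]] that by (auto simp: F_def)
  have ext: "F w = undefined" if "w \<notin> A" for w
    using that by (simp add: F_def)
  have eqI: "F w = P" if "w \<in> A" "asym w P" for w P
    using asym_unique asymD F(1)[OF that(1)] that(2) by blast
  note sub = submodD[OF submod_words_over[OF R, of V]]
  have "is_reg F"
    unfolding is_reg_def linear_over_def
  proof (intro conjI ballI)
    show "F \<in> A \<rightarrow>\<^sub>E {p. \<forall>i. coeff p i \<in> Z}"
      using F(2) ext by (intro PiE_I) auto
    show "F (u + v) = F u + F v" if "u \<in> A" "v \<in> A" for u v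
      using that by (intro eqI asym_add F sub)
    show "F (scale c v) = smult c (F v)" if "c \<in> R" "v \<in> A" for c v
      using that by (intro eqI asym_scale F sub)
    show "F w = [:z w:]" if "w \<in> A0" for w
      using that A0 by (intro eqI asym_A0) auto
    show "F (basis_elt y) = [:0, 1:]"
      by (intro eqI asym_y basis_y)
    show "F (mul u v) = F u * F v" if "u \<in> A" "v \<in> A" for u v
      using that by (intro eqI asym_mul F mul)
  qed
  then show "\<exists>F. is_reg F" by (rule exI[of is_reg F])
next
  fix F F' assume F: "is_reg F" "is_reg F'"
  have "F w = F' w" if "w \<in> A" for w
    by (rule eq_on_A[OF is_regD(1)[OF F(1)] is_regD(1)[OF F(2)] _ _
          is_regD(4)[OF F(1)] is_regD(4)[OF F(2)] that])
      (simp_all add: is_regD(2,3)[OF F(1)] is_regD(2,3)[OF F(2)])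
  then show "F = F'"
    using is_regD(5)[OF F(1)] is_regD(5)[OF F(2)] by (metis ext)
qed

text \<open>The expansion can be recovered from the algebraic laws alone: it holds for convergent
  elements and is preserved by linear combinations and by multiplication with \<open>y\<close>.
  Statements about the definite descriptions thereby become statements about limits.\<close>

lemma is_reg_asym:
  assumes F: "is_reg F" and w: "w \<in> A"
  shows "asym w (F w)"
proof -
  let ?G = "{w \<in> A. asym w (F w)}"
  note sub = submodD[OF submod_words_over[OF R, of V]]
  have lin: "F (u + v) = F u + F v" "c \<in> R \<Longrightarrow> F (scale c u) = smult c (F u)"
    if "u \<in> A" "v \<in> A" for u v c
    using is_regD(1)[OF F] that by (simp_all add: linear_over_def)
  have "A \<subseteq> ?G"
  proof (rule generated)
    have "F 0 = 0" using lin(1)[OF sub(1) sub(1)] by simp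
    then show "submod R scale ?G"
      using sub lin by (simp add: submod_def asym_add asym_scale asym_def[of 0])
    show "A0 \<subseteq> ?G"
      using A0 asym_A0 is_regD(2)[OF F] by auto
    show "mul u (basis_elt y) \<in> ?G" if "u \<in> ?G" for u
      using that mul[OF _ basis_y] asym_mul[OF _ _ basis_y asym_y] is_regD(4)[OF F _ basis_y]
        is_regD(3)[OF F] by simp
  qed auto
  then show ?thesis using w by blast
qed

text \<open>Multiplying an element of value 1 by \<open>y\<close> j times gives T^j. These witnesses
  pin down linear maps of polynomials in T.\<close>

lemma is_reg_ex_power:
  assumes F: "is_reg F"
  shows "\<exists>w\<in>A. F w = monom 1 j"
proof (induction j)
  case 0
  obtain w where "w \<in> A0" "z w = 1" using unit by blast
  then show ?case
    using is_regD(2)[OF F] A0 by (intro bexI[of _ w]) (auto simp: monom_0 one_pCons)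
next
  case (Suc j)
  then obtain w where "w \<in> A" "F w = monom 1 j" by blast
  then show ?case
    using is_regD(3,4)[OF F] mul basis_y
    by (intro bexI[of _ "mul w (basis_elt y)"]) (simp_all add: monom_Suc)
qed

text \<open>Substituting T + c into \<open>F\<close> keeps all the laws and the values on
  \<open>A0\<close>. It also has the right value at \<open>y\<close>, because y = (y - y') + y'
  forces F'(y) = c + T. So it must be \<open>F'\<close>.\<close>

lemma reg_change_of_generator:
  assumes F: "is_reg F"
    and F': "linear_over R scale smult A F'" "\<And>w. w \<in> A0 \<Longrightarrow> F' w = [:z w:]"
      "F' (basis_elt y') = [:0, 1:]" "\<And>u v. u \<in> A \<Longrightarrow> v \<in> A \<Longrightarrow> F' (mul u v) = F' u * F' v"
    and y': "y' \<in> V" "basis_elt y - basis_elt y' \<in> A0" and w: "w \<in> A"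
  shows "F' w = pcompose (F w) [:z (basis_elt y - basis_elt y'), 1:]"
proof (rule eq_on_A[of F' "\<lambda>w. pcompose (F w) [:z (basis_elt y - basis_elt y'), 1:]"])
  note F1 = is_regD[OF F]
  let ?q = "[:z (basis_elt y - basis_elt y'), 1:]"
  let ?F = "\<lambda>w. pcompose (F w) ?q"
  show "linear_over R scale smult A ?F"
    using F1(1) by (auto simp: linear_over_def pcompose_add pcompose_smult)
  show "F' w = ?F w" if "w \<in> A0" for w
    using F1(2) F'(2) that by simp
  have "F' (u + v) = F' u + F' v" if "u \<in> A" "v \<in> A" for u v
    using F'(1) that by (simp add: linear_over_def)
  from this[OF subsetD[OF A0 y'(2)] basis_elt_words_over[OF R y'(1)]]
  have "F' (basis_elt y - basis_elt y' + basis_elt y') =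
      F' (basis_elt y - basis_elt y') + F' (basis_elt y')" .
  then show "F' (basis_elt y) = ?F (basis_elt y)"
    using F'(2)[OF y'(2)] F'(3) F1(3) by (simp add: pcompose_pCons)
  show "?F (mul u v) = ?F u * ?F v" if "u \<in> A" "v \<in> A" for u v
    using F1(4)[OF that] by (simp add: pcompose_mult)
  show "linear_over R scale smult A F'" "w \<in> A" by fact+
  show "F' (mul u v) = F' u * F' v" if "u \<in> A" "v \<in> A" for u v
    using F'(4) that .
qed

end

section \<open>Linear maps of polynomials in T\<close>

lemma C_linear_eqI:
  assumes "C_linear \<rho>" "C_linear \<rho>'" "\<And>j. \<rho> (monom 1 j) = \<rho>' (monom 1 j)"
  shows "\<rho> = \<rho>'"
proof
  fix p :: "complex poly"
  interpret a: Vector_Spaces.linear smult smult \<rho> by fact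
  interpret b: Vector_Spaces.linear smult smult \<rho>' by fact
  have p: "p = (\<Sum>j\<le>degree p. smult (coeff p j) (monom 1 j))"
    unfolding smult_monom mult.right_neutral by (rule poly_as_sum_of_monoms[symmetric])
  show "\<rho> p = \<rho>' p"
    by (subst (1 2) p) (simp add: a.sum b.sum a.scale b.scale assms(3))
qed

lemma C_linearI:
  assumes "\<And>p q. \<rho> (p + q) = \<rho> p + \<rho> q" "\<And>c p. \<rho> (smult c p) = smult c (\<rho> p)"
  shows "C_linear \<rho>"
  by unfold_locales (auto simp: assms smult_add_left smult_add_right)

text \<open>Read as a composition, the map is visibly linear, and it takes the form produced by
  \<open>reg_change_of_generator\<close>.\<close>

lemma rho_mu_eq_pcompose: "rho_mu \<mu> m m' p = pcompose p [:c_mu \<mu> m m', 1:]"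
proof -
  have "pcompose p q = (\<Sum>s\<le>degree p. smult (coeff p s) (q ^ s))" for q :: "complex poly"
  proof (subst poly_as_sum_of_monoms[of p, symmetric], subst pcompose_sum, rule sum.cong[OF refl])
    have "pcompose (monom c s) q = smult c (q ^ s)" for c s
      by (induction s) (auto simp: monom_0 monom_Suc pcompose_pCons)
    then show "pcompose (monom (coeff p s) s) q = smult (coeff p s) (q ^ s)" for s .
  qed
  then show ?thesis by (simp add: rho_mu_def)
qed

lemma C_linear_rho_mu: "C_linear (rho_mu \<mu> m m')"
  by (rule C_linearI) (simp_all add: rho_mu_eq_pcompose pcompose_add pcompose_smult)

lemma rho_mu_monom: "rho_mu \<mu> m m' (monom 1 s) = [:c_mu \<mu> m m', 1:] ^ s"
  unfolding rho_mu_eq_pcompose by (induction s) (auto simp: monom_Suc pcompose_pCons pcompose_1)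

section \<open>The stuffle product of truncated sums\<close>

lemma poly_map_poly_of_rat_pCons:
  "poly (map_poly of_rat (pCons c p)) \<mu> = of_rat c + \<mu> * poly (map_poly of_rat p) \<mu>"
  for \<mu> :: "'a :: field_char_0"
  by (cases "pCons c p = 0") (auto simp: map_poly_pCons)

lemma poly_map_poly_of_rat_add:
  "poly (map_poly of_rat (p + q)) \<mu> = poly (map_poly of_rat p) \<mu> + poly (map_poly of_rat q) \<mu>"
  for \<mu> :: "'a :: field_char_0"
  by (induction p q rule: poly_induct2)
    (auto simp: poly_map_poly_of_rat_pCons of_rat_add algebra_simps)

lemma poly_map_poly_of_rat_smult:
  "poly (map_poly of_rat (smult c p)) \<mu> = of_rat c * poly (map_poly of_rat p) \<mu>"
  for \<mu> :: "'a :: field_char_0"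
  by (induction p) (auto simp: poly_map_poly_of_rat_pCons of_rat_mult algebra_simps)

lemma poly_map_poly_of_rat_mult:
  "poly (map_poly of_rat (p * q)) \<mu> = poly (map_poly of_rat p) \<mu> * poly (map_poly of_rat q) \<mu>"
  for \<mu> :: "'a :: field_char_0"
  by (induction p)
    (auto simp: poly_map_poly_of_rat_pCons poly_map_poly_of_rat_add poly_map_poly_of_rat_smult
      algebra_simps)

lemma scalar_ring_Q_adjoin: "scalar_ring (Q_adjoin \<mu>)"
  unfolding scalar_ring_def Q_adjoin_def
proof (intro conjI allI ballI)
  fix q
  have "of_rat q = poly (map_poly of_rat [:q:]) \<mu>" by (simp add: poly_map_poly_of_rat_pCons)
  then show "of_rat q \<in> range (\<lambda>p. poly (map_poly of_rat p) \<mu>)" by blast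
qed (auto simp: poly_map_poly_of_rat_add[symmetric] poly_map_poly_of_rat_mult[symmetric])

lemma mu_in_Q_adjoin: "\<mu> \<in> Q_adjoin \<mu>"
proof -
  have "\<mu> = poly (map_poly of_rat [:0, 1:]) \<mu>" by (simp add: poly_map_poly_of_rat_pCons)
  then show ?thesis unfolding Q_adjoin_def by blast
qed

lemma QY_eq_words_over: "QY \<mu> = words_over (Q_adjoin \<mu>) {w. positive w}"
  by (auto simp: QY_def words_over_def)

lemma positive_simps [simp]:
  "positive []" "positive (u @ v) \<longleftrightarrow> positive u \<and> positive v"
  "positive ((k, m) # w) \<longleftrightarrow> k \<ge> 1 \<and> m > 0 \<and> positive w"
  by (auto simp: positive_def)

text \<open>Write A = x + m1, B = x + m2 and d = m2 - m1. Multiplying by (B - A)/d = 1 turns a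
  product of two reciprocal powers into a difference of two products, each with one exponent
  lowered, so a double induction works. It passes through cases where one exponent is 0; both cannot
  be 0, since empty sums do not give 1.\<close>

lemma partial_fraction_exists:
  fixes m1 m2 :: rat
  assumes "m1 \<noteq> m2" "k1 + k2 > 0"
  shows "\<exists>a b. \<forall>x. x + m1 \<noteq> 0 \<longrightarrow> x + m2 \<noteq> 0 \<longrightarrow>
       1 / ((x + m1) ^ k1 * (x + m2) ^ k2) =
         (\<Sum>i = 1..k1. a i / (x + m1) ^ i) + (\<Sum>j = 1..k2. b j / (x + m2) ^ j)"
  using assms(2)
proof (induction k1 arbitrary: k2)
  case 0
  then show ?case
    by (intro exI[of _ "\<lambda>_. 0"] exI[of _ "\<lambda>j. if j = k2 then 1 else 0"])
      (auto simp: if_distrib[of "\<lambda>c. c / _"] cong: if_cong)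
next
  case (Suc k1)
  note outer = Suc.IH
  show ?case
  proof (induction k2)
    case 0
    show ?case
      by (intro exI[of _ "\<lambda>i. if i = Suc k1 then 1 else 0"] exI[of _ "\<lambda>_. 0"])
        (auto simp: if_distrib[of "\<lambda>c. c / _"] cong: if_cong)
  next
    case (Suc k2)
    obtain a b where ab: "\<And>x. x + m1 \<noteq> 0 \<Longrightarrow> x + m2 \<noteq> 0 \<Longrightarrow>
       1 / ((x + m1) ^ Suc k1 * (x + m2) ^ k2) =
         (\<Sum>i = 1..Suc k1. a i / (x + m1) ^ i) + (\<Sum>j = 1..k2. b j / (x + m2) ^ j)"
      using Suc by blast
    obtain a' b' where ab': "\<And>x. x + m1 \<noteq> 0 \<Longrightarrow> x + m2 \<noteq> 0 \<Longrightarrow>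
       1 / ((x + m1) ^ k1 * (x + m2) ^ Suc k2) =
         (\<Sum>i = 1..k1. a' i / (x + m1) ^ i) + (\<Sum>j = 1..Suc k2. b' j / (x + m2) ^ j)"
      using outer[of "Suc k2"] by auto
    define d where "d = m2 - m1"
    have d: "d \<noteq> 0" using assms(1) by (simp add: d_def)
    \<comment> \<open>The two decompositions have sums of different lengths; the missing top
      coefficients are set to 0.\<close>
    define a'' where "a'' = (\<lambda>i. (a i - (if i = Suc k1 then 0 else a' i)) / d)"
    define b'' where "b'' = (\<lambda>j. ((if j = Suc k2 then 0 else b j) - b' j) / d)"
    have "1 / ((x + m1) ^ Suc k1 * (x + m2) ^ Suc k2) =
         (\<Sum>i = 1..Suc k1. a'' i / (x + m1) ^ i) + (\<Sum>j = 1..Suc k2. b'' j / (x + m2) ^ j)"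
      if x: "x + m1 \<noteq> 0" "x + m2 \<noteq> 0" for x
    proof -
      have "1 / ((x + m1) ^ Suc k1 * (x + m2) ^ Suc k2) =
        (1 / ((x + m1) ^ Suc k1 * (x + m2) ^ k2) - 1 / ((x + m1) ^ k1 * (x + m2) ^ Suc k2)) / d"
        using x d by (simp add: divide_simps) (simp add: d_def algebra_simps)
      also have "\<dots> = ((\<Sum>i = 1..Suc k1. a i / (x + m1) ^ i) + (\<Sum>j = 1..k2. b j / (x + m2) ^ j)
          - ((\<Sum>i = 1..k1. a' i / (x + m1) ^ i) + (\<Sum>j = 1..Suc k2. b' j / (x + m2) ^ j))) / d"
        using ab[OF x] ab'[OF x] by simp
      also have "(\<Sum>i = 1..k1. a' i / (x + m1) ^ i) =
          (\<Sum>i = 1..Suc k1. (if i = Suc k1 then 0 else a' i) / (x + m1) ^ i)"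
        by simp
      also have "(\<Sum>j = 1..k2. b j / (x + m2) ^ j) =
          (\<Sum>j = 1..Suc k2. (if j = Suc k2 then 0 else b j) / (x + m2) ^ j)"
        by simp
      finally show ?thesis
        by (simp only: a''_def b''_def diff_divide_distrib add_divide_distrib sum_divide_distrib
            sum_subtractf divide_divide_eq_left mult.commute algebra_simps)
    qed
    then show ?case by blast
  qed
qed

text \<open>The identity of rational functions holds at the rational points, hence everywhere: after
  clearing denominators both sides are polynomials agreeing at infinitely many points.\<close>

lemma partial_fraction_complex:
  fixes z :: complex
  assumes "m1 \<noteq> m2" "k1 + k2 > 0" "partial_fraction k1 m1 k2 m2 = (a, b)"
    and z: "z + of_rat m1 \<noteq> 0" "z + of_rat m2 \<noteq> 0"
  shows "1 / ((z + of_rat m1) ^ k1 * (z + of_rat m2) ^ k2) =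
    (\<Sum>i = 1..k1. of_rat (a i) / (z + of_rat m1) ^ i) + (\<Sum>j = 1..k2. of_rat (b j) / (z + of_rat m2) ^ j)"
proof -
  have "case partial_fraction k1 m1 k2 m2 of (a, b) \<Rightarrow> \<forall>x. x + m1 \<noteq> 0 \<longrightarrow> x + m2 \<noteq> 0 \<longrightarrow>
       1 / ((x + m1) ^ k1 * (x + m2) ^ k2) =
         (\<Sum>i = 1..k1. a i / (x + m1) ^ i) + (\<Sum>j = 1..k2. b j / (x + m2) ^ j)"
    unfolding partial_fraction_def
    by (rule someI_ex) (use partial_fraction_exists[OF assms(1,2)] in auto)
  then have ab: "1 / ((x + m1) ^ k1 * (x + m2) ^ k2) =
         (\<Sum>i = 1..k1. a i / (x + m1) ^ i) + (\<Sum>j = 1..k2. b j / (x + m2) ^ j)"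
    if "x + m1 \<noteq> 0" "x + m2 \<noteq> 0" for x
    using assms(3) that by simp
  define p :: "complex poly" where
    "p = (\<Sum>i = 1..k1. smult (of_rat (a i)) ([:of_rat m1, 1:] ^ (k1 - i) * [:of_rat m2, 1:] ^ k2)) +
      (\<Sum>j = 1..k2. smult (of_rat (b j)) ([:of_rat m2, 1:] ^ (k2 - j) * [:of_rat m1, 1:] ^ k1)) - 1"
  have p: "poly p x = (x + of_rat m1) ^ k1 * (x + of_rat m2) ^ k2 *
      ((\<Sum>i = 1..k1. of_rat (a i) / (x + of_rat m1) ^ i) +
       (\<Sum>j = 1..k2. of_rat (b j) / (x + of_rat m2) ^ j)) - 1"
    if "x + of_rat m1 \<noteq> 0" "x + of_rat m2 \<noteq> 0" for x
  proof -
    have "c * ((x + d) ^ (k - i) * (x + d') ^ k') = (x + d) ^ k * (x + d') ^ k' * (c / (x + d) ^ i)"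
      if "i \<in> {1..k}" "x + d \<noteq> 0" for c d d' k k' i
      using that by (simp add: power_diff)
    from this[OF _ that(1)] this[OF _ that(2), of _ k2 _ "of_rat m1" k1] show ?thesis
      unfolding p_def
      by (simp add: poly_sum sum_distrib_left distrib_left poly_power add.commute[of _ x]
          mult.commute[of "(x + of_rat m2) ^ k2" "(x + of_rat m1) ^ k1"])
  qed
  have "poly p (of_rat x) = 0" if x: "x \<noteq> - m1" "x \<noteq> - m2" for x
  proof -
    have x': "x + m1 \<noteq> 0" "x + m2 \<noteq> 0" using x by (auto simp: add_eq_0_iff2)
    have "of_rat x + of_rat m1 \<noteq> (0 :: complex)" "of_rat x + of_rat m2 \<noteq> (0 :: complex)"
      using x' by (simp_all flip: of_rat_add)
    from p[OF this] have "poly p (of_rat x) = of_rat ((x + m1) ^ k1 * (x + m2) ^ k2 *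
      ((\<Sum>i = 1..k1. a i / (x + m1) ^ i) + (\<Sum>j = 1..k2. b j / (x + m2) ^ j)) - 1)"
      by (simp add: of_rat_diff of_rat_mult of_rat_add of_rat_power of_rat_sum of_rat_divide)
    also have "(x + m1) ^ k1 * (x + m2) ^ k2 *
      ((\<Sum>i = 1..k1. a i / (x + m1) ^ i) + (\<Sum>j = 1..k2. b j / (x + m2) ^ j)) = 1"
      unfolding ab[OF x', symmetric] using x' by simp
    finally show ?thesis by simp
  qed
  then have "of_rat ` (UNIV - {- m1, - m2}) \<subseteq> {x. poly p x = 0}" by auto
  moreover have "infinite (of_rat ` (UNIV - {- m1, - m2}) :: complex set)"
    by (subst finite_image_iff) (auto simp: inj_on_def infinite_UNIV_char_0)
  ultimately have "p = 0"
    using poly_roots_finite finite_subset by blast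
  with p[OF z] z show ?thesis
    by (simp add: field_simps)
qed

definition letter_val :: "complex \<Rightarrow> nat \<Rightarrow> nat \<times> rat \<Rightarrow> complex" where
  "letter_val \<mu> n x = 1 / (of_nat n * \<mu> + of_rat (snd x)) ^ fst x"

lemma Re_of_rat: "Re (of_rat m) = of_rat m"
proof -
  have "of_rat m = complex_of_real (of_rat m)"
    by (cases m) (simp add: of_rat_rat)
  then show ?thesis by (metis Re_complex_of_real)
qed

lemma denom_factor_nonzero:
  assumes "Re \<mu> > 0" "m > 0"
  shows "of_nat n * \<mu> + of_rat m \<noteq> 0"
proof -
  have "Re (of_nat n * \<mu> + of_rat m) = real n * Re \<mu> + of_rat m"
    by (simp add: Re_of_rat)
  also have "\<dots> > 0" using assms by (intro add_nonneg_pos) auto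
  finally show ?thesis by (metis less_irrefl zero_complex.sel(1))
qed

text \<open>For distinct shifts this is the partial fraction identity at x = n mu; for equal shifts
  the exponents add. It describes what happens when two summation indices coincide.\<close>

lemma lin_val_odot:
  assumes "Re \<mu> > 0" "positive [x]" "positive [y]"
  shows "lin_val (letter_val \<mu> n) (odot x y) = letter_val \<mu> n x * letter_val \<mu> n y"
proof -
  obtain k1 m1 k2 m2 where xy: "x = (k1, m1)" "y = (k2, m2)" by force
  then have pos: "k1 \<ge> 1" "m1 > 0" "k2 \<ge> 1" "m2 > 0" using assms by auto
  show ?thesis
  proof (cases "m1 = m2")
    case True
    then show ?thesis by (simp add: xy odot_def letter_val_def power_add)
  next
    case False
    obtain a b where ab: "partial_fraction k1 m1 k2 m2 = (a, b)" by force
    have "k1 + k2 > 0" using pos by simp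
    from partial_fraction_complex[OF False this ab, of "of_nat n * \<mu>"]
    show ?thesis
      using False denom_factor_nonzero[OF assms(1)] pos
      by (simp add: xy odot_def ab lin_val_sum letter_val_def)
  qed
qed

lemma odot_words_over:
  assumes "scalar_ring R" "positive [x]" "positive [y]"
  shows "odot x y \<in> words_over R {a. positive [a]}"
proof -
  obtain k1 m1 k2 m2 where xy: "x = (k1, m1)" "y = (k2, m2)" by force
  obtain a b where ab: "partial_fraction k1 m1 k2 m2 = (a, b)" by force
  note sub = submod_words_over[OF assms(1), of "{a. positive [a]}"]
  have single: "Poly_Mapping.single (k, m) (of_rat q) \<in> words_over R {a. positive [a]}"
    if "k \<ge> 1" "m > 0" for k m q
    using that scalar_ringD(1,4)[OF assms(1)] by (auto simp: words_over_def lookup_single when_def)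
  show ?thesis
    using assms(2,3) basis_elt_words_over[OF assms(1), of "(k1 + k2, m1)" "{a. positive [a]}"]
    by (auto simp: xy odot_def ab intro!: submodD(2)[OF sub] submod_sum[OF sub] single)
qed

section \<open>Truncated sums and their stuffle product\<close>

definition trunc_tuples :: "nat \<Rightarrow> nat \<Rightarrow> nat list set" where
  "trunc_tuples r M = {ns \<in> mono_tuples r. \<forall>n\<in>set ns. n \<le> M}"

lemma trunc_tuples_0 [simp]: "trunc_tuples 0 M = {[]}"
  by (auto simp: trunc_tuples_def mono_tuples_def)

lemma finite_trunc_tuples [simp]: "finite (trunc_tuples r M)"
  by (rule finite_subset[OF _ finite_lists_length_eq[of "{..M}" r]])
    (auto simp: trunc_tuples_def mono_tuples_def)

text \<open>The last entry n is the largest, so the other entries range over the tuples truncated at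
  n.\<close>

lemma sum_trunc_tuples_Suc:
  "(\<Sum>ns\<in>trunc_tuples (Suc r) M. f ns) = (\<Sum>n\<le>M. \<Sum>ns\<in>trunc_tuples r n. f (ns @ [n]))"
proof -
  have "bij_betw (\<lambda>(n, ns). ns @ [n]) (SIGMA n:{..M}. trunc_tuples r n) (trunc_tuples (Suc r) M)"
  proof (rule bij_betwI[where g = "\<lambda>ns. (last ns, butlast ns)"])
    show "(\<lambda>ns. (last ns, butlast ns)) \<in> trunc_tuples (Suc r) M \<rightarrow> (SIGMA n:{..M}. trunc_tuples r n)"
    proof
      fix ns assume ns: "ns \<in> trunc_tuples (Suc r) M"
      then obtain ms n where "ns = ms @ [n]"
        by (cases ns rule: rev_cases) (auto simp: trunc_tuples_def mono_tuples_def)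
      with ns show "(last ns, butlast ns) \<in> (SIGMA n:{..M}. trunc_tuples r n)"
        by (auto simp: trunc_tuples_def mono_tuples_def sorted_append)
    qed
    show "(case (last ns, butlast ns) of (n, ns) \<Rightarrow> ns @ [n]) = ns"
      if "ns \<in> trunc_tuples (Suc r) M" for ns
      using that by (cases ns rule: rev_cases) (auto simp: trunc_tuples_def mono_tuples_def)
  qed (fastforce simp: trunc_tuples_def mono_tuples_def sorted_append)+
  then have "(\<Sum>ns\<in>trunc_tuples (Suc r) M. f ns) =
      (\<Sum>p\<in>(SIGMA n:{..M}. trunc_tuples r n). f ((\<lambda>(n, ns). ns @ [n]) p))"
    by (rule sum.reindex_bij_betw[symmetric])
  then show ?thesis
    by (simp add: sum.Sigma case_prod_unfold)
qed

lemma denom_append: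
  assumes "length ns = length w"
  shows "denom \<mu> w (ns @ ns') = denom \<mu> w ns"
    and "denom \<mu> (w @ [x]) (ns @ [n]) = denom \<mu> w ns / letter_val \<mu> n x"
proof -
  have *: "(\<Prod>i<length w. (of_nat ((ns @ ns') ! i) * \<mu> + of_rat (snd ((w @ w') ! i))) ^ fst ((w @ w') ! i)) =
      denom \<mu> w ns" for ns' w'
    unfolding denom_def using assms by (intro prod.cong) (auto simp: nth_append)
  show "denom \<mu> w (ns @ ns') = denom \<mu> w ns"
    using *[of ns' "[]"] by (simp add: denom_def)
  show "denom \<mu> (w @ [x]) (ns @ [n]) = denom \<mu> w ns / letter_val \<mu> n x"
    using *[of "[n]" "[x]"] assms nth_append_length[of ns n] by (simp add: denom_def letter_val_def)
qed

definition trunc_zeta :: "complex \<Rightarrow> nat \<Rightarrow> biindex \<Rightarrow> complex" where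
  "trunc_zeta \<mu> M w = (\<Sum>ns\<in>trunc_tuples (length w) M. \<mu> ^ length w / denom \<mu> w ns)"

lemma zeta_star_trunc_eq: "zeta_star_trunc \<mu> M p = lin_val (trunc_zeta \<mu> M) p"
  by (simp add: zeta_star_trunc_def lin_val_def trunc_zeta_def trunc_tuples_def)

lemma trunc_zeta_Nil [simp]: "trunc_zeta \<mu> M [] = 1"
  by (simp add: trunc_zeta_def denom_def)

lemma trunc_zeta_snoc:
  "trunc_zeta \<mu> M (w @ [x]) = (\<Sum>n\<le>M. \<mu> * letter_val \<mu> n x * trunc_zeta \<mu> n w)"
  unfolding trunc_zeta_def length_append list.size add_0_right sum_trunc_tuples_Suc add_Suc_right
    sum_distrib_left
  by (intro sum.cong refl) (auto simp: trunc_tuples_def mono_tuples_def denom_append)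

lemma lin_val_trunc_zeta_append_letters:
  "lin_val (trunc_zeta \<mu> M) (append_letters p q) =
     (\<Sum>n\<le>M. \<mu> * lin_val (letter_val \<mu> n) q * lin_val (trunc_zeta \<mu> n) p)"
proof -
  have "lin_val (trunc_zeta \<mu> M) (append_letters p q) = (\<Sum>u\<in>Poly_Mapping.keys p. \<Sum>v\<in>Poly_Mapping.keys q.
     \<Sum>n\<le>M. Poly_Mapping.lookup p u * Poly_Mapping.lookup q v * (\<mu> * letter_val \<mu> n v * trunc_zeta \<mu> n u))"
    by (simp add: append_letters_def lin_val_bilin_ext trunc_zeta_snoc sum_distrib_left)
  also have "\<dots> = (\<Sum>n\<le>M. \<Sum>u\<in>Poly_Mapping.keys p. \<Sum>v\<in>Poly_Mapping.keys q.
     Poly_Mapping.lookup p u * Poly_Mapping.lookup q v * (\<mu> * letter_val \<mu> n v * trunc_zeta \<mu> n u))"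
    by (subst sum.swap[of _ "{..M}"]) (simp only: sum.swap[of _ "{..M}"])
  also have "\<dots> = (\<Sum>n\<le>M. \<mu> * lin_val (letter_val \<mu> n) q * lin_val (trunc_zeta \<mu> n) p)"
    by (intro sum.cong refl) (simp add: lin_val_def sum_product sum_distrib_left algebra_simps
        sum.swap[of _ "Poly_Mapping.keys q"])
  finally show ?thesis .
qed

text \<open>The square of index pairs is covered by the two closed triangles, which share the
  diagonal. Subtracting the diagonal once is the origin of the minus sign in the stuffle
  recursion.\<close>

lemma sum_atMost_product:
  fixes f g :: "nat \<Rightarrow> 'a :: comm_ring_1"
  shows "(\<Sum>n\<le>M. f n) * (\<Sum>n\<le>M. g n) =
    (\<Sum>n\<le>M. f n * (\<Sum>i\<le>n. g i)) + (\<Sum>n\<le>M. g n * (\<Sum>i\<le>n. f i)) - (\<Sum>n\<le>M. f n * g n)"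
  by (induction M) (auto simp: algebra_simps)

lemma stuffle_words_Nil_right [simp]: "stuffle_words \<mu> w [] = basis_elt w"
  by (cases w rule: rev_cases) simp_all

text \<open>Each truncated sum is a sum over its largest index, so \<open>sum_atMost_product\<close>
  reproduces the recursion in the last letters. The diagonal carries two factors mu: appending the
  merged letter accounts for one, the scalar in the recursion for the other.\<close>

lemma trunc_zeta_stuffle_words:
  assumes "Re \<mu> > 0" "positive u" "positive v"
  shows "lin_val (trunc_zeta \<mu> M) (stuffle_words \<mu> u v) = trunc_zeta \<mu> M u * trunc_zeta \<mu> M v"
  using assms
proof (induction \<mu> u v arbitrary: M rule: stuffle_words.induct)
  case (3 \<mu> u x v y)
  have IH: "lin_val (trunc_zeta \<mu> M) (stuffle_words \<mu> u (v @ [y])) =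
      trunc_zeta \<mu> M u * trunc_zeta \<mu> M (v @ [y])"
    "lin_val (trunc_zeta \<mu> M) (stuffle_words \<mu> (u @ [x]) v) =
      trunc_zeta \<mu> M (u @ [x]) * trunc_zeta \<mu> M v"
    "lin_val (trunc_zeta \<mu> M) (stuffle_words \<mu> u v) = trunc_zeta \<mu> M u * trunc_zeta \<mu> M v" for M
    using 3 by auto
  have "lin_val (letter_val \<mu> n) (odot x y) = letter_val \<mu> n x * letter_val \<mu> n y" for n
    using 3 by (intro lin_val_odot) auto
  then have "lin_val (trunc_zeta \<mu> M) (stuffle_words \<mu> (u @ [x]) (v @ [y])) =
      (\<Sum>n\<le>M. \<mu> * letter_val \<mu> n x * trunc_zeta \<mu> n u * trunc_zeta \<mu> n (v @ [y])) +
      (\<Sum>n\<le>M. \<mu> * letter_val \<mu> n y * trunc_zeta \<mu> n v * trunc_zeta \<mu> n (u @ [x])) -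
      (\<Sum>n\<le>M. (\<mu> * letter_val \<mu> n x * trunc_zeta \<mu> n u) * (\<mu> * letter_val \<mu> n y * trunc_zeta \<mu> n v))"
    by (simp add: lin_val_trunc_zeta_append_letters IH sum_distrib_left algebra_simps)
  also have "\<dots> = trunc_zeta \<mu> M (u @ [x]) * trunc_zeta \<mu> M (v @ [y])"
    unfolding trunc_zeta_snoc sum_atMost_product ..
  finally show ?case .
qed simp_all

lemma stuffle_words_words_over:
  assumes "positive u" "positive v"
  shows "stuffle_words \<mu> u v \<in> words_over (Q_adjoin \<mu>) {w. positive w}"
  using assms
proof (induction \<mu> u v rule: stuffle_words.induct)
  case (3 \<mu> u x v y)
  note R = scalar_ring_Q_adjoin[of \<mu>]
  note sub = submod_words_over[OF R, of "{w. positive w}"]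
  have app: "append_letters p q \<in> words_over (Q_adjoin \<mu>) {w. positive w}"
    if "p \<in> words_over (Q_adjoin \<mu>) {w. positive w}"
      "q \<in> words_over (Q_adjoin \<mu>) {a. positive [a]}" for p q
    by (rule append_letters_words_over[OF R that]) auto
  have x: "positive [x]" "positive [y]" using 3 by auto
  show ?case
    unfolding stuffle_words.simps using 3 x
    by (intro submod_diff[OF sub R] submodD(2,3)[OF sub] app mu_in_Q_adjoin odot_words_over R
        basis_elt_words_over) auto
qed (auto intro: basis_elt_words_over scalar_ring_Q_adjoin)

lemma stuffle_in_QY: "u \<in> QY \<mu> \<Longrightarrow> v \<in> QY \<mu> \<Longrightarrow> stuffle \<mu> u v \<in> QY \<mu>"
  unfolding QY_eq_words_over stuffle_def
  by (rule bilin_ext_in_submod[of "Q_adjoin \<mu>"])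
    (auto intro: scalar_ring_Q_adjoin submod_words_over stuffle_words_words_over)

lemma trunc_zeta_stuffle:
  assumes "Re \<mu> > 0" "u \<in> QY \<mu>" "v \<in> QY \<mu>"
  shows "lin_val (trunc_zeta \<mu> M) (stuffle \<mu> u v) = lin_val (trunc_zeta \<mu> M) u * lin_val (trunc_zeta \<mu> M) v"
  unfolding stuffle_def using assms
  by (intro lin_val_bilin_ext_mult trunc_zeta_stuffle_words) (auto simp: QY_def)

text \<open>This is the shuffle product of \<open>u\<close> with the letter \<open>y\<close>; on the
  stuffle side it is the part of maximal length.\<close>

definition insertions :: "'a \<Rightarrow> 'a list \<Rightarrow> ('a list \<Rightarrow>\<^sub>0 complex)" where
  "insertions y u = (\<Sum>i\<le>length u. basis_elt (take i u @ y # drop i u))"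

lemma insertions_Nil [simp]: "insertions y [] = basis_elt [y]"
  by (simp add: insertions_def)

lemma insertions_snoc:
  "insertions y (u @ [x]) = append_letters (insertions y u) (basis_elt x) + basis_elt (u @ [x, y])"
proof -
  have "(\<Sum>i\<le>length u. basis_elt (take i (u @ [x]) @ y # drop i (u @ [x]))) =
      (\<Sum>i\<le>length u. append_letters (basis_elt (take i u @ y # drop i u)) (basis_elt x))"
    by (intro sum.cong) (auto simp: append_letters_single)
  then show ?thesis
    by (simp add: insertions_def append_letters_sum_left)
qed

text \<open>Apart from the insertions, the recursion produces terms in which \<open>y\<close> is
  merged with a letter of \<open>u\<close>; these are no longer than \<open>u\<close>.\<close>

lemma stuffle_words_letter:
  assumes "positive u" "positive [y]"
  shows "stuffle_words \<mu> u [y] - insertions y u \<in>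
    words_over (Q_adjoin \<mu>) {v \<in> {v. positive v}. length v \<le> length u}"
  using assms(1)
proof (induction u rule: rev_induct)
  case Nil
  then show ?case
    using submodD(1)[OF submod_words_over[OF scalar_ring_Q_adjoin]] by simp
next
  case (snoc x u)
  note R = scalar_ring_Q_adjoin[of \<mu>]
  let ?V = "\<lambda>n. {v \<in> {v. positive v}. length v \<le> n}"
  note sub = submod_words_over[OF R, of "?V (length (u @ [x]))"]
  have eq: "stuffle_words \<mu> (u @ [x]) [y] - insertions y (u @ [x]) =
      append_letters (stuffle_words \<mu> u [y] - insertions y u) (basis_elt x) -
      scale \<mu> (append_letters (basis_elt u) (odot x y))"
    using stuffle_words.simps(3)[of \<mu> u x "[]" y]
    by (simp add: insertions_snoc append_letters_single append_letters_diff_left)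
  have 1: "append_letters (stuffle_words \<mu> u [y] - insertions y u) (basis_elt x) \<in>
      words_over (Q_adjoin \<mu>) (?V (length (u @ [x])))"
    using snoc by (intro append_letters_words_over[where U = "?V (length u)" and V = "{a. positive [a]}"]
        R basis_elt_words_over) auto
  have 2: "append_letters (basis_elt u) (odot x y) \<in>
      words_over (Q_adjoin \<mu>) (?V (length (u @ [x])))"
    using snoc assms(2)
    by (intro append_letters_words_over[where U = "?V (length u)" and V = "{a. positive [a]}"]
        R basis_elt_words_over odot_words_over) auto
  show ?case
    unfolding eq by (rule submod_diff[OF sub R 1 submodD(3)[OF sub mu_in_Q_adjoin 2]])
qed

text \<open>Instance of \<open>generated_by_letter\<close>. A last letter with k > 1 makes the word
  admissible, and a last letter with k = 1 differs from the chosen one by a special triple.\<close>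

lemma QY_generated:
  assumes "m > 0" and G: "submod (Q_adjoin \<mu>) scale G" "QY0 \<mu> \<subseteq> G"
    and mul: "\<And>u. u \<in> G \<Longrightarrow> stuffle \<mu> u (basis_elt [(1, m)]) \<in> G"
  shows "QY \<mu> \<subseteq> G"
proof -
  note R = scalar_ring_Q_adjoin[of \<mu>]
  have base: "x \<in> G" if "x \<in> {basis_elt []} \<union> {basis_elt w | w. admissible w} \<union>
      {basis_elt (u @ [(1, m)]) - basis_elt (u @ [(1, m')]) | u m m'. special u m m'}" for x
    using G(2) span_over_base[OF scale.module_axioms scalar_ringD(5)[OF R] that]
    unfolding QY0_def by blast
  show ?thesis
    unfolding QY_eq_words_over
  proof (rule words_over_subset[OF G(1)],
      rule generated_by_letter[where y = "(1, m)" and S = "\<lambda>u. stuffle_words \<mu> u [(1, m)]", OF R G(1)])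
    show "basis_elt [] \<in> G" by (rule base) simp
  next
    fix u assume u: "u \<in> {w. positive w}"
    show "stuffle_words \<mu> u [(1, m)] - (\<Sum>i\<le>length u. basis_elt (take i u @ (1, m) # drop i u)) \<in>
        words_over (Q_adjoin \<mu>) {v \<in> {w. positive w}. length v \<le> length u}"
      using stuffle_words_letter[of u "(1, m)" \<mu>] u assms(1) by (simp add: insertions_def)
    show "stuffle_words \<mu> u [(1, m)] \<in> G" if "basis_elt u \<in> G"
      using mul[OF that] by (simp add: stuffle_def)
  next
    fix u x assume ux: "u @ [x] \<in> {w. positive w}" "x \<noteq> (1, m)"
    obtain k l where x: "x = (k, l)" by force
    show "basis_elt (u @ [x]) \<in> G \<or> basis_elt (u @ [x]) - basis_elt (u @ [(1, m)]) \<in> G"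
    proof (cases "k = 1")
      case True
      then show ?thesis
        using ux x assms(1) by (intro disjI2 base) (auto simp: special_def)
    next
      case False
      then show ?thesis
        using ux x by (intro disjI1 base) (auto simp: admissible_def)
    qed
  qed (use assms(1) in auto)
qed

section \<open>Convergence of truncated sums\<close>

lemma summable_Suc_powr: "s < -1 \<Longrightarrow> summable (\<lambda>n. real (Suc n) powr s)"
  using summable_Suc_iff[of "\<lambda>n. real n powr s"] summable_real_powr_iff[of s] by simp

lemma denom_factor_lower_bound:
  assumes "Re \<mu> > 0" "m > 0"
  obtains c where "c > 0" "\<And>n. c * real (Suc n) \<le> Re (of_nat n * \<mu> + of_rat m)"
    "\<And>n. c * real (Suc n) \<le> norm (of_nat n * \<mu> + of_rat m)"
proof
  \<comment> \<open>Re (n mu + m) = n Re mu + m is at least (n + 1) times the smaller of Re mu and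
    m.\<close>
  define c where "c = min (Re \<mu>) (of_rat m)"
  show "c > 0" using assms by (simp add: c_def)
  show 1: "c * real (Suc n) \<le> Re (of_nat n * \<mu> + of_rat m)" for n
  proof -
    have "c * real n \<le> Re \<mu> * real n" "c \<le> of_rat m"
      by (auto simp: c_def intro: mult_right_mono)
    then show ?thesis by (simp add: Re_of_rat algebra_simps)
  qed
  show "c * real (Suc n) \<le> norm (of_nat n * \<mu> + of_rat m)" for n
    using 1[of n] complex_Re_le_cmod order_trans by blast
qed

lemma letter_val_bound:
  assumes "Re \<mu> > 0" "positive [x]"
  obtains K where "K > 0" "\<And>n. norm (\<mu> * letter_val \<mu> n x) \<le> K * real (Suc n) powr - real (fst x)"
proof -
  obtain k m where x: "x = (k, m)" by force
  then have m: "m > 0" using assms by simp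
  obtain c where c: "c > 0" "\<And>n. c * real (Suc n) \<le> norm (of_nat n * \<mu> + of_rat m)"
    using denom_factor_lower_bound[OF assms(1) m] by metis
  have "norm (\<mu> * letter_val \<mu> n x) \<le> (norm \<mu> / c ^ k) * real (Suc n) powr - real (fst x)" for n
  proof -
    have "norm (\<mu> * letter_val \<mu> n x) = norm \<mu> / norm (of_nat n * \<mu> + of_rat m) ^ k"
      by (simp add: letter_val_def x norm_mult norm_divide norm_power)
    also have "\<dots> \<le> norm \<mu> / (c * real (Suc n)) ^ k"
    proof -
      have "0 < c * real (Suc n)" using c(1) by simp
      moreover from this have "0 < norm (of_nat n * \<mu> + of_rat m)" using c(2)[of n] by linarith
      ultimately show ?thesis
        using c(2) by (intro divide_left_mono power_mono mult_pos_pos zero_less_power c(1))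
            auto
    qed
    also have "\<dots> = (norm \<mu> / c ^ k) * real (Suc n) powr - real (fst x)"
      by (simp add: x power_mult_distrib powr_minus powr_realpow field_simps del: of_nat_Suc)
    finally show ?thesis .
  qed
  moreover have "norm \<mu> / c ^ k > 0"
  proof -
    have "\<mu> \<noteq> 0" using assms(1) by auto
    then show ?thesis using c(1) by simp
  qed
  ultimately show ?thesis using that by blast
qed

text \<open>A substitute for polylogarithmic growth that avoids logarithms and is stable under
  summation with weights 1/(n+1). The successor keeps the base positive at n = 0.\<close>

definition subpoly :: "(nat \<Rightarrow> 'a :: real_normed_vector) \<Rightarrow> bool" where
  "subpoly f \<longleftrightarrow> (\<forall>\<delta>>0. \<exists>K>0. \<forall>n. norm (f n) \<le> K * real (Suc n) powr \<delta>)"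

lemma subpolyE:
  assumes "subpoly f" "\<delta> > 0"
  obtains K where "K > 0" "\<And>n. norm (f n) \<le> K * real (Suc n) powr \<delta>"
  using assms unfolding subpoly_def by blast

text \<open>Half of the exponent bounds \<open>f\<close>, the other half buys convergence:
  (n+1)^(d/2 - 1) equals (n+1)^d times the summable (n+1)^(-1 - d/2), and (n+1)^d is at most
  (M+1)^d.\<close>

lemma subpoly_partial_sum:
  assumes f: "subpoly (f :: nat \<Rightarrow> real)" "\<And>n. f n \<ge> 0"
  shows "subpoly (\<lambda>M. \<Sum>n\<le>M. f n / real (Suc n))"
  unfolding subpoly_def
proof (intro allI impI)
  fix \<delta> :: real assume "\<delta> > 0"
  then obtain K where K: "K > 0" "\<And>n. norm (f n) \<le> K * real (Suc n) powr (\<delta> / 2)"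
    using subpolyE[OF f(1), of "\<delta> / 2"] by auto
  let ?g = "\<lambda>n. real (Suc n) powr (-1 - \<delta> / 2)"
  have g: "summable ?g" using \<open>\<delta> > 0\<close> by (intro summable_Suc_powr) simp
  \<comment> \<open>Adding 1 to the sum makes the constant visibly positive, as
    \<open>subpoly\<close> demands.\<close>
  have "norm (\<Sum>n\<le>M. f n / real (Suc n)) \<le> (K * (suminf ?g + 1)) * real (Suc M) powr \<delta>" for M
  proof -
    have "norm (\<Sum>n\<le>M. f n / real (Suc n)) = (\<Sum>n\<le>M. f n / real (Suc n))"
      using f(2) by (auto intro!: abs_of_nonneg sum_nonneg divide_nonneg_pos)
    also have "\<dots> \<le> (\<Sum>n\<le>M. K * real (Suc M) powr \<delta> * ?g n)"
    proof (rule sum_mono)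
      fix n assume n: "n \<in> {..M}"
      have "f n / real (Suc n) \<le> K * real (Suc n) powr (\<delta> / 2) / real (Suc n)"
        using K(2)[of n] f(2)[of n] by (intro divide_right_mono) auto
      also have "\<dots> = K * (real (Suc n) powr (\<delta> / 2) * real (Suc n) powr -1)"
        by (simp add: powr_minus_divide del: of_nat_Suc)
      also have "real (Suc n) powr (\<delta> / 2) * real (Suc n) powr -1 = real (Suc n) powr \<delta> * ?g n"
        unfolding powr_add[symmetric] by simp
      also have "K * (real (Suc n) powr \<delta> * ?g n) = K * real (Suc n) powr \<delta> * ?g n"
        by simp
      also have "\<dots> \<le> K * real (Suc M) powr \<delta> * ?g n"
        using n K(1) \<open>\<delta> > 0\<close> by (intro mult_right_mono mult_left_mono powr_mono2) auto
      finally show "f n / real (Suc n) \<le> K * real (Suc M) powr \<delta> * ?g n" .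
    qed
    also have "\<dots> = K * real (Suc M) powr \<delta> * (\<Sum>n\<le>M. ?g n)"
      by (simp add: sum_distrib_left)
    also have "\<dots> \<le> K * real (Suc M) powr \<delta> * (suminf ?g + 1)"
      using K(1) sum_le_suminf[OF g, of "{..M}"] by (intro mult_left_mono) auto
    finally show ?thesis by (simp add: mult_ac)
  qed
  moreover have "K * (suminf ?g + 1) > 0"
    using K(1) suminf_nonneg[OF g] by (intro mult_pos_pos) auto
  ultimately show "\<exists>K>0. \<forall>M. norm (\<Sum>n\<le>M. f n / real (Suc n)) \<le> K * real (Suc M) powr \<delta>"
    by blast
qed

lemma subpoly_mono:
  assumes "subpoly f" "\<And>n. norm (g n) \<le> C * norm (f n)"
  shows "subpoly g"
  unfolding subpoly_def
proof (intro allI impI)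
  fix \<delta> :: real assume "\<delta> > 0"
  then obtain K where K: "K > 0" "\<And>n. norm (f n) \<le> K * real (Suc n) powr \<delta>"
    using subpolyE[OF assms(1)] by blast
  have "norm (g n) \<le> ((\<bar>C\<bar> + 1) * K) * real (Suc n) powr \<delta>" for n
  proof -
    have "norm (g n) \<le> (\<bar>C\<bar> + 1) * norm (f n)"
      using assms(2)[of n] by (rule order_trans) (auto intro: mult_right_mono)
    also have "\<dots> \<le> (\<bar>C\<bar> + 1) * (K * real (Suc n) powr \<delta>)"
      using K(2) by (intro mult_left_mono) auto
    finally show ?thesis by (simp only: mult.assoc)
  qed
  then show "\<exists>K>0. \<forall>n. norm (g n) \<le> K * real (Suc n) powr \<delta>"
    using K(1) by (intro exI[of _ "(\<bar>C\<bar> + 1) * K"]) auto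
qed

text \<open>The sums defining \<open>zeta_mu\<close> and \<open>D_mu\<close> are unordered, so their
  convergence is controlled through sums of norms.\<close>

definition trunc_zeta_abs :: "complex \<Rightarrow> nat \<Rightarrow> biindex \<Rightarrow> real" where
  "trunc_zeta_abs \<mu> M w = (\<Sum>ns\<in>trunc_tuples (length w) M. norm (\<mu> ^ length w / denom \<mu> w ns))"

lemma trunc_zeta_abs_nonneg: "trunc_zeta_abs \<mu> M w \<ge> 0"
  unfolding trunc_zeta_abs_def by (intro sum_nonneg) auto

lemma norm_trunc_zeta_le: "norm (trunc_zeta \<mu> M w) \<le> trunc_zeta_abs \<mu> M w"
  unfolding trunc_zeta_def trunc_zeta_abs_def by (rule norm_sum)

lemma trunc_zeta_abs_snoc:
  "trunc_zeta_abs \<mu> M (w @ [x]) = (\<Sum>n\<le>M. norm (\<mu> * letter_val \<mu> n x) * trunc_zeta_abs \<mu> n w)"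
  unfolding trunc_zeta_abs_def length_append list.size add_0_right sum_trunc_tuples_Suc add_Suc_right
    sum_distrib_left
  by (intro sum.cong refl)
    (auto simp: trunc_tuples_def mono_tuples_def denom_append norm_mult norm_divide)

text \<open>Every letter has k at least 1 and contributes a weight of order at most 1/(n+1), so
  \<open>subpoly_partial_sum\<close> applies letter by letter.\<close>

lemma subpoly_trunc_zeta_abs:
  assumes "Re \<mu> > 0" "positive w"
  shows "subpoly (\<lambda>M. trunc_zeta_abs \<mu> M w)"
  using assms(2)
proof (induction w rule: rev_induct)
  case Nil
  have "1 \<le> real (Suc n) powr \<delta>" if "\<delta> > 0" for n \<delta>
    using that by (intro ge_one_powr_ge_zero) auto
  then show ?case
    by (auto simp: subpoly_def trunc_zeta_abs_def denom_def intro!: exI[of _ 1])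
next
  case (snoc x w)
  obtain K where K: "K > 0" "\<And>n. norm (\<mu> * letter_val \<mu> n x) \<le> K * real (Suc n) powr - real (fst x)"
    using letter_val_bound[OF assms(1), of x] snoc.prems by auto
  have x: "fst x \<ge> 1" using snoc.prems by (cases x) simp
  have "norm (\<mu> * letter_val \<mu> n x) \<le> K * (1 / real (Suc n))" for n
  proof -
    have "real (Suc n) powr - real (fst x) \<le> real (Suc n) powr -1"
      using x by (intro powr_mono) auto
    then have "K * real (Suc n) powr - real (fst x) \<le> K * real (Suc n) powr -1"
      using K(1) by (intro mult_left_mono) auto
    then have "K * real (Suc n) powr - real (fst x) \<le> K * (1 / real (Suc n))"
      by (simp only: powr_minus_divide powr_one[OF of_nat_0_le_iff])
    with K(2)[of n] show ?thesis by (rule order_trans)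
  qed
  then have *: "norm (\<mu> * letter_val \<mu> n x) * trunc_zeta_abs \<mu> n w \<le> K * (trunc_zeta_abs \<mu> n w / real (Suc n))" for n
    using mult_right_mono[OF _ trunc_zeta_abs_nonneg, of "norm (\<mu> * letter_val \<mu> n x)" "K * (1 / real (Suc n))" \<mu> n w]
    by simp
  show ?case
  proof (rule subpoly_mono[OF subpoly_partial_sum[of "\<lambda>n. trunc_zeta_abs \<mu> n w"]])
    show "subpoly (\<lambda>n. trunc_zeta_abs \<mu> n w)" using snoc by simp
    show "norm (trunc_zeta_abs \<mu> M (w @ [x])) \<le> K * norm (\<Sum>n\<le>M. trunc_zeta_abs \<mu> n w / real (Suc n))" for M
    proof -
      have "norm (trunc_zeta_abs \<mu> M (w @ [x])) = trunc_zeta_abs \<mu> M (w @ [x])"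
        using trunc_zeta_abs_nonneg by simp
      also have "\<dots> \<le> (\<Sum>n\<le>M. K * (trunc_zeta_abs \<mu> n w / real (Suc n)))"
        unfolding trunc_zeta_abs_snoc by (intro sum_mono *)
      also have "\<dots> = K * (\<Sum>n\<le>M. trunc_zeta_abs \<mu> n w / real (Suc n))"
        by (simp add: sum_distrib_left)
      also have "\<dots> \<le> K * norm (\<Sum>n\<le>M. trunc_zeta_abs \<mu> n w / real (Suc n))"
        using K(1) by (intro mult_left_mono) auto
      finally show ?thesis .
    qed
  qed (rule trunc_zeta_abs_nonneg)
qed

lemma subpoly_trunc_zeta:
  assumes "Re \<mu> > 0" "positive w"
  shows "subpoly (\<lambda>M. trunc_zeta \<mu> M w)"
  by (rule subpoly_mono[OF subpoly_trunc_zeta_abs[OF assms], of _ 1])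
    (simp add: trunc_zeta_abs_nonneg norm_trunc_zeta_le)

text \<open>Decay of order n^(-2), up to a factor of subpolynomial growth, leaves room for any extra
  power p < 1. The case p = 0 gives absolute convergence; positive p gives rates for the
  error.\<close>

lemma summable_subpoly:
  assumes "subpoly f" "\<And>n. norm (g n) \<le> C * norm (f n) * real (Suc n) powr -2" "p < 1"
  shows "summable (\<lambda>n. real (Suc n) powr p * norm (g n))"
proof -
  \<comment> \<open>Half the distance from p to 1, which keeps p + delta - 2 below -1.\<close>
  define \<delta> where "\<delta> = (1 - p) / 2"
  have "\<delta> > 0" using assms(3) by (simp add: \<delta>_def)
  then obtain K where K: "K > 0" "\<And>n. norm (f n) \<le> K * real (Suc n) powr \<delta>"
    using subpolyE[OF assms(1)] by blast
  have 1: "summable (\<lambda>n. \<bar>C\<bar> * K * real (Suc n) powr (p + \<delta> - 2))"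
    using assms(3) by (intro summable_mult summable_Suc_powr) (simp add: \<delta>_def field_simps)
  have 2: "norm (real (Suc n) powr p * norm (g n)) \<le> \<bar>C\<bar> * K * real (Suc n) powr (p + \<delta> - 2)" for n
  proof -
    have "norm (g n) \<le> \<bar>C\<bar> * norm (f n) * real (Suc n) powr -2"
      using assms(2)[of n] by (rule order_trans) (intro mult_right_mono; simp)
    also have "\<dots> \<le> \<bar>C\<bar> * (K * real (Suc n) powr \<delta>) * real (Suc n) powr -2"
      using K(2) by (intro mult_right_mono mult_left_mono) auto
    finally have "real (Suc n) powr p * norm (g n) \<le>
        real (Suc n) powr p * (\<bar>C\<bar> * (K * real (Suc n) powr \<delta>) * real (Suc n) powr -2)"
      by (intro mult_left_mono) auto
    also have "\<dots> = \<bar>C\<bar> * K * (real (Suc n) powr p * real (Suc n) powr \<delta> * real (Suc n) powr -2)"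
      by (simp only: mult_ac)
    also have "real (Suc n) powr p * real (Suc n) powr \<delta> * real (Suc n) powr -2 = real (Suc n) powr (p + \<delta> - 2)"
      unfolding powr_add[symmetric] by simp
    finally show ?thesis by (simp add: abs_mult)
  qed
  show ?thesis by (rule summable_comparison_test'[OF 1 2])
qed

lemma suminf_tail_tendsto_0:
  fixes f :: "nat \<Rightarrow> real"
  assumes "summable f"
  shows "(\<lambda>M. suminf (\<lambda>i. f (i + Suc M))) \<longlonglongrightarrow> 0"
proof -
  have "(\<lambda>M. suminf f - sum f {..<Suc M}) \<longlonglongrightarrow> suminf f - suminf f"
    using summable_LIMSEQ[OF assms] by (intro tendsto_intros filterlim_compose[OF _ filterlim_Suc])
  then show ?thesis
    by (simp only: suminf_minus_initial_segment[OF assms] diff_self)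
qed

text \<open>The error is a tail over indices beyond M. The factor t^j is at most a constant times
  (M+1)^(j delta) and can be moved into the tail, where each base is larger; what remains is the
  tail of a convergent series.\<close>

lemma partial_sum_error:
  fixes g :: "nat \<Rightarrow> complex"
  assumes f: "subpoly f" "\<And>n. norm (g n) \<le> C * norm (f n) * real (Suc n) powr -2"
    and t: "subpoly t"
  shows "(\<lambda>M. ((\<Sum>n\<le>M. g n) - suminf g) * t M ^ j) \<longlonglongrightarrow> 0"
proof -
  \<comment> \<open>This choice gives j delta < 1, the margin allowed by
    \<open>summable_subpoly\<close>.\<close>
  define \<delta> where "\<delta> = 1 / (2 * real (Suc j))"
  obtain K where K: "K > 0" "\<And>n. norm (t n) \<le> K * real (Suc n) powr \<delta>"
    using subpolyE[OF t, of \<delta>] by (auto simp: \<delta>_def)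
  have "real j * \<delta> < 1" by (simp add: \<delta>_def field_simps)
  let ?h = "\<lambda>n. real (Suc n) powr (real j * \<delta>) * norm (g n)"
  have h: "summable ?h" by (rule summable_subpoly[OF f]) fact
  have "summable (\<lambda>n. norm (g n))" using summable_subpoly[OF f, of 0] by simp
  then have g: "summable g" by (rule summable_norm_cancel)
  have gM: "summable (\<lambda>i. norm (g (i + Suc M)))" for M
    using \<open>summable (\<lambda>n. norm (g n))\<close> by (simp only: summable_iff_shift[of "\<lambda>n. norm (g n)"])
  have bound: "norm (((\<Sum>n\<le>M. g n) - suminf g) * t M ^ j) \<le> K ^ j * (suminf (\<lambda>i. ?h (i + Suc M)))" for M
  proof -
    have "(\<Sum>n\<le>M. g n) - suminf g = - (suminf (\<lambda>i. g (i + Suc M)))"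
      using suminf_minus_initial_segment[OF g, of "Suc M"] by (simp add: lessThan_Suc_atMost)
    then have "norm (((\<Sum>n\<le>M. g n) - suminf g) * t M ^ j) = norm (suminf (\<lambda>i. g (i + Suc M))) * norm (t M) ^ j"
      by (simp add: norm_mult norm_power)
    also have "\<dots> \<le> suminf (\<lambda>i. norm (g (i + Suc M))) * (K ^ j * real (Suc M) powr (real j * \<delta>))"
    proof (rule mult_mono)
      show "norm (suminf (\<lambda>i. g (i + Suc M))) \<le> suminf (\<lambda>i. norm (g (i + Suc M)))"
        by (intro summable_norm gM)
      have "norm (t M) ^ j \<le> (K * real (Suc M) powr \<delta>) ^ j"
        using K(2) by (intro power_mono) auto
      also have "\<dots> = K ^ j * real (Suc M) powr (real j * \<delta>)"
        by (simp add: power_mult_distrib powr_power mult.commute del: of_nat_Suc)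
      finally show "norm (t M) ^ j \<le> K ^ j * real (Suc M) powr (real j * \<delta>)" .
    qed (use suminf_nonneg[OF gM] in auto)
    also have "(suminf (\<lambda>i. norm (g (i + Suc M)))) * (K ^ j * real (Suc M) powr (real j * \<delta>)) =
       K ^ j * (suminf (\<lambda>i. real (Suc M) powr (real j * \<delta>) * norm (g (i + Suc M))))"
      unfolding suminf_mult[OF gM] by (simp only: mult_ac)
    also have "\<dots> \<le> K ^ j * (suminf (\<lambda>i. ?h (i + Suc M)))"
    proof (intro mult_left_mono suminf_le)
      show "summable (\<lambda>i. real (Suc M) powr (real j * \<delta>) * norm (g (i + Suc M)))"
        by (intro summable_mult gM)
      show "summable (\<lambda>i. ?h (i + Suc M))"
        using h by (simp only: summable_iff_shift[of ?h])
      show "real (Suc M) powr (real j * \<delta>) * norm (g (i + Suc M)) \<le> ?h (i + Suc M)" for i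
        by (intro mult_right_mono powr_mono2) (auto simp: \<delta>_def)
    qed (use K(1) in auto)
    finally show ?thesis .
  qed
  have "(\<lambda>M. K ^ j * suminf (\<lambda>i. ?h (i + Suc M))) \<longlonglongrightarrow> K ^ j * 0"
    by (intro tendsto_intros suminf_tail_tendsto_0 h)
  then show ?thesis
    unfolding mult_zero_right by (rule Lim_null_comparison[OF always_eventually[OF allI[OF bound]]])
qed

lemma summable_of_subpoly:
  fixes g :: "nat \<Rightarrow> complex"
  assumes "subpoly f" "\<And>n. norm (g n) \<le> C * norm (f n) * real (Suc n) powr -2"
  shows "summable g" "summable (\<lambda>n. norm (g n))"
proof -
  show "summable (\<lambda>n. norm (g n))" using summable_subpoly[OF assms, of 0] by simp
  then show "summable g" by (rule summable_norm_cancel)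
qed

text \<open>Every finite set of monotone tuples lies in the truncated sets from some bound on. Hence
  the bound on truncated sums of norms gives summability, and truncation is a cofinal way to compute
  the unordered sum.\<close>

lemma trunc_sum_tendsto_infsum:
  fixes f :: "nat list \<Rightarrow> complex"
  assumes "\<And>M. (\<Sum>ns\<in>trunc_tuples r M. norm (f ns)) \<le> B"
  shows "(\<lambda>M. \<Sum>ns\<in>trunc_tuples r M. f ns) \<longlonglongrightarrow> (\<Sum>\<^sub>\<infinity>ns\<in>mono_tuples r. f ns)"
proof -
  have sub: "\<exists>M0. \<forall>M\<ge>M0. X \<subseteq> trunc_tuples r M" if "finite X" "X \<subseteq> mono_tuples r" for X
  proof (intro exI allI impI subsetI)
    \<comment> \<open>Inserting 0 keeps the maximum meaningful when no entry occurs.\<close>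
    fix M ns assume M: "M \<ge> Max (insert 0 (\<Union>(set ` X)))" and ns: "ns \<in> X"
    have "n \<le> M" if "n \<in> set ns" for n
    proof -
      have "n \<le> Max (insert 0 (\<Union>(set ` X)))"
        using that ns \<open>finite X\<close> by (intro Max_ge) auto
      with M show ?thesis by simp
    qed
    then show "ns \<in> trunc_tuples r M" using ns that(2) by (auto simp: trunc_tuples_def)
  qed
  have "(\<lambda>ns. norm (f ns)) summable_on mono_tuples r"
  proof (rule nonneg_bdd_above_summable_on)
    show "bdd_above (sum (\<lambda>ns. norm (f ns)) ` {X. X \<subseteq> mono_tuples r \<and> finite X})"
    proof (rule bdd_aboveI2)
      fix X assume X: "X \<in> {X. X \<subseteq> mono_tuples r \<and> finite X}"
      then have "finite X" "X \<subseteq> mono_tuples r" by auto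
      from sub[OF this] obtain M where "X \<subseteq> trunc_tuples r M" by auto
      then have "(\<Sum>ns\<in>X. norm (f ns)) \<le> (\<Sum>ns\<in>trunc_tuples r M. norm (f ns))"
        by (intro sum_mono2) auto
      with assms[of M] show "(\<Sum>ns\<in>X. norm (f ns)) \<le> B" by linarith
    qed
  qed auto
  then have "f summable_on mono_tuples r"
    by (rule abs_summable_summable)
  then have "(sum f \<longlongrightarrow> (\<Sum>\<^sub>\<infinity>ns\<in>mono_tuples r. f ns)) (finite_subsets_at_top (mono_tuples r))"
    using has_sum_infsum unfolding has_sum_def by blast
  moreover have "filterlim (trunc_tuples r) (finite_subsets_at_top (mono_tuples r)) sequentially"
    unfolding filterlim_finite_subsets_at_top
  proof (intro allI impI)
    fix X assume "finite X \<and> X \<subseteq> mono_tuples r"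
    then obtain M0 where M0: "\<And>M. M \<ge> M0 \<Longrightarrow> X \<subseteq> trunc_tuples r M" using sub[of X] by auto
    have "trunc_tuples r M \<subseteq> mono_tuples r" for M by (auto simp: trunc_tuples_def)
    with M0 show "\<forall>\<^sub>F M in sequentially.
        finite (trunc_tuples r M) \<and> X \<subseteq> trunc_tuples r M \<and> trunc_tuples r M \<subseteq> mono_tuples r"
      unfolding eventually_sequentially by (intro exI[of _ M0]) simp
  qed
  ultimately show ?thesis
    by (rule filterlim_compose)
qed

text \<open>Here \<open>h n\<close> collects the factors that depend on the largest index. The
  unordered sum over tuples becomes an ordinary series in that index, with truncated sums as
  coefficients; all later error estimates use this form.\<close>

lemma mono_tuples_sums:
  fixes f :: "nat list \<Rightarrow> complex"
  assumes "Re \<mu> > 0" "positive u" and h: "\<And>n. norm (h n) \<le> C * real (Suc n) powr -2"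
    and f: "\<And>ns n. length ns = length u \<Longrightarrow> f (ns @ [n]) = h n * (\<mu> ^ length u / denom \<mu> u ns)"
  shows "(\<lambda>n. h n * trunc_zeta \<mu> n u) sums (\<Sum>\<^sub>\<infinity>ns\<in>mono_tuples (Suc (length u)). f ns)"
proof -
  let ?g = "\<lambda>n. complex_of_real (norm (h n) * trunc_zeta_abs \<mu> n u)"
  have len: "length ns = length u" if "ns \<in> trunc_tuples (length u) n" for ns n
    using that by (simp add: trunc_tuples_def mono_tuples_def)
  have "summable (\<lambda>n. norm (?g n))"
    by (rule summable_of_subpoly(2)[OF subpoly_trunc_zeta_abs[OF assms(1,2)], of _ C])
      (use h mult_right_mono[OF h trunc_zeta_abs_nonneg] in
        \<open>simp add: norm_mult trunc_zeta_abs_nonneg mult_ac del: of_nat_Suc\<close>)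
  then have s: "summable (\<lambda>n. norm (h n) * trunc_zeta_abs \<mu> n u)"
    by (simp add: norm_mult trunc_zeta_abs_nonneg)
  have "(\<Sum>ns\<in>trunc_tuples (Suc (length u)) M. norm (f ns)) \<le>
      suminf (\<lambda>n. norm (h n) * trunc_zeta_abs \<mu> n u)" for M
  proof -
    have "(\<Sum>ns\<in>trunc_tuples (Suc (length u)) M. norm (f ns)) =
        (\<Sum>n\<le>M. norm (h n) * trunc_zeta_abs \<mu> n u)"
      unfolding sum_trunc_tuples_Suc trunc_zeta_abs_def sum_distrib_left
      by (intro sum.cong refl) (simp add: f len norm_mult norm_divide)
    also have "\<dots> \<le> suminf (\<lambda>n. norm (h n) * trunc_zeta_abs \<mu> n u)"
      by (intro sum_le_suminf s) (auto simp: trunc_zeta_abs_nonneg)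
    finally show ?thesis .
  qed
  from trunc_sum_tendsto_infsum[OF this]
  have "(\<lambda>M. \<Sum>n\<le>M. h n * trunc_zeta \<mu> n u) \<longlonglongrightarrow> (\<Sum>\<^sub>\<infinity>ns\<in>mono_tuples (Suc (length u)). f ns)"
    unfolding sum_trunc_tuples_Suc trunc_zeta_def sum_distrib_left
    by (simp add: f len cong: sum.cong)
  then show ?thesis by (simp add: sums_def_le)
qed

lemma admissible_sums:
  assumes "Re \<mu> > 0" "admissible (u @ [x])"
  shows "(\<lambda>n. \<mu> * letter_val \<mu> n x * trunc_zeta \<mu> n u) sums zeta_mu \<mu> (u @ [x])"
    and "\<exists>C. \<forall>n. norm (\<mu> * letter_val \<mu> n x) \<le> C * real (Suc n) powr -2"
proof -
  have x: "positive [x]" "positive u" "fst x \<ge> 2" using assms(2) by (auto simp: admissible_def)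
  obtain K where K: "K > 0" "\<And>n. norm (\<mu> * letter_val \<mu> n x) \<le> K * real (Suc n) powr - real (fst x)"
    using letter_val_bound[OF assms(1) x(1)] by metis
  have *: "norm (\<mu> * letter_val \<mu> n x) \<le> K * real (Suc n) powr -2" for n
    using K(2)[of n] by (rule order_trans) (use K(1) x(3) in \<open>intro mult_left_mono powr_mono; simp\<close>)
  then show "\<exists>C. \<forall>n. norm (\<mu> * letter_val \<mu> n x) \<le> C * real (Suc n) powr -2" by blast
  show "(\<lambda>n. \<mu> * letter_val \<mu> n x * trunc_zeta \<mu> n u) sums zeta_mu \<mu> (u @ [x])"
    unfolding zeta_mu_def length_append list.size add_0_right add_Suc_right
    by (rule mono_tuples_sums[OF assms(1) x(2) *]) (simp add: denom_append)
qed

text \<open>The difference of two simple fractions has their product as denominator, so the two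
  divergent letters cancel down to the decay of a letter with k = 2. The quotient by mu in the
  constant appears because each of the two factors carries its own mu.\<close>

lemma special_letter_bound:
  assumes "Re \<mu> > 0" "m > 0" "m' > 0"
  shows "\<exists>C. \<forall>n. norm (\<mu> * letter_val \<mu> n (1, m) - \<mu> * letter_val \<mu> n (1, m')) \<le> C * real (Suc n) powr -2"
    and "\<mu> * letter_val \<mu> n (1, m) - \<mu> * letter_val \<mu> n (1, m') =
      of_rat (m' - m) * \<mu> * letter_val \<mu> n (1, m) * letter_val \<mu> n (1, m')"
proof -
  have eq: "\<mu> * letter_val \<mu> n (1, m) - \<mu> * letter_val \<mu> n (1, m') =
      of_rat (m' - m) * \<mu> * letter_val \<mu> n (1, m) * letter_val \<mu> n (1, m')" for n
    using denom_factor_nonzero[OF assms(1,2), of n] denom_factor_nonzero[OF assms(1,3), of n]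
    by (simp add: letter_val_def divide_simps of_rat_diff) (simp add: algebra_simps)
  then show "\<mu> * letter_val \<mu> n (1, m) - \<mu> * letter_val \<mu> n (1, m') =
      of_rat (m' - m) * \<mu> * letter_val \<mu> n (1, m) * letter_val \<mu> n (1, m')" .
  have mu: "\<mu> \<noteq> 0" using assms(1) by auto
  obtain K where K: "K > 0" "\<And>n. norm (\<mu> * letter_val \<mu> n (1, m)) \<le> K * real (Suc n) powr -1"
    using letter_val_bound[OF assms(1), of "(1, m)"] assms(2) by auto
  obtain L where L: "L > 0" "\<And>n. norm (\<mu> * letter_val \<mu> n (1, m')) \<le> L * real (Suc n) powr -1"
    using letter_val_bound[OF assms(1), of "(1, m')"] assms(3) by auto
  have "norm (\<mu> * letter_val \<mu> n (1, m) - \<mu> * letter_val \<mu> n (1, m')) \<le>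
      (norm (of_rat (m' - m) / \<mu>) * K * L) * real (Suc n) powr -2" for n
  proof -
    have "norm (\<mu> * letter_val \<mu> n (1, m) - \<mu> * letter_val \<mu> n (1, m')) =
        norm (of_rat (m' - m) / \<mu>) * (norm (\<mu> * letter_val \<mu> n (1, m)) * norm (\<mu> * letter_val \<mu> n (1, m')))"
      unfolding eq norm_mult[symmetric] using mu by (simp add: mult_ac)
    also have "\<dots> \<le> norm (of_rat (m' - m) / \<mu>) * ((K * real (Suc n) powr -1) * (L * real (Suc n) powr -1))"
      using K(1) by (intro mult_left_mono mult_mono K(2) L(2)) auto
    also have "\<dots> = (norm (of_rat (m' - m) / \<mu>) * K * L) * (real (Suc n) powr -1 * real (Suc n) powr -1)"
      by (simp only: mult_ac)
    also have "real (Suc n) powr -1 * real (Suc n) powr -1 = real (Suc n) powr -2"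
      unfolding powr_add[symmetric] by simp
    finally show ?thesis .
  qed
  then show "\<exists>C. \<forall>n. norm (\<mu> * letter_val \<mu> n (1, m) - \<mu> * letter_val \<mu> n (1, m')) \<le> C * real (Suc n) powr -2"
    by blast
qed

lemma special_sums:
  assumes "Re \<mu> > 0" "special u m m'"
  shows "(\<lambda>n. (\<mu> * letter_val \<mu> n (1, m) - \<mu> * letter_val \<mu> n (1, m')) * trunc_zeta \<mu> n u) sums D_mu \<mu> u m m'"
proof -
  have m: "m > 0" "m' > 0" "positive u" "m \<noteq> m'" using assms(2) by (auto simp: special_def)
  obtain C where C: "\<And>n. norm (\<mu> * letter_val \<mu> n (1, m) - \<mu> * letter_val \<mu> n (1, m')) \<le> C * real (Suc n) powr -2"
    using special_letter_bound(1)[OF assms(1) m(1,2)] by blast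
  let ?h = "\<lambda>n. \<mu> * letter_val \<mu> n (1, m) * letter_val \<mu> n (1, m')"
  have d: "of_rat (m' - m) \<noteq> (0 :: complex)" using m(4) by simp
  note eq = special_letter_bound(2)[OF assms(1) m(1,2)]
  have "norm (?h n) \<le> C / norm (of_rat (m' - m) :: complex) * real (Suc n) powr -2" for n
    using C[of n] d unfolding eq by (simp add: norm_mult field_simps del: of_nat_Suc)
  from mono_tuples_sums[OF assms(1) m(3) this, of "\<lambda>ns. \<mu> ^ (length u + 1) /
        (denom \<mu> u ns * (of_nat (last ns) * \<mu> + of_rat m) * (of_nat (last ns) * \<mu> + of_rat m'))"]
  have "(\<lambda>n. ?h n * trunc_zeta \<mu> n u) sums (\<Sum>\<^sub>\<infinity>ns\<in>mono_tuples (length u + 1). \<mu> ^ (length u + 1) /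
        (denom \<mu> u ns * (of_nat (last ns) * \<mu> + of_rat m) * (of_nat (last ns) * \<mu> + of_rat m')))"
    by (simp add: denom_append letter_val_def)
  from sums_mult[OF this, of "of_rat (m' - m)"] show ?thesis
    unfolding D_mu_def eq by (simp only: mult.assoc)
qed

section \<open>Convergent elements and their errors\<close>

lemma submod_Z_mu: "submod (Q_adjoin \<mu>) (*) (Z_mu \<mu>)"
  unfolding Z_mu_def
  by (rule submod_span_over) (auto simp: scalar_ring_Q_adjoin module_def algebra_simps)

lemma Z_mu_base:
  assumes "x \<in> {1} \<union> {zeta_mu \<mu> w | w. admissible w} \<union> {D_mu \<mu> u m m' | u m m'. special u m m'}"
  shows "x \<in> Z_mu \<mu>"
  unfolding Z_mu_def
  by (rule span_over_base[OF _ scalar_ringD(5)[OF scalar_ring_Q_adjoin] assms])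
    (auto simp: module_def algebra_simps)

text \<open>Reduces the error claims for \<open>QY0\<close> and \<open>QX0\<close> to their spanning
  elements, producing the limit and its membership in \<open>Z\<close> together. The function
  \<open>t\<close> will be the divergent letter.\<close>

lemma submod_limits:
  fixes val :: "'i \<Rightarrow> 'a \<Rightarrow> complex" and t :: "'i \<Rightarrow> complex"
  assumes "submod R (*) Z"
  shows "submod R scale {w. \<exists>c\<in>Z. \<forall>j. ((\<lambda>i. (lin_val (val i) w - c) * t i ^ j) \<longlongrightarrow> 0) Fl}"
  unfolding submod_def
proof (intro conjI ballI CollectI)
  show "\<exists>c\<in>Z. \<forall>j. ((\<lambda>i. (lin_val (val i) 0 - c) * t i ^ j) \<longlongrightarrow> 0) Fl"
    using submodD(1)[OF assms] by (intro bexI[of _ 0]) auto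
next
  fix u v assume "u \<in> {w. \<exists>c\<in>Z. \<forall>j. ((\<lambda>i. (lin_val (val i) w - c) * t i ^ j) \<longlongrightarrow> 0) Fl}"
    "v \<in> {w. \<exists>c\<in>Z. \<forall>j. ((\<lambda>i. (lin_val (val i) w - c) * t i ^ j) \<longlongrightarrow> 0) Fl}"
  then obtain c d where cd: "c \<in> Z" "d \<in> Z"
    "\<And>j. ((\<lambda>i. (lin_val (val i) u - c) * t i ^ j) \<longlongrightarrow> 0) Fl"
    "\<And>j. ((\<lambda>i. (lin_val (val i) v - d) * t i ^ j) \<longlongrightarrow> 0) Fl" by blast
  have "((\<lambda>i. (lin_val (val i) (u + v) - (c + d)) * t i ^ j) \<longlongrightarrow> 0) Fl" for j
    using tendsto_add[OF cd(3)[of j] cd(4)[of j]] by (simp add: algebra_simps)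
  then show "\<exists>c\<in>Z. \<forall>j. ((\<lambda>i. (lin_val (val i) (u + v) - c) * t i ^ j) \<longlongrightarrow> 0) Fl"
    using submodD(2)[OF assms cd(1,2)] by (intro bexI[of _ "c + d"]) auto
next
  fix a u assume a: "a \<in> R" and "u \<in> {w. \<exists>c\<in>Z. \<forall>j. ((\<lambda>i. (lin_val (val i) w - c) * t i ^ j) \<longlongrightarrow> 0) Fl}"
  then obtain c where c: "c \<in> Z" "\<And>j. ((\<lambda>i. (lin_val (val i) u - c) * t i ^ j) \<longlongrightarrow> 0) Fl" by blast
  have "((\<lambda>i. (lin_val (val i) (scale a u) - a * c) * t i ^ j) \<longlongrightarrow> 0) Fl" for j
    using tendsto_mult_right[OF c(2)[of j], of a] by (simp add: algebra_simps)
  then show "\<exists>c\<in>Z. \<forall>j. ((\<lambda>i. (lin_val (val i) (scale a u) - c) * t i ^ j) \<longlongrightarrow> 0) Fl"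
    using submodD(3)[OF assms a c(1)] by (intro bexI[of _ "a * c"]) auto
qed

lemma admissible_error:
  assumes "Re \<mu> > 0" "admissible w" "subpoly t"
  shows "(\<lambda>M. (trunc_zeta \<mu> M w - zeta_mu \<mu> w) * t M ^ j) \<longlonglongrightarrow> 0"
proof -
  obtain u x where w: "w = u @ [x]" using assms(2) by (cases w rule: rev_cases) (auto simp: admissible_def)
  have u: "positive u" using assms(2) w by (simp add: admissible_def)
  obtain C where C: "\<And>n. norm (\<mu> * letter_val \<mu> n x) \<le> C * real (Suc n) powr -2"
    using admissible_sums(2)[OF assms(1)] assms(2) w by blast
  have "norm (\<mu> * letter_val \<mu> n x * trunc_zeta \<mu> n u) \<le>
      C * norm (trunc_zeta \<mu> n u) * real (Suc n) powr -2" for n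
    using mult_right_mono[OF C[of n], of "norm (trunc_zeta \<mu> n u)"]
    by (simp add: norm_mult mult_ac del: of_nat_Suc)
  from partial_sum_error[OF subpoly_trunc_zeta[OF assms(1) u] this assms(3), of j] show ?thesis
    using sums_unique[OF admissible_sums(1)[OF assms(1), of u x]] assms(2)
    by (simp add: w trunc_zeta_snoc)
qed

lemma special_error:
  assumes "Re \<mu> > 0" "special u m m'" "subpoly t"
  shows "(\<lambda>M. (trunc_zeta \<mu> M (u @ [(1, m)]) - trunc_zeta \<mu> M (u @ [(1, m')]) - D_mu \<mu> u m m') * t M ^ j) \<longlonglongrightarrow> 0"
proof -
  have m: "m > 0" "m' > 0" "positive u" using assms(2) by (auto simp: special_def)
  let ?h = "\<lambda>n. \<mu> * letter_val \<mu> n (1, m) - \<mu> * letter_val \<mu> n (1, m')"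
  obtain C where C: "\<And>n. norm (?h n) \<le> C * real (Suc n) powr -2"
    using special_letter_bound(1)[OF assms(1) m(1,2)] by blast
  have "norm (?h n * trunc_zeta \<mu> n u) \<le>
      C * norm (trunc_zeta \<mu> n u) * real (Suc n) powr -2" for n
    using mult_right_mono[OF C[of n], of "norm (trunc_zeta \<mu> n u)"]
    by (simp add: norm_mult mult_ac del: of_nat_Suc)
  from partial_sum_error[OF subpoly_trunc_zeta[OF assms(1) m(3)] this assms(3), of j] show ?thesis
    using sums_unique[OF special_sums[OF assms(1,2)]]
    by (simp add: trunc_zeta_snoc sum_subtractf left_diff_distrib)
qed

lemma QY0_error:
  assumes "Re \<mu> > 0" "w \<in> QY0 \<mu>" "subpoly t"
  shows "\<exists>c\<in>Z_mu \<mu>. \<forall>j. (\<lambda>M. (lin_val (trunc_zeta \<mu> M) w - c) * t M ^ j) \<longlonglongrightarrow> 0"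
proof -
  have "QY0 \<mu> \<subseteq> {w. \<exists>c\<in>Z_mu \<mu>. \<forall>j. (\<lambda>M. (lin_val (trunc_zeta \<mu> M) w - c) * t M ^ j) \<longlonglongrightarrow> 0}"
    unfolding QY0_def
  proof (rule span_over_subset[OF submod_limits[OF submod_Z_mu]], intro Un_least subsetI CollectI)
    fix w :: "biindex \<Rightarrow>\<^sub>0 complex" assume "w \<in> {basis_elt []}"
    then show "\<exists>c\<in>Z_mu \<mu>. \<forall>j. (\<lambda>M. (lin_val (trunc_zeta \<mu> M) w - c) * t M ^ j) \<longlonglongrightarrow> 0"
      by (intro bexI[of _ 1] Z_mu_base) auto
  next
    fix w :: "biindex \<Rightarrow>\<^sub>0 complex" assume "w \<in> {basis_elt w | w. admissible w}"
    then show "\<exists>c\<in>Z_mu \<mu>. \<forall>j. (\<lambda>M. (lin_val (trunc_zeta \<mu> M) w - c) * t M ^ j) \<longlonglongrightarrow> 0"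
    proof (elim CollectE exE conjE)
      fix v assume "w = basis_elt v" "admissible v"
      then show ?thesis
        using admissible_error[OF assms(1) _ assms(3)]
        by (intro bexI[of _ "zeta_mu \<mu> v"] Z_mu_base) auto
    qed
  next
    fix w :: "biindex \<Rightarrow>\<^sub>0 complex"
    assume "w \<in> {basis_elt (u @ [(1, m)]) - basis_elt (u @ [(1, m')]) | u m m'. special u m m'}"
    then obtain u m m' where "w = basis_elt (u @ [(1, m)]) - basis_elt (u @ [(1, m')])" "special u m m'"
      by blast
    then show "\<exists>c\<in>Z_mu \<mu>. \<forall>j. (\<lambda>M. (lin_val (trunc_zeta \<mu> M) w - c) * t M ^ j) \<longlonglongrightarrow> 0"
      using special_error[OF assms(1) _ assms(3)]
      by (intro bexI[of _ "D_mu \<mu> u m m'"] Z_mu_base) auto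
  qed
  then show ?thesis using assms(2) by blast
qed

lemma zeta_star_eqI:
  assumes "(\<lambda>M. lin_val (trunc_zeta \<mu> M) w - c) \<longlonglongrightarrow> 0"
  shows "zeta_star \<mu> w = c"
  unfolding zeta_star_def zeta_star_trunc_eq by (rule limI, rule LIM_zero_cancel[OF assms])

lemma QY0_subset_QY: "QY0 \<mu> \<subseteq> QY \<mu>"
  unfolding QY0_def QY_eq_words_over
proof (rule span_over_subset[OF submod_words_over[OF scalar_ring_Q_adjoin]])
  note R = scalar_ring_Q_adjoin[of \<mu>]
  note base = basis_elt_words_over[OF R] and sub = submod_words_over[OF R]
  show "{basis_elt []} \<union> {basis_elt w | w. admissible w} \<union>
      {basis_elt (u @ [(1, m)]) - basis_elt (u @ [(1, m')]) | u m m'. special u m m'}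
    \<subseteq> words_over (Q_adjoin \<mu>) {w. positive w}"
    by (auto simp: admissible_def special_def intro!: base submod_diff[OF sub R])
qed

text \<open>The difference equals (mu - m)/((n mu + m)(n + 1)). Every divergent letter can thus be
  compared with 1/(n+1), whose partial sums are harmonic numbers and whose power series is a
  logarithm.\<close>

lemma summable_letter_val_minus_harmonic:
  assumes "Re \<mu> > 0" "m > 0"
  shows "summable (\<lambda>n. norm (\<mu> * letter_val \<mu> n (1, m) - 1 / of_nat (Suc n)))"
proof -
  let ?d = "\<lambda>n. \<mu> * letter_val \<mu> n (1, m) - 1 / of_nat (Suc n)"
  obtain K where K: "K > 0" "\<And>n. norm (\<mu> * letter_val \<mu> n (1, m)) \<le> K * real (Suc n) powr -1"
    using letter_val_bound[OF assms(1), of "(1, m)"] assms(2) by auto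
  show ?thesis
  proof (rule summable_comparison_test'[OF summable_mult[OF summable_Suc_powr[of "-2"]]])
    fix n
    have "?d n = \<mu> * letter_val \<mu> n (1, m) * ((\<mu> - of_rat m) / \<mu>) / of_nat (Suc n)"
      using denom_factor_nonzero[OF assms, of n] assms(1)
      by (simp add: letter_val_def divide_simps del: of_nat_Suc) (auto simp: algebra_simps)
    then have "norm (?d n) = norm (\<mu> * letter_val \<mu> n (1, m)) * norm ((\<mu> - of_rat m) / \<mu>) / real (Suc n)"
      by (simp add: norm_mult norm_divide del: of_nat_Suc)
    also have "\<dots> \<le> K * real (Suc n) powr -1 * norm ((\<mu> - of_rat m) / \<mu>) / real (Suc n)"
      using K by (intro divide_right_mono mult_right_mono) auto
    also have "\<dots> = (K * norm ((\<mu> - of_rat m) / \<mu>)) * (real (Suc n) powr -1 * real (Suc n) powr -1)"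
      by (simp add: powr_minus_divide del: of_nat_Suc)
    also have "real (Suc n) powr -1 * real (Suc n) powr -1 = real (Suc n) powr -2"
      unfolding powr_add[symmetric] by simp
    finally show "norm (norm (?d n)) \<le> (K * norm ((\<mu> - of_rat m) / \<mu>)) * real (Suc n) powr -2"
      by simp
  qed simp
qed

lemma trunc_zeta_letter_infinity:
  assumes "Re \<mu> > 0" "m > 0"
  shows "filterlim (\<lambda>M. trunc_zeta \<mu> M [(1, m)]) at_infinity sequentially"
proof -
  let ?d = "\<lambda>n. \<mu> * letter_val \<mu> n (1, m) - 1 / of_nat (Suc n)"
  have "(\<lambda>M. \<Sum>n\<le>M. ?d n) \<longlonglongrightarrow> suminf ?d"
    by (rule summable_LIMSEQ'[OF summable_norm_cancel[OF summable_letter_val_minus_harmonic[OF assms]]])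
  moreover have "filterlim (\<lambda>M. of_real (harm (Suc M)) :: complex) at_infinity sequentially"
    by (intro filterlim_compose[OF filterlim_of_real_at_infinity] filterlim_compose[OF harm_at_top filterlim_Suc])
  ultimately have "filterlim (\<lambda>M. (\<Sum>n\<le>M. ?d n) + of_real (harm (Suc M))) at_infinity sequentially"
    by (rule tendsto_add_filterlim_at_infinity)
  moreover have "(\<Sum>n\<le>M. ?d n) + of_real (harm (Suc M)) = trunc_zeta \<mu> M [(1, m)]" for M
  proof -
    have "harm (Suc M) = (\<Sum>n\<le>M. 1 / real (Suc n))"
      by (induction M) (simp_all add: harm_Suc harm_expand divide_inverse)
    then show ?thesis
      using trunc_zeta_snoc[of \<mu> M "[]" "(1, m)"] by (simp add: sum_subtractf)
  qed
  ultimately show ?thesis by simp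
qed

lemma stuffle_regularisation:
  assumes "Re \<mu> > 0" "m > 0"
  shows "regularisation (Q_adjoin \<mu>) {w. positive w} (QY0 \<mu>) (stuffle \<mu>) (trunc_zeta \<mu>) sequentially
    (zeta_star \<mu>) (Z_mu \<mu>) [(1, m)]"
proof
  note R = scalar_ring_Q_adjoin[of \<mu>]
  show "scalar_ring (Q_adjoin \<mu>)" "submod (Q_adjoin \<mu>) (*) (Z_mu \<mu>)"
    by (rule R submod_Z_mu)+
  show "filterlim (\<lambda>i. trunc_zeta \<mu> i [(1, m)]) at_infinity sequentially"
    by (rule trunc_zeta_letter_infinity[OF assms])
  have t: "subpoly (\<lambda>M. trunc_zeta \<mu> M [(1, m)])"
    using assms by (intro subpoly_trunc_zeta) auto
  show "QY0 \<mu> \<subseteq> words_over (Q_adjoin \<mu>) {w. positive w}"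
    using QY0_subset_QY by (simp add: QY_eq_words_over)
  show "[(1, m)] \<in> {w. positive w}" using assms(2) by simp
  show "stuffle \<mu> u v \<in> words_over (Q_adjoin \<mu>) {w. positive w}"
    if "u \<in> words_over (Q_adjoin \<mu>) {w. positive w}" "v \<in> words_over (Q_adjoin \<mu>) {w. positive w}" for u v
    using stuffle_in_QY that unfolding QY_eq_words_over by blast
  show "\<forall>\<^sub>F M in sequentially. lin_val (trunc_zeta \<mu> M) (stuffle \<mu> u v) =
      lin_val (trunc_zeta \<mu> M) u * lin_val (trunc_zeta \<mu> M) v"
    if "u \<in> words_over (Q_adjoin \<mu>) {w. positive w}" "v \<in> words_over (Q_adjoin \<mu>) {w. positive w}" for u v
    using trunc_zeta_stuffle[OF assms(1)] that unfolding QY_eq_words_over by simp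
  show "words_over (Q_adjoin \<mu>) {w. positive w} \<subseteq> G"
    if "submod (Q_adjoin \<mu>) scale G" "QY0 \<mu> \<subseteq> G"
      "\<And>u. u \<in> G \<Longrightarrow> stuffle \<mu> u (basis_elt [(1, m)]) \<in> G" for G
    using QY_generated[OF assms(2) that] unfolding QY_eq_words_over .
  fix w assume w: "w \<in> QY0 \<mu>"
  from QY0_error[OF assms(1) w t] obtain c where
    c: "c \<in> Z_mu \<mu>" "\<And>j. (\<lambda>M. (lin_val (trunc_zeta \<mu> M) w - c) * trunc_zeta \<mu> M [(1, m)] ^ j) \<longlonglongrightarrow> 0"
    by blast
  have "zeta_star \<mu> w = c" using c(2)[of 0] by (intro zeta_star_eqI) simp
  with c show "zeta_star \<mu> w \<in> Z_mu \<mu>"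
    and "(\<lambda>M. (lin_val (trunc_zeta \<mu> M) w - zeta_star \<mu> w) * trunc_zeta \<mu> M [(1, m)] ^ j) \<longlonglongrightarrow> 0" for j
    by auto
next
  have "basis_elt [] \<in> QY0 \<mu>"
    unfolding QY0_def
    by (intro span_over_base scale.module_axioms scalar_ringD(5)[OF scalar_ring_Q_adjoin]) simp
  moreover have "zeta_star \<mu> (basis_elt []) = 1"
    by (rule zeta_star_eqI) simp
  ultimately show "\<exists>w\<in>QY0 \<mu>. zeta_star \<mu> w = 1" by blast
qed simp

lemma zeta_star_special:
  assumes "Re \<mu> > 0" "special u m m'"
  shows "zeta_star \<mu> (basis_elt (u @ [(1, m)]) - basis_elt (u @ [(1, m')])) = D_mu \<mu> u m m'"
proof (rule zeta_star_eqI)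
  have "subpoly (\<lambda>_. 0 :: complex)" by (auto simp: subpoly_def intro!: exI[of _ 1])
  from special_error[OF assms this, of 0]
  show "(\<lambda>M. lin_val (trunc_zeta \<mu> M) (basis_elt (u @ [(1, m)]) - basis_elt (u @ [(1, m')])) - D_mu \<mu> u m m')
    \<longlonglongrightarrow> 0" by simp
qed

section \<open>The integral \<open>H\<close>\<close>

text \<open>Mean value inequality on the half plane Re z <= B, which is convex and contains 0, and
  where the derivative is bounded by exp B.\<close>

lemma norm_exp_minus_1_le:
  fixes z :: complex
  assumes "Re z \<le> B" "B \<ge> 0"
  shows "norm (exp z - 1) \<le> exp B * norm z"
proof -
  have "norm (exp z - exp 0) \<le> exp B * norm (z - 0)"
  proof (rule field_differentiable_bound[of "{z. Re z \<le> B}"])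
    show "convex {z. Re z \<le> B}" by (rule convex_halfspace_Re_le)
    show "(exp has_field_derivative exp w) (at w within {z. Re z \<le> B})" for w
      by (rule DERIV_subset[OF DERIV_exp]) simp
    show "norm (exp w) \<le> exp B" if "w \<in> {z. Re z \<le> B}" for w
      using that by simp
  qed (use assms in auto)
  then show ?thesis by simp
qed

lemma has_integral_powr_complex:
  assumes "Re a > -1"
  shows "((\<lambda>t::real. of_real t powr a) has_integral 1 / (a + 1)) {0..1}"
proof -
  have a: "a + 1 \<noteq> 0" using assms by (metis add_eq_0_iff2 less_irrefl one_complex.sel(1) uminus_complex.sel(1))
  have "((\<lambda>t::real. of_real t powr a) has_integral
      (of_real 1 powr (a + 1) / (a + 1) - of_real 0 powr (a + 1) / (a + 1))) {0..1}"
  proof (rule fundamental_theorem_of_calculus_interior)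
    show "continuous_on {0..1} (\<lambda>t. complex_of_real t powr (a + 1) / (a + 1))"
      using assms a by (intro continuous_intros) auto
    show "((\<lambda>t. complex_of_real t powr (a + 1) / (a + 1)) has_vector_derivative of_real t powr a) (at t)"
      if "t \<in> {0<..<1}" for t
    proof (rule has_vector_derivative_real_field)
      show "((\<lambda>z. z powr (a + 1) / (a + 1)) has_field_derivative complex_of_real t powr a) (at (of_real t))"
        using that a DERIV_cdivide[OF has_field_derivative_powr[of "of_real t" "a + 1"], of "a + 1"]
        by (auto simp: complex_nonpos_Reals_iff)
    qed
  qed simp
  then show ?thesis by simp
qed

text \<open>For t <= 1/2 the denominator is harmless. For t > 1/2 write t = exp(-tau) with tau <=
  2(1 - t), so the numerator is of order 1 - t. The sum of the two bounds is a majorant that is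
  integrable for Re x > -1.\<close>

lemma norm_one_minus_powr_le:
  assumes "0 < t" "t < 1"
  shows "norm (1 - complex_of_real t powr x) / (1 - t) \<le> 2 * (1 + t powr Re x) + 2 * norm x * exp (norm x)"
proof (cases "t \<le> 1 / 2")
  case True
  have "norm (1 - complex_of_real t powr x) \<le> 1 + t powr Re x"
    using norm_triangle_ineq4[of 1 "complex_of_real t powr x"] assms by (simp add: norm_powr_real_powr)
  then have "norm (1 - complex_of_real t powr x) / (1 - t) \<le> (1 + t powr Re x) / (1 / 2)"
    using True by (intro frac_le) (auto intro: add_nonneg_nonneg)
  then show ?thesis by (simp add: add_increasing2)
next
  case False
  define \<tau> where "\<tau> = - ln t"
  have t0: "\<tau> \<ge> 0" using assms by (simp add: \<tau>_def)
  have "\<tau> = ln (1 / t)" using assms by (simp add: \<tau>_def ln_div)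
  also have "\<dots> \<le> 1 / t - 1" using assms by (intro ln_le_minus_one) auto
  also have "\<dots> = (1 - t) / t" using assms by (simp add: field_simps)
  also have "\<dots> \<le> (1 - t) / (1 / 2)" using assms False by (intro divide_left_mono) auto
  finally have t2: "\<tau> \<le> 2 * (1 - t)" by simp
  have "complex_of_real t powr x = exp (- (x * of_real \<tau>))"
    using assms by (simp add: powr_def \<tau>_def Ln_of_real mult.commute)
  then have "norm (1 - complex_of_real t powr x) = norm (exp (- (x * of_real \<tau>)) - 1)"
    by (simp add: norm_minus_commute)
  also have "\<dots> \<le> exp (norm x * \<tau>) * norm (- (x * of_real \<tau>))"
  proof (rule norm_exp_minus_1_le)
    have "Re (- (x * of_real \<tau>)) \<le> norm (- (x * of_real \<tau>))" by (rule complex_Re_le_cmod)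
    then show "Re (- (x * of_real \<tau>)) \<le> norm x * \<tau>" using t0 by (simp add: norm_mult)
  qed (use t0 in simp)
  also have "\<dots> = exp (norm x * \<tau>) * (norm x * \<tau>)" using t0 by (simp add: norm_mult)
  also have "\<dots> \<le> exp (norm x * 1) * (norm x * (2 * (1 - t)))"
    using t0 t2 False by (intro mult_mono mult_left_mono iffD2[OF exp_le_cancel_iff]) auto
  finally have "norm (1 - complex_of_real t powr x) / (1 - t) \<le> 2 * norm x * exp (norm x)"
    using assms by (simp add: field_simps)
  then show ?thesis by (simp add: add_increasing)
qed

text \<open>The partial sums of the expanded integrand are 1 - t^N times the integrand itself, so
  one bound for the integrand dominates all of them.\<close>

lemma H_sums:
  assumes "Re x > -1"
  shows "(\<lambda>n. 1 / of_nat (Suc n) - 1 / (of_nat (Suc n) + x)) sums H x"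
proof -
  define f :: "nat \<Rightarrow> real \<Rightarrow> complex" where "f = (\<lambda>n t. of_real t ^ n * (1 - of_real t powr x))"
  define G where "G = (\<lambda>t::real. 2 * (1 + t powr Re x) + 2 * norm x * exp (norm x))"
  have f: "(f n has_integral (1 / of_nat (Suc n) - 1 / (of_nat (Suc n) + x))) {0..1}" for n
  proof -
    have "((\<lambda>t::real. of_real t powr of_nat n - of_real t powr (of_nat n + x)) has_integral
       (1 / (of_nat n + 1) - 1 / (of_nat n + x + 1))) {0..1}"
      using assms by (intro has_integral_diff has_integral_powr_complex) auto
    then have "((\<lambda>t::real. of_real t powr of_nat n - of_real t powr (of_nat n + x)) has_integral
       (1 / of_nat (Suc n) - 1 / (of_nat (Suc n) + x))) {0..1}"
      by (simp add: add_ac)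
    then show ?thesis
    \<comment> \<open>At t = 0 the two integrands differ for n = 0, because 0 \<open>powr\<close> 0
      is 0 while 0^0 is 1; a null set removes the discrepancy.\<close>
    proof (rule has_integral_spike[of "{0}", rotated 2])
      fix t :: real assume t: "t \<in> {0..1} - {0}"
      then have "complex_of_real t powr of_nat n = of_real t ^ n"
        by (simp add: powr_nat')
      then show "f n t = of_real t powr of_nat n - of_real t powr (of_nat n + x)"
        by (simp add: f_def powr_add algebra_simps)
    qed auto
  qed
  have "(\<lambda>N. integral {0..1} (\<lambda>t. \<Sum>n<N. f n t)) \<longlonglongrightarrow>
      integral {0..1} (\<lambda>t::real. (1 - of_real t powr x) / (1 - of_real t))"
  proof (rule dominated_convergence(2))
    show "(\<lambda>t. \<Sum>n<N. f n t) integrable_on {0..1}" for N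
      using f by (intro integrable_sum) (auto simp: integrable_on_def)
    show "G integrable_on {0..1}"
      unfolding G_def using assms
      by (intro integrable_add integrable_on_mult_right integrable_on_powr_from_0) auto
    fix t :: real assume t: "t \<in> {0..1}"
    have geo: "(\<Sum>n<N. f n t) = (1 - of_real t ^ N) * ((1 - of_real t powr x) / (1 - of_real t))" for N
    proof (cases "t = 1")
      case False
      have "(\<Sum>n<N. f n t) = (\<Sum>n<N. of_real t ^ n) * (1 - of_real t powr x)"
        by (simp add: f_def sum_distrib_right)
      also have "(\<Sum>n<N. complex_of_real t ^ n) = (1 - of_real t ^ N) / (1 - of_real t)"
        using False by (subst sum_gp_strict) auto
      finally show ?thesis by simp
    qed (simp add: f_def)
    show "norm (\<Sum>n<N. f n t) \<le> G t" for N
    proof (cases "t = 0 \<or> t = 1")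
      case True
      then show ?thesis
        by (auto simp: geo G_def norm_mult add_increasing2 power_0_left)
    next
      case False
      then have t': "0 < t" "t < 1" using t by auto
      have "norm (\<Sum>n<N. f n t) = \<bar>1 - t ^ N\<bar> * (norm (1 - complex_of_real t powr x) / (1 - t))"
      proof -
        have "norm (1 - complex_of_real t ^ N) = \<bar>1 - t ^ N\<bar>"
          by (metis norm_of_real of_real_1 of_real_diff of_real_power)
        moreover have "norm (1 - complex_of_real t) = 1 - t"
          using t' by (metis abs_of_pos diff_gt_0_iff_gt norm_of_real of_real_1 of_real_diff)
        ultimately show ?thesis by (simp add: geo norm_mult norm_divide)
      qed
      also have "\<dots> \<le> 1 * (norm (1 - complex_of_real t powr x) / (1 - t))"
        using t' power_le_one[of t N] by (intro mult_right_mono) auto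
      also have "\<dots> \<le> G t" unfolding G_def using norm_one_minus_powr_le[OF t'] by simp
      finally show ?thesis .
    qed
    show "(\<lambda>N. \<Sum>n<N. f n t) \<longlonglongrightarrow> (1 - of_real t powr x) / (1 - of_real t)"
    proof (cases "t = 1")
      case True
      then show ?thesis by (simp add: f_def)
    next
      case False
      then have "(\<lambda>N. complex_of_real t ^ N) \<longlonglongrightarrow> 0" using t by (intro LIMSEQ_power_zero) auto
      from tendsto_mult[OF tendsto_diff[OF tendsto_const[of 1] this]
          tendsto_const[of "(1 - complex_of_real t powr x) / (1 - of_real t)"]]
      show ?thesis unfolding geo by simp
    qed
  qed
  moreover have "integral {0..1} (\<lambda>t. \<Sum>n<N. f n t) =
      (\<Sum>n<N. 1 / of_nat (Suc n) - 1 / (of_nat (Suc n) + x))" for N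
    using f by (intro integral_unique has_integral_sum) auto
  ultimately show ?thesis by (simp add: sums_def H_def)
qed

text \<open>For x = q/mu - 1 the term 1/(n + 1 + x) is mu/(n mu + q), and the harmonic parts cancel
  in the difference of the two series for \<open>H\<close>.\<close>

lemma c_mu_eq_D_mu:
  assumes "Re \<mu> > 0" "special [] m m'"
  shows "c_mu \<mu> m m' = D_mu \<mu> [] m m'"
proof -
  have m: "m > 0" "m' > 0" using assms(2) by (auto simp: special_def)
  have mu: "\<mu> \<noteq> 0" using assms(1) by auto
  have Re: "Re (of_rat q / \<mu> - 1) > -1" if "q > 0" for q :: rat
  proof -
    have "Re (of_rat q / \<mu>) = of_rat q * Re \<mu> / (norm \<mu>)\<^sup>2"
    proof -
      have "of_rat q = complex_of_real (of_rat q)" by (cases q) (simp add: of_rat_rat)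
      then show ?thesis by (simp add: Re_divide cmod_def)
    qed
    also have "\<dots> > 0" using that assms(1) mu by simp
    finally show ?thesis by simp
  qed
  have t: "1 / of_nat (Suc n) - 1 / (of_nat (Suc n) + (of_rat q / \<mu> - 1)) =
      1 / of_nat (Suc n) - \<mu> * letter_val \<mu> n (1, q)" if "q > 0" for n and q :: rat
    using denom_factor_nonzero[OF assms(1) that, of n] mu
    by (simp add: letter_val_def field_simps)
  from sums_diff[OF H_sums[OF Re[OF m(2)]] H_sums[OF Re[OF m(1)]]]
  have "(\<lambda>n. (\<mu> * letter_val \<mu> n (1, m) - \<mu> * letter_val \<mu> n (1, m'))) sums c_mu \<mu> m m'"
    unfolding t[OF m(1)] t[OF m(2)] c_mu_def by simp
  moreover have "(\<lambda>n. (\<mu> * letter_val \<mu> n (1, m) - \<mu> * letter_val \<mu> n (1, m'))) sums D_mu \<mu> [] m m'"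
    using special_sums[OF assms] by simp
  ultimately show ?thesis by (rule sums_unique2)
qed

section \<open>The shuffle product of iterated integrals\<close>

fun shift_of :: "xletter \<Rightarrow> rat" where
  "shift_of Lx = 0"
| "shift_of (Ly l) = l"

text \<open>In \<open>yx w\<close> the shifts are differences of consecutive entries of
  \<open>w\<close> and telescope to the last entry.\<close>

definition total_shift :: "xletter list \<Rightarrow> rat" where
  "total_shift W = (\<Sum>a\<leftarrow>W. shift_of a)"

lemma total_shift_simps [simp]:
  "total_shift [] = 0" "total_shift (a # W) = shift_of a + total_shift W"
  "total_shift (U @ W) = total_shift U + total_shift W" "total_shift (rev W) = total_shift W"
  "total_shift (replicate j Lx) = 0"
  by (auto simp: total_shift_def sum_list_replicate simp flip: rev_map)

text \<open>An intrinsic description of the words \<open>yx w\<close> with \<open>w\<close>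
  positive: the entries of \<open>w\<close> are recovered as sums of shifts over prefixes. A word
  starting with \<open>Lx\<close> is excluded, since its first sum is 0.\<close>

definition valid :: "xletter list \<Rightarrow> bool" where
  "valid W \<longleftrightarrow> (\<forall>n<length W. total_shift (take (Suc n) W) > 0)"

lemma valid_Nil [simp]: "valid []"
  by (simp add: valid_def)

lemma valid_snoc: "valid (W @ [a]) \<longleftrightarrow> valid W \<and> total_shift W + shift_of a > 0"
  by (auto simp: valid_def less_Suc_eq)

lemma total_shift_nonneg: "valid W \<Longrightarrow> total_shift W \<ge> 0"
  by (cases W rule: rev_cases) (auto simp: valid_snoc)

lemma total_shift_pos: "valid W \<Longrightarrow> W \<noteq> [] \<Longrightarrow> total_shift W > 0"
  by (cases W rule: rev_cases) (auto simp: valid_snoc)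

text \<open>The inserted letter raises every later prefix sum by l > 0 and leaves the earlier ones
  unchanged.\<close>

lemma valid_insert:
  assumes "l > 0" "valid (U @ W)"
  shows "valid (U @ Ly l # W)"
  using assms(2)
proof (induction W rule: rev_induct)
  case Nil
  then show ?case using assms(1) total_shift_nonneg[of U] by (simp add: valid_snoc)
next
  case (snoc a W)
  have "valid (U @ Ly l # W)" "total_shift (U @ W) + shift_of a > 0"
    using snoc by (simp_all add: valid_snoc flip: append_assoc)
  then show ?case
    using assms(1) by (simp add: valid_snoc flip: append_assoc append_Cons)
qed

lemma yx_from_snoc:
  "yx_from l (w @ [(k, m)]) =
     yx_from l w @ Ly (m - (if w = [] then l else snd (last w))) # replicate (k - 1) Lx"
  by (induction l w rule: yx_from.induct) auto

lemma total_shift_yx_from: "total_shift (yx_from l w) = (if w = [] then 0 else snd (last w) - l)"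
  by (induction l w rule: yx_from.induct) auto

lemma yx_Nil [simp]: "yx [] = []"
  by (simp add: yx_def)

lemma yx_snoc: "yx (w @ [(k, m)]) = yx w @ Ly (m - total_shift (yx w)) # replicate (k - 1) Lx"
  by (simp add: yx_def yx_from_snoc total_shift_yx_from)

lemma yx_letter [simp]: "yx [(Suc 0, m)] = [Ly m]"
  by (simp add: yx_def)

lemma valid_replicate_Lx: "valid (W @ [Ly l]) \<Longrightarrow> valid (W @ Ly l # replicate j Lx)"
proof (induction j)
  case (Suc j)
  then show ?case
    using valid_snoc[of "W @ Ly l # replicate j Lx" Lx] valid_snoc[of W "Ly l"]
    by (simp add: replicate_append_same flip: replicate_Suc)
qed simp

lemma valid_yx: "positive w \<Longrightarrow> valid (yx w)"
proof (induction w rule: rev_induct)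
  case (snoc x w)
  obtain k m where x: "x = (k, m)" by force
  have "valid (yx w @ [Ly (m - total_shift (yx w))])"
    using snoc by (simp add: valid_snoc x)
  then show ?case
    unfolding x yx_snoc by (rule valid_replicate_Lx)
qed simp

text \<open>Reading the word from left to right, \<open>Ly\<close> opens a new entry whose m is the
  current prefix sum, and \<open>Lx\<close> raises the exponent of the last entry by 1.\<close>

lemma valid_eq_yx: "valid W \<Longrightarrow> \<exists>w. positive w \<and> W = yx w"
proof (induction W rule: rev_induct)
  case Nil
  show ?case by (intro exI[of _ "[]"]) simp
next
  case (snoc a W)
  then obtain w where w: "positive w" "W = yx w" by (auto simp: valid_snoc)
  show ?case
  proof (cases a)
    case (Ly l)
    then show ?thesis
      using w snoc.prems
      by (intro exI[of _ "w @ [(1, total_shift W + l)]"]) (auto simp: yx_snoc valid_snoc)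
  next
    case Lx
    then have "w \<noteq> []" using snoc.prems w by (auto simp: valid_snoc)
    then obtain w' x where "w = w' @ [x]" by (cases w rule: rev_cases) auto
    then obtain k m where w': "w = w' @ [(k, m)]" by (cases x) auto
    then have k: "k \<ge> 1" using w(1) by simp
    have "replicate k Lx = replicate (k - 1) Lx @ [Lx]"
      using k by (cases k) (auto simp: replicate_append_same)
    then have "W @ [a] = yx (w' @ [(Suc k, m)])"
      using Lx by (simp add: w(2) w' yx_snoc)
    then show ?thesis
      using w(1) w' by (intro exI[of _ "w' @ [(Suc k, m)]"]) simp
  qed
qed

lemma valid_snoc_Lx:
  assumes "valid (W @ [Lx])"
  shows "\<exists>w. admissible w \<and> W @ [Lx] = yx w"
proof -
  obtain w where w: "positive w" "W @ [Lx] = yx w" using valid_eq_yx[OF assms] by blast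
  then have "w \<noteq> []" by auto
  then obtain w' x where "w = w' @ [x]" by (cases w rule: rev_cases) auto
  then obtain k m where w': "w = w' @ [(k, m)]" by (cases x) auto
  have "k \<noteq> 1" using w(2) by (auto simp: w' yx_snoc)
  then have "admissible w" using w(1) w' by (auto simp: admissible_def)
  with w(2) show ?thesis by blast
qed

lemma valid_snoc_Ly:
  assumes "valid (W @ [Ly l])"
  shows "\<exists>w. positive w \<and> W = yx w"
  using assms valid_eq_yx by (simp add: valid_snoc)

lemma QX1_eq_words_over: "QX1 \<mu> = words_over (Q_adjoin \<mu>) {W. valid W}"
proof -
  have "{basis_elt []} \<union> {basis_elt (yx w) | w. positive w} = (basis_elt ` {W. valid W} :: (xletter list \<Rightarrow>\<^sub>0 complex) set)"
    using valid_eq_yx valid_yx by fastforce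
  then show ?thesis
    unfolding QX1_def using span_over_basis_elt[OF scalar_ring_Q_adjoin] by simp
qed

text \<open>All words of a shuffle product use the same letters, hence have the same total shift.
  Keeping track of it gives validity, and later lets a common denominator and a common exponential
  factor be pulled out.\<close>

lemma shuffle_words_words_over:
  assumes "scalar_ring R" "valid U" "valid V"
  shows "shuffle_words U V \<in> words_over R {W. valid W \<and> total_shift W = total_shift U + total_shift V}"
  using assms(2,3)
proof (induction U V rule: shuffle_words.induct)
  case (3 u x v y)
  let ?W = "\<lambda>s. {W. valid W \<and> total_shift W = s}"
  let ?s = "total_shift (u @ [x]) + total_shift (v @ [y])"
  note sub = submod_words_over[OF assms(1), of "?W ?s"]
  have pos: "?s > 0" using 3 by (simp add: valid_snoc add_pos_pos)
  have "append_letters (shuffle_words u (v @ [y])) (basis_elt x) \<in> words_over R (?W ?s)"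
    using 3 pos by (intro append_letters_words_over[where U = "?W (total_shift u + total_shift (v @ [y]))"
        and V = "{x}"] basis_elt_words_over assms(1)) (auto simp: valid_snoc algebra_simps)
  moreover have "append_letters (shuffle_words (u @ [x]) v) (basis_elt y) \<in> words_over R (?W ?s)"
    using 3 pos by (intro append_letters_words_over[where U = "?W (total_shift (u @ [x]) + total_shift v)"
        and V = "{y}"] basis_elt_words_over assms(1)) (auto simp: valid_snoc algebra_simps)
  ultimately show ?case
    unfolding shuffle_words.simps by (rule submodD(2)[OF sub])
qed (auto intro!: basis_elt_words_over assms(1))

lemma shuffle_in_QX1:
  assumes "u \<in> QX1 \<mu>" "v \<in> QX1 \<mu>"
  shows "shuffle u v \<in> QX1 \<mu>"
proof -
  note R = scalar_ring_Q_adjoin[of \<mu>]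
  have "shuffle_words U V \<in> words_over (Q_adjoin \<mu>) {W. valid W}" if "valid U" "valid V" for U V
    using shuffle_words_words_over[OF R that] by (auto simp: words_over_def)
  then show ?thesis
    using assms unfolding QX1_eq_words_over shuffle_def
    by (intro bilin_ext_in_submod[of "Q_adjoin \<mu>"] R submod_words_over) auto
qed

lemma shuffle_words_Nil_right [simp]: "shuffle_words W [] = basis_elt W"
  by (cases W rule: rev_cases) simp_all

lemma shuffle_words_letter: "shuffle_words U [a] = insertions a U"
proof (induction U rule: rev_induct)
  case (snoc x U)
  then show ?case
    using shuffle_words.simps(3)[of U x "[]" a] by (simp add: insertions_snoc append_letters_single)
qed simp

lemma QX1_generated:
  assumes "m > 0" and G: "submod (Q_adjoin \<mu>) scale G" "QX0 \<mu> \<subseteq> G"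
    and mul: "\<And>u. u \<in> G \<Longrightarrow> shuffle u (basis_elt [Ly m]) \<in> G"
  shows "QX1 \<mu> \<subseteq> G"
proof -
  note R = scalar_ring_Q_adjoin[of \<mu>]
  have base: "x \<in> G" if "x \<in> {basis_elt []} \<union> {basis_elt (yx w) | w. admissible w} \<union>
      {basis_elt (yx (u @ [(1, m)])) - basis_elt (yx (u @ [(1, m')])) | u m m'. special u m m'}" for x
    using G(2) span_over_base[OF scale.module_axioms scalar_ringD(5)[OF R] that]
    unfolding QX0_def by blast
  show ?thesis
    unfolding QX1_eq_words_over
  proof (rule words_over_subset[OF G(1)],
      rule generated_by_letter[where y = "Ly m" and S = "\<lambda>u. shuffle_words u [Ly m]", OF R G(1)])
    show "basis_elt [] \<in> G" by (rule base) simp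
    show "u \<in> {W. valid W}" if "u @ [x] \<in> {W. valid W}" for u x
      using that by (simp add: valid_snoc)
    show "u @ Ly m # v \<in> {W. valid W}" if "u @ v \<in> {W. valid W}" for u v
      using that valid_insert[OF assms(1)] by simp
    show "shuffle_words u [Ly m] - (\<Sum>i\<le>length u. basis_elt (take i u @ Ly m # drop i u)) \<in>
        words_over (Q_adjoin \<mu>) {v \<in> {w. valid w}. length v \<le> length u}" for u
      using submodD(1)[OF submod_words_over[OF R]] by (simp add: shuffle_words_letter insertions_def)
    show "shuffle_words u [Ly m] \<in> G" if "basis_elt u \<in> G" for u
      using mul[OF that] by (simp add: shuffle_def)
  next
    fix u x assume ux: "u @ [x] \<in> {W. valid W}" "x \<noteq> Ly m"
    show "basis_elt (u @ [x]) \<in> G \<or> basis_elt (u @ [x]) - basis_elt (u @ [Ly m]) \<in> G"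
    proof (cases x)
      case Lx
      then obtain w where "admissible w" "u @ [x] = yx w"
        using valid_snoc_Lx ux by auto
      then show ?thesis by (intro disjI1 base) auto
    next
      case (Ly l)
      then obtain w where w: "positive w" "u = yx w" using valid_snoc_Ly ux by blast
      have sp: "special w (total_shift u + l) (total_shift u + m)"
        using ux Ly w assms(1) total_shift_nonneg[OF valid_yx[OF w(1)]]
        by (auto simp: special_def valid_snoc)
      have "u @ [x] = yx (w @ [(1, total_shift u + l)])" "u @ [Ly m] = yx (w @ [(1, total_shift u + m)])"
        using Ly by (simp_all add: yx_snoc w(2))
      then show ?thesis
        using sp by (intro disjI2 base) auto
    qed
  qed auto
qed

text \<open>The form attached to a letter, divided by dt/t and by t^l, as a power series in t^mu.
  The exponent l is recorded in the total shift instead.\<close>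

fun omega :: "complex \<Rightarrow> xletter \<Rightarrow> complex fps" where
  "omega \<mu> Lx = 1"
| "omega \<mu> (Ly l) = fps_const \<mu> * Abs_fps (\<lambda>_. 1)"

text \<open>The word is reversed because its last letter is the outermost integration. Integrating
  t^(n mu + s) dt/t divides the n-th coefficient by n mu + s.\<close>

fun li_rev :: "complex \<Rightarrow> xletter list \<Rightarrow> complex fps" where
  "li_rev \<mu> [] = 1"
| "li_rev \<mu> (a # W) = Abs_fps (\<lambda>n. fps_nth (omega \<mu> a * li_rev \<mu> W) n /
     (of_nat n * \<mu> + of_rat (total_shift (a # W))))"

text \<open>The iterated integral of the word \<open>W\<close> in the forms \<open>dt/t\<close> (for \<open>x\<close>) and
  \<open>\<mu> t\<^bsup>l-1\<^esup> dt/(1 - t\<^bsup>\<mu>\<^esup>)\<close> (for \<open>y\<^sub>l\<close>) from \<open>0\<close> to \<open>t\<close> is \<open>t\<^bsup>s\<^esup>\<close>, with \<open>s\<close> the total shift of \<open>W\<close>,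
  times this power series in \<open>t\<^bsup>\<mu>\<^esup>\<close>.\<close>

definition li :: "complex \<Rightarrow> xletter list \<Rightarrow> complex fps" where
  "li \<mu> W = li_rev \<mu> (rev W)"

lemma li_Nil [simp]: "li \<mu> [] = 1"
  by (simp add: li_def)

lemma li_snoc:
  "fps_nth (li \<mu> (W @ [a])) n =
     fps_nth (omega \<mu> a * li \<mu> W) n / (of_nat n * \<mu> + of_rat (total_shift (W @ [a])))"
  by (simp add: li_def add.commute)

text \<open>The operator t d/dt acting on t^c f(t^mu), written in terms of the power series f. Its
  product rule adds the exponents c.\<close>

definition euler_op :: "complex \<Rightarrow> complex \<Rightarrow> complex fps \<Rightarrow> complex fps" where
  "euler_op \<mu> c f = fps_const c * f + fps_const \<mu> * (fps_X * fps_deriv f)"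

lemma euler_op_nth: "fps_nth (euler_op \<mu> c f) n = (of_nat n * \<mu> + c) * fps_nth f n"
  by (cases n) (auto simp: euler_op_def algebra_simps)

lemma euler_op_mult: "euler_op \<mu> (c + d) (f * g) = euler_op \<mu> c f * g + f * euler_op \<mu> d g"
  by (simp add: euler_op_def algebra_simps flip: fps_const_add)

lemma euler_op_li:
  assumes "Re \<mu> > 0" "valid (W @ [a])"
  shows "euler_op \<mu> (of_rat (total_shift (W @ [a]))) (li \<mu> (W @ [a])) = omega \<mu> a * li \<mu> W"
proof (rule fps_ext)
  fix n
  show "fps_nth (euler_op \<mu> (of_rat (total_shift (W @ [a]))) (li \<mu> (W @ [a]))) n =
      fps_nth (omega \<mu> a * li \<mu> W) n"
    unfolding euler_op_nth li_snoc
    using denom_factor_nonzero[OF assms(1) total_shift_pos[OF assms(2)], of n] by simp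
qed

text \<open>Since all words of \<open>p\<close> have the same total shift, the last integration
  divides by one common denominator.\<close>

lemma lin_val_li_append_letters:
  assumes "Poly_Mapping.keys p \<subseteq> {W. total_shift W = s}"
  shows "lin_val (\<lambda>W. fps_nth (li \<mu> W) n) (append_letters p (basis_elt a)) =
    fps_nth (omega \<mu> a * Abs_fps (\<lambda>k. lin_val (\<lambda>W. fps_nth (li \<mu> W) k) p)) n /
      (of_nat n * \<mu> + of_rat (s + shift_of a))"
proof -
  have "lin_val (\<lambda>W. fps_nth (li \<mu> W) n) (append_letters p (basis_elt a)) =
      lin_val (\<lambda>W. fps_nth (omega \<mu> a * li \<mu> W) n) p *
      lin_val (\<lambda>_. 1 / (of_nat n * \<mu> + of_rat (s + shift_of a))) (basis_elt a)"
    using assms by (intro lin_val_append_letters) (auto simp: li_snoc)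
  also have "lin_val (\<lambda>W. fps_nth (omega \<mu> a * li \<mu> W) n) p =
      fps_nth (omega \<mu> a * Abs_fps (\<lambda>k. lin_val (\<lambda>W. fps_nth (li \<mu> W) k) p)) n"
    unfolding fps_mult_nth fps_nth_Abs_fps lin_val_def sum_distrib_left
    by (subst sum.swap) (simp add: mult_ac)
  finally show ?thesis by simp
qed

text \<open>The Euler operator turns the product of two power series into the recursion of the shuffle
  product, and it is injective because its eigenvalues \<open>n\<mu> + s\<close> do not vanish.\<close>

lemma li_shuffle_words:
  assumes "Re \<mu> > 0" "valid U" "valid V"
  shows "lin_val (\<lambda>W. fps_nth (li \<mu> W) n) (shuffle_words U V) = fps_nth (li \<mu> U * li \<mu> V) n"
  using assms(2,3)
proof (induction U V arbitrary: n rule: shuffle_words.induct)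
  case (3 u x v y)
  have val: "valid u" "valid v" using 3 by (auto simp: valid_snoc)
  have keys: "Poly_Mapping.keys (shuffle_words U V) \<subseteq> {W. total_shift W = total_shift U + total_shift V}"
    if "valid U" "valid V" for U V
    using shuffle_words_words_over[OF scalar_ring_Q_adjoin[of 0] that] by (auto simp: words_over_def)
  define s :: complex where "s = of_rat (total_shift (u @ [x]) + total_shift (v @ [y]))"
  have "total_shift (u @ [x]) + total_shift (v @ [y]) > 0"
    using 3 by (simp add: valid_snoc add_pos_pos)
  from denom_factor_nonzero[OF assms(1) this] have s: "of_nat n * \<mu> + s \<noteq> 0" unfolding s_def .
  have IH: "Abs_fps (\<lambda>k. lin_val (\<lambda>W. fps_nth (li \<mu> W) k) (shuffle_words u (v @ [y]))) = li \<mu> u * li \<mu> (v @ [y])"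
    "Abs_fps (\<lambda>k. lin_val (\<lambda>W. fps_nth (li \<mu> W) k) (shuffle_words (u @ [x]) v)) = li \<mu> (u @ [x]) * li \<mu> v"
    using 3 val by (auto intro: fps_ext)
  have "lin_val (\<lambda>W. fps_nth (li \<mu> W) n) (shuffle_words (u @ [x]) (v @ [y])) =
      fps_nth (omega \<mu> x * (li \<mu> u * li \<mu> (v @ [y]))) n / (of_nat n * \<mu> + s) +
      fps_nth (omega \<mu> y * (li \<mu> (u @ [x]) * li \<mu> v)) n / (of_nat n * \<mu> + s)"
    using lin_val_li_append_letters[OF keys[OF val(1) 3(4)], of \<mu> n x]
      lin_val_li_append_letters[OF keys[OF 3(3) val(2)], of \<mu> n y]
    by (simp add: IH s_def algebra_simps)
  also have "\<dots> = fps_nth (euler_op \<mu> s (li \<mu> (u @ [x]) * li \<mu> (v @ [y]))) n / (of_nat n * \<mu> + s)"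
    unfolding s_def of_rat_add euler_op_mult
      euler_op_li[OF assms(1) 3(3)] euler_op_li[OF assms(1) 3(4)]
    by (simp add: add_divide_distrib mult_ac)
  also have "\<dots> = fps_nth (li \<mu> (u @ [x]) * li \<mu> (v @ [y])) n"
    using s by (simp add: euler_op_nth)
  finally show ?case .
qed simp_all

lemma omega_Ly_nth: "fps_nth (omega \<mu> (Ly l) * f) n = \<mu> * (\<Sum>i\<le>n. fps_nth f i)"
proof -
  have "omega \<mu> (Ly l) * f = fps_const \<mu> * (f * Abs_fps (\<lambda>_. 1))" by (simp add: mult_ac)
  then show ?thesis
    by (simp only: fps_mult_left_const_nth) (simp add: fps_mult_nth atLeast0AtMost)
qed

text \<open>The letter \<open>Ly\<close> multiplies by a geometric series, which forms partial sums,
  and divides once by n mu + m; every following \<open>Lx\<close> divides by the same denominator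
  once more.\<close>

lemma li_yx:
  assumes "positive (w @ [(k, m)])"
  shows "fps_nth (li \<mu> (yx (w @ [(k, m)]))) n = \<mu> * letter_val \<mu> n (k, m) * (\<Sum>i\<le>n. fps_nth (li \<mu> (yx w)) i)"
proof -
  let ?W = "\<lambda>j. yx w @ Ly (m - total_shift (yx w)) # replicate j Lx"
  have "fps_nth (li \<mu> (?W j)) n = \<mu> * letter_val \<mu> n (Suc j, m) * (\<Sum>i\<le>n. fps_nth (li \<mu> (yx w)) i)" for j
  proof (induction j)
    case 0
    then show ?case
      using li_snoc[of \<mu> "yx w" "Ly (m - total_shift (yx w))" n]
      unfolding omega_Ly_nth by (simp add: letter_val_def)
  next
    case (Suc j)
    have "?W (Suc j) = ?W j @ [Lx]" by (simp add: replicate_append_same)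
    then show ?case
      using li_snoc[of \<mu> "?W j" Lx n] Suc by (simp add: letter_val_def)
  qed
  from this[of "k - 1"] show ?thesis using assms by (simp add: yx_snoc)
qed

text \<open>The link between the two sides: by \<open>li_yx\<close>, passing to partial sums of the
  coefficients follows exactly the recursion of \<open>trunc_zeta\<close>.\<close>

lemma li_partial_sum: "positive w \<Longrightarrow> (\<Sum>i\<le>n. fps_nth (li \<mu> (yx w)) i) = trunc_zeta \<mu> n w"
proof (induction w arbitrary: n rule: rev_induct)
  case Nil
  have "(\<Sum>i\<le>n. if i = 0 then 1 else (0 :: complex)) = 1" by (simp add: sum.delta)
  then show ?case by simp
next
  case (snoc x w)
  then show ?case
    by (cases x) (simp add: li_yx trunc_zeta_snoc del: fps_one_nth)
qed

lemma li_yx_snoc: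
  "positive (w @ [x]) \<Longrightarrow> fps_nth (li \<mu> (yx (w @ [x]))) n = \<mu> * letter_val \<mu> n x * trunc_zeta \<mu> n w"
  by (cases x) (simp add: li_yx li_partial_sum)

section \<open>Iterated integrals near the end point\<close>

text \<open>The iterated integral from 0 to t = exp(-s). In this parametrisation t^mu and t to the
  total shift are exponentials, so no choice of a complex power is involved.\<close>

definition lval :: "complex \<Rightarrow> real \<Rightarrow> xletter list \<Rightarrow> complex" where
  "lval \<mu> s W = exp (- (of_rat (total_shift W) * of_real s)) *
     suminf (\<lambda>n. fps_nth (li \<mu> W) n * exp (- (\<mu> * of_real s)) ^ n)"

lemma norm_exp_mu_less_1: "Re \<mu> > 0 \<Longrightarrow> s > 0 \<Longrightarrow> norm (exp (- (\<mu> * of_real s))) < 1"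
  by simp

text \<open>A crude bound suffices for convergence when |q| < 1: the last letter decays at least
  like 1/(n+1), and the truncated sum grows at most linearly.\<close>

lemma li_bounded:
  assumes "Re \<mu> > 0" "valid W"
  shows "\<exists>K. \<forall>n. norm (fps_nth (li \<mu> W) n) \<le> K"
proof -
  obtain w where w: "positive w" "W = yx w" using valid_eq_yx[OF assms(2)] by blast
  show ?thesis
  proof (cases w rule: rev_cases)
    case Nil
    then show ?thesis using w by (intro exI[of _ 1]) auto
  next
    case (snoc u x)
    then have u: "positive u" "positive [x]" and x: "fst x \<ge> 1"
      using w by (auto simp: positive_def)
    obtain K where K: "K > 0" "\<And>n. norm (\<mu> * letter_val \<mu> n x) \<le> K * real (Suc n) powr - real (fst x)"
      using letter_val_bound[OF assms(1) u(2)] by metis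
    obtain L where L: "L > 0" "\<And>n. norm (trunc_zeta \<mu> n u) \<le> L * real (Suc n) powr 1"
      using subpolyE[OF subpoly_trunc_zeta[OF assms(1) u(1)], of 1] by auto
    have "norm (fps_nth (li \<mu> W) n) \<le> K * L" for n
    proof -
      have "norm (fps_nth (li \<mu> W) n) = norm (\<mu> * letter_val \<mu> n x) * norm (trunc_zeta \<mu> n u)"
        using w snoc by (simp add: li_yx_snoc norm_mult)
      also have "\<dots> \<le> (K * real (Suc n) powr - real (fst x)) * (L * real (Suc n) powr 1)"
        using K L by (intro mult_mono) auto
      also have "\<dots> = (K * L) * (real (Suc n) powr - real (fst x) * real (Suc n) powr 1)"
        by (simp only: mult_ac)
      also have "real (Suc n) powr - real (fst x) * real (Suc n) powr 1 = real (Suc n) powr (1 - real (fst x))"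
        unfolding powr_add[symmetric] by simp
      also have "(K * L) * real (Suc n) powr (1 - real (fst x)) \<le> (K * L) * real (Suc n) powr 0"
        using K(1) L(1) x by (intro mult_left_mono powr_mono) auto
      finally show ?thesis by simp
    qed
    then show ?thesis by blast
  qed
qed

lemma summable_li:
  assumes "Re \<mu> > 0" "valid W" "norm q < 1"
  shows "summable (\<lambda>n. norm (fps_nth (li \<mu> W) n * q ^ n))"
proof -
  obtain K where K: "\<And>n. norm (fps_nth (li \<mu> W) n) \<le> K" using li_bounded[OF assms(1,2)] by blast
  show ?thesis
  proof (rule summable_comparison_test'[OF summable_mult[OF summable_geometric[of "norm q"], of K]])
    show "norm (norm (fps_nth (li \<mu> W) n * q ^ n)) \<le> K * norm q ^ n" for n
      using mult_right_mono[OF K[of n], of "norm q ^ n"] by (simp add: norm_mult norm_power)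
  qed (use assms(3) in simp)
qed

text \<open>The identity for coefficients passes to values through the Cauchy product. The
  exponential prefactor depends only on the total shift, which all words of the shuffle
  share.\<close>

lemma lval_shuffle_words:
  assumes "Re \<mu> > 0" "s > 0" "valid U" "valid V"
  shows "lin_val (lval \<mu> s) (shuffle_words U V) = lval \<mu> s U * lval \<mu> s V"
proof -
  define q where "q = exp (- (\<mu> * of_real s))"
  have q: "norm q < 1" unfolding q_def by (rule norm_exp_mu_less_1) fact+
  define p where "p = shuffle_words U V"
  define E where "E = exp (- (of_rat (total_shift U + total_shift V) * complex_of_real s))"
  have keys: "valid W" "total_shift W = total_shift U + total_shift V" if "W \<in> Poly_Mapping.keys p" for W
    using shuffle_words_words_over[OF scalar_ring_Q_adjoin[of 0] assms(3,4)] that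
    by (auto simp: words_over_def p_def)
  have sm: "summable (\<lambda>n. fps_nth (li \<mu> W) n * q ^ n)" if "W \<in> Poly_Mapping.keys p" for W
    using summable_norm_cancel[OF summable_li[OF assms(1) keys(1)[OF that] q]] .
  have "lin_val (lval \<mu> s) p =
      (\<Sum>W\<in>Poly_Mapping.keys p. Poly_Mapping.lookup p W * (E * suminf (\<lambda>n. fps_nth (li \<mu> W) n * q ^ n)))"
    unfolding lin_val_def lval_def q_def[symmetric] by (intro sum.cong refl) (simp add: keys E_def)
  also have "\<dots> = E * (\<Sum>W\<in>Poly_Mapping.keys p. suminf (\<lambda>n. Poly_Mapping.lookup p W * (fps_nth (li \<mu> W) n * q ^ n)))"
    unfolding sum_distrib_left
    by (intro sum.cong refl) (simp only: suminf_mult[OF sm] mult.left_commute)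
  also have "(\<Sum>W\<in>Poly_Mapping.keys p. suminf (\<lambda>n. Poly_Mapping.lookup p W * (fps_nth (li \<mu> W) n * q ^ n))) =
      suminf (\<lambda>n. \<Sum>W\<in>Poly_Mapping.keys p. Poly_Mapping.lookup p W * (fps_nth (li \<mu> W) n * q ^ n))"
    by (intro suminf_sum[symmetric] summable_mult sm)
  also have "(\<lambda>n. \<Sum>W\<in>Poly_Mapping.keys p. Poly_Mapping.lookup p W * (fps_nth (li \<mu> W) n * q ^ n)) =
      (\<lambda>n. fps_nth (li \<mu> U * li \<mu> V) n * q ^ n)"
    unfolding li_shuffle_words[OF assms(1,3,4), symmetric] p_def[symmetric]
    by (simp add: lin_val_def sum_distrib_right mult.assoc)
  also have "\<dots> = (\<lambda>n. \<Sum>i\<le>n. (fps_nth (li \<mu> U) i * q ^ i) * (fps_nth (li \<mu> V) (n - i) * q ^ (n - i)))"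
  proof
    fix n
    have "fps_nth (li \<mu> U) i * fps_nth (li \<mu> V) (n - i) * q ^ n =
        (fps_nth (li \<mu> U) i * q ^ i) * (fps_nth (li \<mu> V) (n - i) * q ^ (n - i))" if "i \<in> {..n}" for i
    proof -
      have "q ^ n = q ^ i * q ^ (n - i)" using that by (simp flip: power_add)
      then show ?thesis by (simp only: mult_ac)
    qed
    then show "fps_nth (li \<mu> U * li \<mu> V) n * q ^ n =
        (\<Sum>i\<le>n. (fps_nth (li \<mu> U) i * q ^ i) * (fps_nth (li \<mu> V) (n - i) * q ^ (n - i)))"
      unfolding fps_mult_nth sum_distrib_right atLeast0AtMost by (intro sum.cong refl)
  qed
  also have "suminf \<dots> = suminf (\<lambda>n. fps_nth (li \<mu> U) n * q ^ n) * suminf (\<lambda>n. fps_nth (li \<mu> V) n * q ^ n)"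
    using Cauchy_product_sums[OF summable_li[OF assms(1,3) q] summable_li[OF assms(1,4) q]]
    by (rule sums_unique[symmetric])
  moreover have "E = exp (- (of_rat (total_shift U) * of_real s)) * exp (- (of_rat (total_shift V) * of_real s))"
    unfolding E_def mult_exp_exp by (simp add: of_rat_add algebra_simps)
  ultimately show ?thesis
    unfolding p_def lval_def q_def[symmetric] by (simp only: mult_ac)
qed

lemma lval_shuffle:
  assumes "Re \<mu> > 0" "s > 0" "u \<in> QX1 \<mu>" "v \<in> QX1 \<mu>"
  shows "lin_val (lval \<mu> s) (shuffle u v) = lin_val (lval \<mu> s) u * lin_val (lval \<mu> s) v"
  unfolding shuffle_def using assms
  by (intro lin_val_bilin_ext_mult lval_shuffle_words) (auto simp: QX1_eq_words_over words_over_def)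

text \<open>The prefactor and q^n combine to exp(-(n mu + m) s). The value is therefore the series
  over the largest index, damped by this factor.\<close>

lemma lval_yx_sums:
  assumes "Re \<mu> > 0" "s > 0" "positive (w @ [(k, m)])"
  shows "(\<lambda>n. \<mu> * letter_val \<mu> n (k, m) * trunc_zeta \<mu> n w * exp (- ((of_nat n * \<mu> + of_rat m) * of_real s)))
    sums lval \<mu> s (yx (w @ [(k, m)]))"
proof -
  let ?W = "yx (w @ [(k, m)])"
  let ?q = "exp (- (\<mu> * of_real s))"
  have "(\<lambda>n. fps_nth (li \<mu> ?W) n * ?q ^ n) sums suminf (\<lambda>n. fps_nth (li \<mu> ?W) n * ?q ^ n)"
    using summable_norm_cancel[OF summable_li[OF assms(1) valid_yx[OF assms(3)] norm_exp_mu_less_1[OF assms(1,2)]]]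
    by (rule summable_sums)
  from sums_mult[OF this, of "exp (- (of_rat m * of_real s))"]
  have "(\<lambda>n. exp (- (of_rat m * of_real s)) * (fps_nth (li \<mu> ?W) n * ?q ^ n)) sums lval \<mu> s ?W"
    by (simp add: lval_def yx_snoc)
  moreover have "exp (- (of_rat m * of_real s)) * (fps_nth (li \<mu> ?W) n * ?q ^ n) =
      \<mu> * letter_val \<mu> n (k, m) * trunc_zeta \<mu> n w * exp (- ((of_nat n * \<mu> + of_rat m) * of_real s))" for n
  proof -
    have "exp (- (of_rat m * of_real s)) * ?q ^ n = exp (- ((of_nat n * \<mu> + of_rat m) * of_real s))"
      by (simp add: exp_of_nat_mult[symmetric] mult_exp_exp algebra_simps)
    then show ?thesis using assms(3) by (simp add: li_yx_snoc mult_ac)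
  qed
  ultimately show ?thesis by simp
qed

section \<open>Rates of convergence as s tends to 0\<close>

lemma exp_neg_le_powr:
  fixes x \<delta> :: real
  assumes "x > 0" "0 < \<delta>" "\<delta> \<le> 1"
  shows "exp (- x) \<le> x powr - \<delta>"
proof -
  have "x powr \<delta> \<le> 1 + x"
  proof (cases "x \<le> 1")
    case True
    then have "x powr \<delta> \<le> 1" using assms by (intro powr_le1) auto
    then show ?thesis using assms by linarith
  next
    case False
    then have "x powr \<delta> \<le> x powr 1" using assms by (intro powr_mono) auto
    then show ?thesis using assms by simp
  qed
  also have "\<dots> \<le> exp x" by (rule exp_ge_add_one_self)
  finally have "x powr \<delta> \<le> exp x" .
  then show ?thesis
    using assms by (simp add: exp_minus powr_minus le_imp_inverse_le)
qed

text \<open>The left side is at most min(|u|, 2), hence at most 2 |u|^(1/4). For u = (n mu + m) s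
  this costs only n^(1/4), affordable in a series that decays almost like n^(-2), and leaves the
  rate s^(1/4).\<close>

lemma norm_exp_neg_minus_1_le:
  assumes "Re u \<ge> 0"
  shows "norm (exp (- u) - 1) \<le> 2 * norm u powr (1 / 4)"
proof (cases "norm u \<le> 1")
  case True
  have "norm (exp (- u) - 1) \<le> norm u"
    using norm_exp_minus_1_le[of "- u" 0] assms by simp
  also have "\<dots> \<le> norm u powr (1 / 4)"
    using True powr_mono'[of "1 / 4" 1 "norm u"] by simp
  also have "\<dots> \<le> 2 * norm u powr (1 / 4)" by simp
  finally show ?thesis .
next
  case False
  have "norm (exp (- u) - 1) \<le> norm (exp (- u)) + norm (1 :: complex)"
    by (rule norm_triangle_ineq4)
  also have "\<dots> \<le> 2" using assms by simp
  also have "\<dots> \<le> 2 * norm u powr (1 / 4)" using False ge_one_powr_ge_zero[of "norm u" "1/4"] by simp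
  finally show ?thesis .
qed

lemma error_tendsto_0:
  fixes e t :: "real \<Rightarrow> complex"
  assumes e: "\<And>s. 0 < s \<Longrightarrow> s \<le> 1 \<Longrightarrow> norm (e s) \<le> C * s powr (1 / 4)"
    and t: "\<And>\<delta>. 0 < \<delta> \<Longrightarrow> \<delta> \<le> 1 \<Longrightarrow> \<exists>K. \<forall>s. 0 < s \<longrightarrow> s \<le> 1 \<longrightarrow> norm (t s) \<le> K * s powr - \<delta>"
  shows "((\<lambda>s. e s * t s ^ j) \<longlongrightarrow> 0) (at_right 0)"
proof -
  \<comment> \<open>With this choice t^j costs at most s^(-1/8), so the product still decays like
    s^(1/8).\<close>
  define \<delta> where "\<delta> = 1 / (8 * real (Suc j))"
  have \<delta>: "0 < \<delta>" "\<delta> \<le> 1" "real j * \<delta> \<le> 1 / 8" by (auto simp: \<delta>_def field_simps)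
  obtain K where K: "\<And>s. 0 < s \<Longrightarrow> s \<le> 1 \<Longrightarrow> norm (t s) \<le> K * s powr - \<delta>"
    using t[OF \<delta>(1,2)] by blast
  have bound: "norm (e s * t s ^ j) \<le> (\<bar>C\<bar> * \<bar>K\<bar> ^ j) * s powr (1 / 8)" if s: "0 < s" "s \<le> 1" for s
  proof -
    have "norm (e s * t s ^ j) = norm (e s) * norm (t s) ^ j" by (simp add: norm_mult norm_power)
    also have "\<dots> \<le> (\<bar>C\<bar> * s powr (1 / 4)) * (\<bar>K\<bar> * s powr - \<delta>) ^ j"
    proof (intro mult_mono power_mono)
      show "norm (e s) \<le> \<bar>C\<bar> * s powr (1 / 4)"
        using e[OF s] by (rule order_trans) (intro mult_right_mono; simp)
      show "norm (t s) \<le> \<bar>K\<bar> * s powr - \<delta>"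
        using K[OF s] by (rule order_trans) (intro mult_right_mono; simp)
    qed auto
    also have "\<dots> = (\<bar>C\<bar> * \<bar>K\<bar> ^ j) * (s powr (1 / 4) * (s powr - \<delta>) ^ j)"
      by (simp add: power_mult_distrib)
    also have "s powr (1 / 4) * (s powr - \<delta>) ^ j = s powr (1 / 4 - real j * \<delta>)"
    proof -
      have "(s powr - \<delta>) ^ j = s powr (- (real j * \<delta>))"
        using s by (simp add: powr_power mult.commute)
      then show ?thesis unfolding powr_add[symmetric] by (simp flip: powr_add)
    qed
    also have "(\<bar>C\<bar> * \<bar>K\<bar> ^ j) * s powr (1 / 4 - real j * \<delta>) \<le> (\<bar>C\<bar> * \<bar>K\<bar> ^ j) * s powr (1 / 8)"
      using s \<delta>(3) by (intro mult_left_mono powr_mono') auto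
    finally show ?thesis .
  qed
  have "((\<lambda>s::real. s powr (1 / 8)) \<longlongrightarrow> 0 powr (1 / 8)) (at_right 0)"
    by (rule tendsto_powr') (auto simp: eventually_at_filter)
  then have lim: "((\<lambda>s. (\<bar>C\<bar> * \<bar>K\<bar> ^ j) * s powr (1 / 8)) \<longlongrightarrow> 0) (at_right 0)"
    by (intro tendsto_mult_right_zero) simp
  have "\<forall>\<^sub>F s in at_right 0. norm (e s * t s ^ j) \<le> (\<bar>C\<bar> * \<bar>K\<bar> ^ j) * s powr (1 / 8)"
    unfolding eventually_at_right_field using bound by (intro exI[of _ 1]) auto
  from this lim show ?thesis by (rule Lim_null_comparison)
qed

lemma denom_factor_upper_bound:
  fixes \<mu> :: complex
  assumes "m > 0"
  shows "norm (of_nat n * \<mu> + of_rat m) \<le> (norm \<mu> + of_rat m) * real (Suc n)"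
proof -
  have "norm (of_nat n * \<mu> + of_rat m) \<le> real n * norm \<mu> + norm (of_rat m :: complex)"
    using norm_triangle_ineq[of "of_nat n * \<mu>" "of_rat m"] by (simp add: norm_mult)
  also have "norm (of_rat m :: complex) = of_rat m"
  proof -
    have "(of_rat m :: complex) = of_real (of_rat m)" by (cases m) (simp add: of_rat_rat)
    then show ?thesis using assms by simp
  qed
  also have "real n * norm \<mu> + of_rat m \<le> (norm \<mu> + of_rat m) * real (Suc n)"
    using assms by (simp add: algebra_simps)
  finally show ?thesis .
qed

lemma exp_factor_error:
  assumes "Re \<mu> > 0" "m > 0"
  shows "\<exists>C\<ge>0. \<forall>n s. s \<ge> 0 \<longrightarrow>
    norm (exp (- ((of_nat n * \<mu> + of_rat m) * of_real s)) - 1) \<le> C * real (Suc n) powr (1 / 4) * s powr (1 / 4)"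
proof (intro exI conjI allI impI)
  let ?B = "norm \<mu> + of_rat m :: real"
  have B: "?B \<ge> 0" using assms by (simp add: add_nonneg_nonneg)
  show "2 * ?B powr (1 / 4) \<ge> 0" by simp
  fix n and s :: real assume s: "s \<ge> 0"
  let ?u = "(of_nat n * \<mu> + of_rat m) * complex_of_real s"
  obtain c where c: "c > 0" "\<And>n. c * real (Suc n) \<le> Re (of_nat n * \<mu> + of_rat m)"
    using denom_factor_lower_bound[OF assms] by metis
  have "0 \<le> c * real (Suc n)" using c(1) by simp
  also note c(2)[of n]
  finally have "Re ?u \<ge> 0" using s by simp
  then have "norm (exp (- ?u) - 1) \<le> 2 * norm ?u powr (1 / 4)" by (rule norm_exp_neg_minus_1_le)
  also have "norm ?u \<le> ?B * real (Suc n) * s"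
    using mult_right_mono[OF denom_factor_upper_bound[OF assms(2), of n \<mu>] s] s by (simp add: norm_mult)
  then have "2 * norm ?u powr (1 / 4) \<le> 2 * (?B * real (Suc n) * s) powr (1 / 4)"
    by (intro mult_left_mono powr_mono2) auto
  also have "(?B * real (Suc n) * s) powr (1 / 4) = ?B powr (1 / 4) * real (Suc n) powr (1 / 4) * s powr (1 / 4)"
    using s B by (simp add: powr_mult)
  finally show "norm (exp (- ?u) - 1) \<le> 2 * ?B powr (1 / 4) * real (Suc n) powr (1 / 4) * s powr (1 / 4)"
    by (simp add: mult_ac)
qed

lemma suminf_diff_bound:
  fixes f g :: "nat \<Rightarrow> complex"
  assumes "f sums a" "g sums b" "\<And>n. norm (f n - g n) \<le> h n" "summable h"
  shows "norm (a - b) \<le> suminf h"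
proof -
  have "(\<lambda>n. f n - g n) sums (a - b)" using assms(1,2) by (rule sums_diff)
  then have "norm (a - b) = norm (suminf (\<lambda>n. f n - g n))" by (simp add: sums_iff)
  also have "\<dots> \<le> suminf h" by (intro norm_suminf_le assms(3,4))
  finally show ?thesis .
qed

text \<open>Termwise, damping changes the convergent series by at most a constant times n^(1/4)
  s^(1/4), and the series stays summable with the extra weight n^(1/4).\<close>

lemma lval_admissible_error:
  assumes "Re \<mu> > 0" "admissible w"
  shows "\<exists>C. \<forall>s. 0 < s \<longrightarrow> s \<le> 1 \<longrightarrow> norm (lval \<mu> s (yx w) - zeta_mu \<mu> w) \<le> C * s powr (1 / 4)"
proof -
  obtain u x where "w = u @ [x]" using assms(2) by (cases w rule: rev_cases) (auto simp: admissible_def)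
  then obtain k m where w: "w = u @ [(k, m)]" by (cases x) auto
  have u: "positive u" "m > 0" "positive (u @ [(k, m)])" "admissible (u @ [(k, m)])"
    using assms(2) w by (auto simp: admissible_def)
  let ?a = "\<lambda>n. \<mu> * letter_val \<mu> n (k, m) * trunc_zeta \<mu> n u"
  let ?e = "\<lambda>n s. exp (- ((of_nat n * \<mu> + of_rat m) * of_real s))"
  obtain B where B: "\<And>n. norm (\<mu> * letter_val \<mu> n (k, m)) \<le> B * real (Suc n) powr -2"
    using admissible_sums(2)[OF assms(1) u(4)] by blast
  obtain C where C: "C \<ge> 0" "\<And>n s. s \<ge> 0 \<Longrightarrow> norm (?e n s - 1) \<le> C * real (Suc n) powr (1 / 4) * s powr (1 / 4)"
    using exp_factor_error[OF assms(1) u(2)] by blast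
  have "norm (?a n) \<le> B * norm (trunc_zeta \<mu> n u) * real (Suc n) powr -2" for n
    using mult_right_mono[OF B[of n], of "norm (trunc_zeta \<mu> n u)"]
    by (simp add: norm_mult mult_ac del: of_nat_Suc)
  then have h: "summable (\<lambda>n. real (Suc n) powr (1 / 4) * norm (?a n))"
    by (rule summable_subpoly[OF subpoly_trunc_zeta[OF assms(1) u(1)]]) simp
  have "norm (lval \<mu> s (yx w) - zeta_mu \<mu> w) \<le>
      (C * suminf (\<lambda>n. real (Suc n) powr (1 / 4) * norm (?a n))) * s powr (1 / 4)" if s: "0 < s" for s
  proof -
    have "norm (lval \<mu> s (yx w) - zeta_mu \<mu> w) \<le>
        suminf (\<lambda>n. (C * s powr (1 / 4)) * (real (Suc n) powr (1 / 4) * norm (?a n)))"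
      unfolding w
    proof (rule suminf_diff_bound[OF lval_yx_sums[OF assms(1) s u(3)] admissible_sums(1)[OF assms(1) u(4)]])
      fix n
      have "norm (?a n * ?e n s - ?a n) = norm (?a n) * norm (?e n s - 1)"
        by (simp add: algebra_simps flip: norm_mult)
      also have "\<dots> \<le> norm (?a n) * (C * real (Suc n) powr (1 / 4) * s powr (1 / 4))"
        using C(2)[of s n] s by (intro mult_left_mono) auto
      finally show "norm (?a n * ?e n s - ?a n) \<le>
          (C * s powr (1 / 4)) * (real (Suc n) powr (1 / 4) * norm (?a n))"
        by (simp only: mult_ac)
    qed (rule summable_mult[OF h])
    also have "\<dots> = (C * s powr (1 / 4)) * suminf (\<lambda>n. real (Suc n) powr (1 / 4) * norm (?a n))"
      by (rule suminf_mult[OF h])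
    finally show ?thesis by (simp only: mult_ac)
  qed
  then show ?thesis by blast
qed

text \<open>The two series are damped by different factors e and e'. Writing a e - a' e' - (a - a')
  = (e - 1)(a - a') + a'(e - e'), the first part behaves as for admissible words. In the second, e -
  e' is of order s |e'|, and |e'| is at most a constant times (n s)^(-1/2); with a' of order 1/n
  this gives terms of order n^(-3/2) s^(1/2).\<close>

lemma lval_special_error:
  assumes "Re \<mu> > 0" "special u m m'"
  shows "\<exists>C. \<forall>s. 0 < s \<longrightarrow> s \<le> 1 \<longrightarrow>
    norm (lval \<mu> s (yx (u @ [(1, m)])) - lval \<mu> s (yx (u @ [(1, m')])) - D_mu \<mu> u m m') \<le> C * s powr (1 / 4)"
proof -
  have u: "positive u" "m > 0" "m' > 0" "positive (u @ [(1, m)])" "positive (u @ [(1, m')])"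
    using assms(2) by (auto simp: special_def)
  define a where "a = (\<lambda>n. \<mu> * letter_val \<mu> n (1, m))"
  define a' where "a' = (\<lambda>n. \<mu> * letter_val \<mu> n (1, m'))"
  define S where "S = (\<lambda>n. trunc_zeta \<mu> n u)"
  let ?e = "\<lambda>n s. exp (- ((of_nat n * \<mu> + of_rat m) * complex_of_real s))"
  let ?e' = "\<lambda>n s. exp (- ((of_nat n * \<mu> + of_rat m') * complex_of_real s))"
  obtain B where B: "\<And>n. norm (a n - a' n) \<le> B * real (Suc n) powr -2"
    using special_letter_bound(1)[OF assms(1) u(2,3)] unfolding a_def a'_def by blast
  obtain C where C: "C \<ge> 0" "\<And>n s. s \<ge> 0 \<Longrightarrow> norm (?e n s - 1) \<le> C * real (Suc n) powr (1 / 4) * s powr (1 / 4)"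
    using exp_factor_error[OF assms(1) u(2)] by blast
  obtain K where K: "K > 0" "\<And>n. norm (a' n) \<le> K * real (Suc n) powr -1"
    using letter_val_bound[OF assms(1), of "(1, m')"] u(3) unfolding a'_def by auto
  define d :: real where "d = of_rat m - of_rat m'"
  define \<rho> where "\<rho> = Re \<mu>"
  have \<rho>: "\<rho> > 0" using assms(1) by (simp add: \<rho>_def)
  \<comment> \<open>The factor exp rho pays for replacing n by n + 1 in the damping when s <= 1, the
    two factors with d come from the mean value bound, and the power of rho from exp(-x) <=
    x^(-1/2).\<close>
  define L where "L = exp \<rho> * exp \<bar>d\<bar> * \<bar>d\<bar> * \<rho> powr - (1 / 2)"
  have L: "L \<ge> 0" by (simp add: L_def)
  have e_diff: "norm (?e n s - ?e' n s) \<le> L * real (Suc n) powr - (1 / 2) * s powr (1 / 4)"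
    if s: "0 < s" "s \<le> 1" for n s
  proof -
    have "?e n s - ?e' n s = ?e' n s * (exp (- of_real (d * s)) - 1)"
    proof -
      have "of_rat q = complex_of_real (of_rat q)" for q by (cases q) (simp add: of_rat_rat)
      then have "of_rat m = of_rat m' + complex_of_real d"
        unfolding d_def by (metis add_diff_cancel_left' diff_add_cancel of_real_diff add.commute)
      then show ?thesis by (simp add: algebra_simps mult_exp_exp)
    qed
    then have "norm (?e n s - ?e' n s) = norm (?e' n s) * norm (exp (- of_real (d * s)) - 1 :: complex)"
      by (simp only: norm_mult)
    also have "\<dots> \<le> (exp \<rho> * (\<rho> * real (Suc n) * s) powr - (1 / 2)) * (exp \<bar>d\<bar> * (\<bar>d\<bar> * s))"
    proof (rule mult_mono)
      have "norm (?e' n s) = exp (- ((real n * \<rho> + of_rat m') * s))"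
        by (simp add: \<rho>_def Re_of_rat)
      also have "\<dots> \<le> exp (\<rho> + - (\<rho> * real (Suc n) * s))"
      proof -
        have "\<rho> * s \<le> \<rho>" using s \<rho> by simp
        moreover have "0 \<le> of_rat m' * s" using u(3) s by simp
        ultimately show ?thesis by (simp add: algebra_simps)
      qed
      also have "\<dots> = exp \<rho> * exp (- (\<rho> * real (Suc n) * s))" by (simp only: exp_add)
      also have "\<dots> \<le> exp \<rho> * (\<rho> * real (Suc n) * s) powr - (1 / 2)"
        using \<rho> s by (intro mult_left_mono exp_neg_le_powr) auto
      finally show "norm (?e' n s) \<le> exp \<rho> * (\<rho> * real (Suc n) * s) powr - (1 / 2)" .
      have "norm (exp (- of_real (d * s)) - 1 :: complex) \<le> exp \<bar>d\<bar> * norm (- of_real (d * s) :: complex)"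
      proof (rule norm_exp_minus_1_le)
        have "\<bar>d * s\<bar> \<le> \<bar>d\<bar> * 1" unfolding abs_mult using s by (intro mult_left_mono) auto
        then show "Re (- of_real (d * s)) \<le> \<bar>d\<bar>" by auto
      qed simp
      then show "norm (exp (- of_real (d * s)) - 1 :: complex) \<le> exp \<bar>d\<bar> * (\<bar>d\<bar> * s)"
        using s by (simp add: abs_mult norm_mult)
    qed auto
    also have "\<dots> = L * real (Suc n) powr - (1 / 2) * (s powr - (1 / 2) * s powr 1)"
      using s \<rho> by (simp add: L_def powr_mult del: of_nat_Suc)
    also have "s powr - (1 / 2) * s powr 1 = s powr (1 / 2)"
      unfolding powr_add[symmetric] by simp
    also have "L * real (Suc n) powr - (1 / 2) * s powr (1 / 2) \<le> L * real (Suc n) powr - (1 / 2) * s powr (1 / 4)"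
      using s L by (intro mult_left_mono powr_mono') auto
    finally show ?thesis .
  qed
  \<comment> \<open>The exponent 1/4 in the first part is weakened to 1/2, so that both parts share
    a majorant of order |S n| n^(-3/2).\<close>
  define h where "h = (\<lambda>n. (\<bar>B\<bar> * C + K * L) * (real (Suc n) powr (1 / 2) * (norm (S n) * real (Suc n) powr -2)))"
  have h: "summable h"
  proof -
    have "summable (\<lambda>n. real (Suc n) powr (1 / 2) * norm (complex_of_real (norm (S n) * real (Suc n) powr -2)))"
      by (rule summable_subpoly[OF subpoly_trunc_zeta[OF assms(1) u(1)], of _ 1])
        (simp_all add: S_def norm_mult del: of_nat_Suc)
    then show ?thesis unfolding h_def by (intro summable_mult) (simp add: norm_mult del: of_nat_Suc)
  qed
  have "norm (lval \<mu> s (yx (u @ [(1, m)])) - lval \<mu> s (yx (u @ [(1, m')])) - D_mu \<mu> u m m')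
      \<le> suminf h * s powr (1 / 4)" if s: "0 < s" "s \<le> 1" for s
  proof -
    have "norm (lval \<mu> s (yx (u @ [(1, m)])) - lval \<mu> s (yx (u @ [(1, m')])) - D_mu \<mu> u m m')
      \<le> suminf (\<lambda>n. h n * s powr (1 / 4))"
    proof (rule suminf_diff_bound[OF sums_diff[OF lval_yx_sums[OF assms(1) s(1) u(4)]
          lval_yx_sums[OF assms(1) s(1) u(5)]] special_sums[OF assms]])
      fix n
      have "norm ((a n * S n * ?e n s - a' n * S n * ?e' n s) - (a n - a' n) * S n) =
          norm (S n * ((?e n s - 1) * (a n - a' n)) + S n * (a' n * (?e n s - ?e' n s)))"
        by (rule arg_cong[of _ _ norm]) (simp add: algebra_simps)
      also have "\<dots> \<le> norm (S n) * (norm (?e n s - 1) * norm (a n - a' n)) +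
          norm (S n) * (norm (a' n) * norm (?e n s - ?e' n s))"
        by (rule order_trans[OF norm_triangle_ineq]) (simp add: norm_mult)
      also have "\<dots> \<le> norm (S n) * ((C * real (Suc n) powr (1 / 2) * s powr (1 / 4)) * (\<bar>B\<bar> * real (Suc n) powr -2)) +
          norm (S n) * ((K * real (Suc n) powr -1) * (L * real (Suc n) powr - (1 / 2) * s powr (1 / 4)))"
      proof (intro add_mono mult_left_mono mult_mono)
        show "norm (a n - a' n) \<le> \<bar>B\<bar> * real (Suc n) powr -2"
          using B[of n] by (rule order_trans) (intro mult_right_mono; simp)
        show "norm (?e n s - 1) \<le> C * real (Suc n) powr (1 / 2) * s powr (1 / 4)"
          using C(2)[of s n] s(1) C(1)
          by (intro order_trans[OF C(2)] mult_right_mono mult_left_mono powr_mono) auto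
      qed (use K C(1) L e_diff[OF s] in auto)
      also have "(K * real (Suc n) powr -1) * (L * real (Suc n) powr - (1 / 2) * s powr (1 / 4)) =
          K * L * (real (Suc n) powr -1 * real (Suc n) powr - (1 / 2)) * s powr (1 / 4)"
        by (simp only: mult_ac)
      also have "real (Suc n) powr -1 * real (Suc n) powr - (1 / 2) = real (Suc n) powr (1 / 2) * real (Suc n) powr -2"
        unfolding powr_add[symmetric] by simp
      also have "norm (S n) * ((C * real (Suc n) powr (1 / 2) * s powr (1 / 4)) * (\<bar>B\<bar> * real (Suc n) powr -2)) +
          norm (S n) * (K * L * (real (Suc n) powr (1 / 2) * real (Suc n) powr -2) * s powr (1 / 4)) =
          h n * s powr (1 / 4)"
        unfolding h_def by (simp add: algebra_simps del: of_nat_Suc)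
      finally show "norm ((\<mu> * letter_val \<mu> n (1, m) * trunc_zeta \<mu> n u * ?e n s -
          \<mu> * letter_val \<mu> n (1, m') * trunc_zeta \<mu> n u * ?e' n s) -
          (\<mu> * letter_val \<mu> n (1, m) - \<mu> * letter_val \<mu> n (1, m')) * trunc_zeta \<mu> n u) \<le> h n * s powr (1 / 4)"
        by (simp only: a_def a'_def S_def)
    qed (rule summable_mult2[OF h])
    also have "\<dots> = suminf h * s powr (1 / 4)" by (rule suminf_mult2[OF h, symmetric])
    finally show ?thesis .
  qed
  then show ?thesis by blast
qed

text \<open>The damping is at most a constant times (n s)^(-delta). Its factor n^(-delta) makes the
  almost harmonic series converge, and s^(-delta) is what remains.\<close>

lemma lval_letter_bound:
  assumes "Re \<mu> > 0" "m > 0" "0 < \<delta>" "\<delta> \<le> 1"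
  shows "\<exists>K. \<forall>s. 0 < s \<longrightarrow> s \<le> 1 \<longrightarrow> norm (lval \<mu> s [Ly m]) \<le> K * s powr - \<delta>"
proof -
  obtain K where K: "K > 0" "\<And>n. norm (\<mu> * letter_val \<mu> n (1, m)) \<le> K * real (Suc n) powr -1"
    using letter_val_bound[OF assms(1), of "(1, m)"] assms(2) by auto
  obtain c where c: "c > 0" "\<And>n. c * real (Suc n) \<le> Re (of_nat n * \<mu> + of_rat m)"
    using denom_factor_lower_bound[OF assms(1,2)] by metis
  let ?h = "\<lambda>n. real (Suc n) powr (-1 - \<delta>)"
  have h: "summable ?h" using assms(3) by (intro summable_Suc_powr) simp
  have "norm (lval \<mu> s [Ly m]) \<le> (K * c powr - \<delta> * suminf ?h) * s powr - \<delta>" if s: "0 < s" for s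
  proof -
    let ?e = "\<lambda>n. exp (- ((of_nat n * \<mu> + of_rat m) * complex_of_real s))"
    have sums: "(\<lambda>n. \<mu> * letter_val \<mu> n (1, m) * ?e n) sums lval \<mu> s [Ly m]"
      using lval_yx_sums[OF assms(1) s, of "[]" 1 m] assms(2) by simp
    have "norm (\<mu> * letter_val \<mu> n (1, m) * ?e n) \<le> (K * c powr - \<delta> * s powr - \<delta>) * ?h n" for n
    proof -
      have "norm (?e n) = exp (- (Re (of_nat n * \<mu> + of_rat m) * s))" by simp
      also have "\<dots> \<le> exp (- (c * real (Suc n) * s))"
        using mult_right_mono[OF c(2)[of n], of s] s by (simp del: of_nat_Suc)
      also have "\<dots> \<le> (c * real (Suc n) * s) powr - \<delta>"
        using c(1) s assms(3,4) by (intro exp_neg_le_powr) auto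
      also have "\<dots> = c powr - \<delta> * real (Suc n) powr - \<delta> * s powr - \<delta>"
        using c(1) s by (simp add: powr_mult del: of_nat_Suc)
      finally have "norm (\<mu> * letter_val \<mu> n (1, m) * ?e n) \<le>
          (K * real (Suc n) powr -1) * (c powr - \<delta> * real (Suc n) powr - \<delta> * s powr - \<delta>)"
        unfolding norm_mult[of _ "?e n"] using K by (intro mult_mono) auto
      also have "\<dots> = (K * c powr - \<delta> * s powr - \<delta>) * (real (Suc n) powr -1 * real (Suc n) powr - \<delta>)"
        by (simp only: mult_ac)
      also have "real (Suc n) powr -1 * real (Suc n) powr - \<delta> = ?h n"
        unfolding powr_add[symmetric] by simp
      finally show ?thesis .
    qed
    from norm_suminf_le[OF this summable_mult[OF h]]
    have "norm (lval \<mu> s [Ly m]) \<le> suminf (\<lambda>n. (K * c powr - \<delta> * s powr - \<delta>) * ?h n)"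
      using sums by (simp only: sums_iff)
    also have "\<dots> = (K * c powr - \<delta> * s powr - \<delta>) * suminf ?h" by (rule suminf_mult[OF h])
    finally show ?thesis by (simp only: mult_ac)
  qed
  then show ?thesis by blast
qed

lemma log_at_top_at_right_0:
  fixes c k D :: real
  assumes "c > 0" "k > 0"
  shows "filterlim (\<lambda>s. k * (- ln (c * s) - D)) at_top (at_right 0)"
  using assms by real_asymp

text \<open>Replacing the letter by 1/(n+1) costs at most \<open>D\<close> and turns the series into
  -ln(1 - q)/q. Since |1 - q| <= |mu| s, this is at least -ln(|mu| s) in absolute value. For s <= 1
  the prefactor is at least exp(-m).\<close>

lemma lval_letter_infinity:
  assumes "Re \<mu> > 0" "m > 0"
  shows "filterlim (\<lambda>s. lval \<mu> s [Ly m]) at_infinity (at_right 0)"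
proof -
  let ?d = "\<lambda>n. \<mu> * letter_val \<mu> n (1, m) - 1 / of_nat (Suc n)"
  define D where "D = suminf (\<lambda>n. norm (?d n))"
  have d: "summable (\<lambda>n. norm (?d n))" by (rule summable_letter_val_minus_harmonic[OF assms])
  have mu: "norm \<mu> > 0" using assms(1) by auto
  have bound: "exp (- of_rat m) * (- ln (norm \<mu> * s) - D) \<le> norm (lval \<mu> s [Ly m])"
    if s: "0 < s" "s \<le> 1" for s
  proof -
    define q where "q = exp (- (\<mu> * of_real s))"
    have q: "norm q < 1" unfolding q_def by (rule norm_exp_mu_less_1[OF assms(1) s(1)])
    have q0: "q \<noteq> 0" by (simp add: q_def)
    have "(\<lambda>n. - (q ^ n) / of_nat n) sums ln (1 - q)"
      using Ln_series'[of "- q"] q by simp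
    \<comment> \<open>The shift drops the term n = 0, which is 0 by the convention for division by
      zero.\<close>
    then have "(\<lambda>n. - (q ^ Suc n) / of_nat (Suc n)) sums ln (1 - q)"
      by (subst sums_Suc_iff) simp
    from sums_mult[OF this, of "- 1 / q"]
    have B: "(\<lambda>n. q ^ n / of_nat (Suc n)) sums (- ln (1 - q) / q)"
      using q0 by (simp add: field_simps del: of_nat_Suc)
    have dq: "norm (?d n * q ^ n) \<le> norm (?d n)" for n
      using q by (simp add: norm_mult norm_power power_le_one mult_left_le)
    have "summable (\<lambda>n. ?d n * q ^ n)"
      by (rule summable_comparison_test'[OF d dq])
    from sums_add[OF summable_sums[OF this] B]
    have "(\<lambda>n. \<mu> * letter_val \<mu> n (1, m) * q ^ n) sums (suminf (\<lambda>n. ?d n * q ^ n) + (- ln (1 - q) / q))"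
      by (simp add: algebra_simps)
    from sums_mult[OF this, of "exp (- (of_rat m * of_real s))"]
    have "(\<lambda>n. exp (- (of_rat m * of_real s)) * (\<mu> * letter_val \<mu> n (1, m) * q ^ n)) sums
        (exp (- (of_rat m * of_real s)) * (suminf (\<lambda>n. ?d n * q ^ n) + (- ln (1 - q) / q)))" .
    moreover have "exp (- (of_rat m * of_real s)) * (\<mu> * letter_val \<mu> n (1, m) * q ^ n) =
        \<mu> * letter_val \<mu> n (1, m) * exp (- ((of_nat n * \<mu> + of_rat m) * of_real s))" for n
    proof -
      have "exp (- (of_rat m * of_real s)) * q ^ n = exp (- ((of_nat n * \<mu> + of_rat m) * of_real s))"
        by (simp add: q_def exp_of_nat_mult[symmetric] mult_exp_exp algebra_simps)
      then show ?thesis by (metis mult.left_commute)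
    qed
    moreover have "(\<lambda>n. \<mu> * letter_val \<mu> n (1, m) * exp (- ((of_nat n * \<mu> + of_rat m) * of_real s)))
        sums lval \<mu> s [Ly m]"
      using lval_yx_sums[OF assms(1) s(1), of "[]" 1 m] assms(2) by simp
    ultimately have eq: "lval \<mu> s [Ly m] =
        exp (- (of_rat m * of_real s)) * (suminf (\<lambda>n. ?d n * q ^ n) + (- ln (1 - q) / q))"
      by (simp only: sums_unique2)
    have 1: "norm (suminf (\<lambda>n. ?d n * q ^ n)) \<le> D"
      unfolding D_def by (rule norm_suminf_le[OF dq d])
    have q1: "1 - q \<noteq> 0" using q by auto
    have "norm (1 - q) \<le> norm \<mu> * s"
      using norm_exp_minus_1_le[of "- (\<mu> * of_real s)" 0] assms(1) s
      by (simp add: q_def norm_mult norm_minus_commute)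
    then have "- ln (norm \<mu> * s) \<le> - ln (norm (1 - q))"
      using q1 by (simp add: ln_mono)
    also have "\<dots> = - Re (ln (1 - q))" using q1 by simp
    also have "\<dots> \<le> norm (ln (1 - q))" using abs_Re_le_cmod[of "ln (1 - q)"] by linarith
    also have "\<dots> \<le> norm (ln (1 - q)) / norm q"
      using q q0 by (simp add: divide_simps mult_left_le)
    finally have 2: "- ln (norm \<mu> * s) \<le> norm (- ln (1 - q) / q)" by (simp add: norm_divide)
    have "- ln (norm \<mu> * s) - D \<le> norm (suminf (\<lambda>n. ?d n * q ^ n) + (- ln (1 - q) / q))"
      using 1 2 norm_diff_ineq[of "- ln (1 - q) / q" "suminf (\<lambda>n. ?d n * q ^ n)"]
      by (simp add: add.commute)
    then have "exp (- of_rat m) * (- ln (norm \<mu> * s) - D) \<le>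
        exp (- of_rat m) * norm (suminf (\<lambda>n. ?d n * q ^ n) + (- ln (1 - q) / q))"
      by (intro mult_left_mono) auto
    also have "\<dots> \<le> norm (exp (- (of_rat m * of_real s)) :: complex) *
        norm (suminf (\<lambda>n. ?d n * q ^ n) + (- ln (1 - q) / q))"
    proof (rule mult_right_mono)
      have "of_rat m * s \<le> of_rat m * 1" using s assms(2) by (intro mult_left_mono) auto
      then show "exp (- of_rat m) \<le> norm (exp (- (of_rat m * of_real s)) :: complex)"
        by (simp add: Re_of_rat)
    qed simp
    also have "\<dots> = norm (lval \<mu> s [Ly m])" by (simp only: eq norm_mult)
    finally show ?thesis .
  qed
  show ?thesis
  proof (rule filterlim_norm_at_top_imp_at_infinity, rule filterlim_at_top_mono)
    show "filterlim (\<lambda>s. exp (- of_rat m) * (- ln (norm \<mu> * s) - D)) at_top (at_right 0)"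
      using mu by (intro log_at_top_at_right_0) auto
    show "\<forall>\<^sub>F s in at_right 0. exp (- of_rat m) * (- ln (norm \<mu> * s) - D) \<le> norm (lval \<mu> s [Ly m])"
      unfolding eventually_at_right_field using bound by (intro exI[of _ 1]) auto
  qed
qed

lemma lval_Nil: "Re \<mu> > 0 \<Longrightarrow> s > 0 \<Longrightarrow> lval \<mu> s [] = 1"
proof -
  have "(\<lambda>n. fps_nth (1 :: complex fps) n * q ^ n) sums 1" for q
    using powser_sums_if[of 0 q] by (simp add: if_distrib)
  then show ?thesis by (simp add: lval_def sums_iff)
qed

section \<open>Convergent words on the shuffle side\<close>

lemma QX0_error:
  assumes "Re \<mu> > 0" "w \<in> QX0 \<mu>" "m > 0"
  shows "\<exists>c\<in>Z_mu \<mu>. \<forall>j. ((\<lambda>s. (lin_val (lval \<mu> s) w - c) * lval \<mu> s [Ly m] ^ j) \<longlongrightarrow> 0) (at_right 0)"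
proof -
  let ?G = "{w. \<exists>c\<in>Z_mu \<mu>. \<forall>j. ((\<lambda>s. (lin_val (lval \<mu> s) w - c) * lval \<mu> s [Ly m] ^ j) \<longlongrightarrow> 0) (at_right 0)}"
  have G: "w \<in> ?G" if c: "c \<in> Z_mu \<mu>"
    and C: "\<exists>C. \<forall>s. 0 < s \<longrightarrow> s \<le> 1 \<longrightarrow> norm (lin_val (lval \<mu> s) w - c) \<le> C * s powr (1 / 4)" for w c
  proof -
    obtain C where "\<And>s. 0 < s \<Longrightarrow> s \<le> 1 \<Longrightarrow> norm (lin_val (lval \<mu> s) w - c) \<le> C * s powr (1 / 4)"
      using C by blast
    from error_tendsto_0[OF this lval_letter_bound[OF assms(1,3)]] c show ?thesis by blast
  qed
  have "QX0 \<mu> \<subseteq> ?G"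
    unfolding QX0_def
  proof (rule span_over_subset[OF submod_limits[OF submod_Z_mu]], intro Un_least subsetI)
    fix w :: "xletter list \<Rightarrow>\<^sub>0 complex" assume "w \<in> {basis_elt []}"
    then show "w \<in> ?G"
      using lval_Nil[OF assms(1)] by (intro G[of 1] Z_mu_base exI[of _ 0]) auto
  next
    fix w :: "xletter list \<Rightarrow>\<^sub>0 complex" assume "w \<in> {basis_elt (yx w) | w. admissible w}"
    then obtain v where "w = basis_elt (yx v)" "admissible v" by blast
    then show "w \<in> ?G"
      using lval_admissible_error[OF assms(1), of v] by (intro G[of "zeta_mu \<mu> v"] Z_mu_base) auto
  next
    fix w :: "xletter list \<Rightarrow>\<^sub>0 complex"
    assume "w \<in> {basis_elt (yx (u @ [(1, m)])) - basis_elt (yx (u @ [(1, m')])) | u m m'. special u m m'}"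
    then obtain u a b where "w = basis_elt (yx (u @ [(1, a)])) - basis_elt (yx (u @ [(1, b)]))" "special u a b"
      by blast
    then show "w \<in> ?G"
      using lval_special_error[OF assms(1), of u a b] by (intro G[of "D_mu \<mu> u a b"] Z_mu_base) auto
  qed
  then show ?thesis using assms(2) by blast
qed

lemma QX0_limit:
  assumes "Re \<mu> > 0"
  shows "w \<in> QX0 \<mu> \<Longrightarrow> \<exists>c. ((\<lambda>s. lin_val (lval \<mu> s) w) \<longlongrightarrow> c) (at_right 0)"
    and "admissible v \<Longrightarrow> ((\<lambda>s. lval \<mu> s (yx v)) \<longlongrightarrow> zeta_mu \<mu> v) (at_right 0)"
    and "special u a b \<Longrightarrow> ((\<lambda>s. lval \<mu> s (yx (u @ [(1, a)])) - lval \<mu> s (yx (u @ [(1, b)])))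
      \<longlongrightarrow> D_mu \<mu> u a b) (at_right 0)"
proof -
  show "\<exists>c. ((\<lambda>s. lin_val (lval \<mu> s) w) \<longlongrightarrow> c) (at_right 0)" if w: "w \<in> QX0 \<mu>"
  proof -
    \<comment> \<open>Any positive entry can serve for the divergent letter; 1 is taken, and the
      exponent j = 0 removes it again.\<close>
    obtain c where "\<And>j. ((\<lambda>s. (lin_val (lval \<mu> s) w - c) * lval \<mu> s [Ly 1] ^ j) \<longlongrightarrow> 0) (at_right 0)"
      using QX0_error[OF assms w, of 1] by auto
    from this[of 0] have "((\<lambda>s. lin_val (lval \<mu> s) w - c) \<longlongrightarrow> 0) (at_right 0)" by simp
    from LIM_zero_cancel[OF this] show ?thesis by (rule exI)
  qed
  have lim: "(f \<longlongrightarrow> c) (at_right 0)"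
    if C: "\<exists>C. \<forall>s. 0 < s \<longrightarrow> s \<le> 1 \<longrightarrow> norm (f s - c) \<le> C * s powr (1 / 4)" for f :: "real \<Rightarrow> complex" and c
  proof -
    obtain C where "\<And>s. 0 < s \<Longrightarrow> s \<le> 1 \<Longrightarrow> norm (f s - c) \<le> C * s powr (1 / 4)" using C by blast
    from error_tendsto_0[OF this lval_letter_bound[OF assms, of 1], of 0]
    have "((\<lambda>s. f s - c) \<longlongrightarrow> 0) (at_right 0)" by simp
    then show ?thesis by (rule LIM_zero_cancel)
  qed
  show "admissible v \<Longrightarrow> ((\<lambda>s. lval \<mu> s (yx v)) \<longlongrightarrow> zeta_mu \<mu> v) (at_right 0)"
    by (rule lim[OF lval_admissible_error[OF assms]])
  show "special u a b \<Longrightarrow> ((\<lambda>s. lval \<mu> s (yx (u @ [(1, a)])) - lval \<mu> s (yx (u @ [(1, b)])))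
      \<longlongrightarrow> D_mu \<mu> u a b) (at_right 0)"
    by (rule lim[OF lval_special_error[OF assms]])
qed

lemma QX0_base:
  "basis_elt [] \<in> QX0 \<mu>" "admissible w \<Longrightarrow> basis_elt (yx w) \<in> QX0 \<mu>"
  "special u m m' \<Longrightarrow> basis_elt (yx (u @ [(1, m)])) - basis_elt (yx (u @ [(1, m')])) \<in> QX0 \<mu>"
  unfolding QX0_def
  by (rule span_over_base[OF scale.module_axioms scalar_ringD(5)[OF scalar_ring_Q_adjoin]], blast)+

text \<open>The limit of the iterated integrals is linear on \<open>QX0\<close> and has the
  prescribed values on the spanning elements. A linear map is determined by those values, so the
  definite description denotes this limit.\<close>

lemma zeta_sh_eqI:
  assumes "Re \<mu> > 0" "w \<in> QX0 \<mu>" "((\<lambda>s. lin_val (lval \<mu> s) w) \<longlongrightarrow> c) (at_right 0)"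
  shows "zeta_sh \<mu> w = c"
proof -
  define F where "F = (\<lambda>w\<in>QX0 \<mu>. Lim (at_right 0) (\<lambda>s. lin_val (lval \<mu> s) w))"
  have F: "F w = c" if "w \<in> QX0 \<mu>" "((\<lambda>s. lin_val (lval \<mu> s) w) \<longlongrightarrow> c) (at_right 0)" for w c
    using that tendsto_Lim[OF _ that(2)] by (simp add: F_def)
  have F_lim: "((\<lambda>s. lin_val (lval \<mu> s) w) \<longlongrightarrow> F w) (at_right 0)" if "w \<in> QX0 \<mu>" for w
    using QX0_limit(1)[OF assms(1) that] F[OF that] by blast
  note R = scalar_ring_Q_adjoin[of \<mu>]
  have sub: "submod (Q_adjoin \<mu>) scale (QX0 \<mu>)"
    unfolding QX0_def by (rule submod_span_over[OF scale.module_axioms R])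
  let ?P = "\<lambda>F. F \<in> extensional (QX0 \<mu>) \<and>
     linear_over (Q_adjoin \<mu>) scale (*) (QX0 \<mu>) F \<and>
     F (basis_elt []) = 1 \<and>
     (\<forall>w. admissible w \<longrightarrow> F (basis_elt (yx w)) = zeta_mu \<mu> w) \<and>
     (\<forall>u m m'. special u m m' \<longrightarrow>
        F (basis_elt (yx (u @ [(1, m)])) - basis_elt (yx (u @ [(1, m')]))) = D_mu \<mu> u m m')"
  have lin: "linear_over (Q_adjoin \<mu>) scale (*) (QX0 \<mu>) F"
    unfolding linear_over_def
  proof (intro conjI ballI)
    show "F (u + v) = F u + F v" if "u \<in> QX0 \<mu>" "v \<in> QX0 \<mu>" for u v
      using submodD(2)[OF sub that] tendsto_add[OF F_lim F_lim, OF that] by (intro F) simp_all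
    show "F (scale a v) = a * F v" if "a \<in> Q_adjoin \<mu>" "v \<in> QX0 \<mu>" for a v
      using submodD(3)[OF sub that] tendsto_mult_left[OF F_lim[OF that(2)]] by (intro F) simp_all
  qed
  have one: "F (basis_elt []) = 1"
  proof (rule F[OF QX0_base(1)])
    have "\<forall>\<^sub>F s in at_right 0. lin_val (lval \<mu> s) (basis_elt []) = 1"
      unfolding eventually_at_right_field using lval_Nil[OF assms(1)] by (intro exI[of _ 1]) auto
    then show "((\<lambda>s. lin_val (lval \<mu> s) (basis_elt [])) \<longlongrightarrow> 1) (at_right 0)"
      by (rule tendsto_eventually)
  qed
  have adm: "F (basis_elt (yx w)) = zeta_mu \<mu> w" if "admissible w" for w
    using QX0_limit(2)[OF assms(1) that] QX0_base(2)[OF that] by (intro F) simp_all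
  have sp: "F (basis_elt (yx (u @ [(1, m)])) - basis_elt (yx (u @ [(1, m')]))) = D_mu \<mu> u m m'"
    if "special u m m'" for u m m'
    using QX0_limit(3)[OF assms(1) that] QX0_base(3)[OF that] by (intro F) simp_all
  have "zeta_sh \<mu> = F"
    unfolding zeta_sh_def
  proof (rule the_equality)
    have "F \<in> extensional (QX0 \<mu>)" by (simp add: F_def)
    then show "?P F" using lin one adm sp by blast
  next
    fix F' assume P: "?P F'"
    have "QX0 \<mu> \<subseteq> {w \<in> QX0 \<mu>. F' w = F w}"
    proof (subst (1) QX0_def, rule span_over_subset)
      show "submod (Q_adjoin \<mu>) scale {w \<in> QX0 \<mu>. F' w = F w}"
        using P lin by (intro linear_over_cong_span[OF _ sub]) (auto simp: module_def algebra_simps)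
      show "{basis_elt []} \<union> {basis_elt (yx w) | w. admissible w} \<union>
          {basis_elt (yx (u @ [(1, m)])) - basis_elt (yx (u @ [(1, m')])) | u m m'. special u m m'}
          \<subseteq> {w \<in> QX0 \<mu>. F' w = F w}"
      proof (intro Un_least subsetI)
        fix x :: "xletter list \<Rightarrow>\<^sub>0 complex" assume "x \<in> {basis_elt []}"
        then show "x \<in> {w \<in> QX0 \<mu>. F' w = F w}" using P one QX0_base(1) by simp
      next
        fix x :: "xletter list \<Rightarrow>\<^sub>0 complex" assume "x \<in> {basis_elt (yx w) | w. admissible w}"
        then obtain v where "x = basis_elt (yx v)" "admissible v" by blast
        then show "x \<in> {w \<in> QX0 \<mu>. F' w = F w}" using P adm QX0_base(2) by simp
      next
        fix x :: "xletter list \<Rightarrow>\<^sub>0 complex"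
        assume "x \<in> {basis_elt (yx (u @ [(1, m)])) - basis_elt (yx (u @ [(1, m')])) | u m m'. special u m m'}"
        then obtain u a b where x: "x = basis_elt (yx (u @ [(1, a)])) - basis_elt (yx (u @ [(1, b)]))" "special u a b"
          by blast
        have "F' x = D_mu \<mu> u a b" using P x by blast
        then show "x \<in> {w \<in> QX0 \<mu>. F' w = F w}"
          using sp[OF x(2)] QX0_base(3)[OF x(2)] by (simp only: x(1) mem_Collect_eq)
      qed
    qed
    then have on: "F' w = F w" if "w \<in> QX0 \<mu>" for w using that by blast
    have "F' \<in> extensional (QX0 \<mu>)" using P by blast
    moreover have "F \<in> extensional (QX0 \<mu>)" by (simp add: F_def)
    ultimately show "F' = F" using on by (rule extensionalityI)
  qed
  then show ?thesis using F[OF assms(2,3)] by simp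
qed

lemma QX0_subset_QX1: "QX0 \<mu> \<subseteq> QX1 \<mu>"
  unfolding QX0_def QX1_eq_words_over
proof (rule span_over_subset[OF submod_words_over[OF scalar_ring_Q_adjoin]])
  note R = scalar_ring_Q_adjoin[of \<mu>]
  note base = basis_elt_words_over[OF R] and sub = submod_words_over[OF R]
  show "{basis_elt []} \<union> {basis_elt (yx w) | w. admissible w} \<union>
      {basis_elt (yx (u @ [(1, m)])) - basis_elt (yx (u @ [(1, m')])) | u m m'. special u m m'}
    \<subseteq> words_over (Q_adjoin \<mu>) {W. valid W}"
    by (auto simp: admissible_def special_def intro!: base submod_diff[OF sub R] valid_yx)
qed

lemma shuffle_regularisation:
  assumes "Re \<mu> > 0" "m > 0"
  shows "regularisation (Q_adjoin \<mu>) {W. valid W} (QX0 \<mu>) shuffle (lval \<mu>) (at_right 0)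
    (zeta_sh \<mu>) (Z_mu \<mu>) [Ly m]"
proof
  note R = scalar_ring_Q_adjoin[of \<mu>]
  show "scalar_ring (Q_adjoin \<mu>)" "submod (Q_adjoin \<mu>) (*) (Z_mu \<mu>)"
    by (rule R submod_Z_mu)+
  show "filterlim (\<lambda>s. lval \<mu> s [Ly m]) at_infinity (at_right 0)"
    by (rule lval_letter_infinity[OF assms])
  show "QX0 \<mu> \<subseteq> words_over (Q_adjoin \<mu>) {W. valid W}"
    using QX0_subset_QX1 by (simp add: QX1_eq_words_over)
  show "[Ly m] \<in> {W. valid W}" using assms(2) valid_snoc[of "[]" "Ly m"] by simp
  show "shuffle u v \<in> words_over (Q_adjoin \<mu>) {W. valid W}"
    if "u \<in> words_over (Q_adjoin \<mu>) {W. valid W}" "v \<in> words_over (Q_adjoin \<mu>) {W. valid W}" for u v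
    using shuffle_in_QX1 that unfolding QX1_eq_words_over by blast
  show "\<forall>\<^sub>F s in at_right 0. lin_val (lval \<mu> s) (shuffle u v) =
      lin_val (lval \<mu> s) u * lin_val (lval \<mu> s) v"
    if "u \<in> words_over (Q_adjoin \<mu>) {W. valid W}" "v \<in> words_over (Q_adjoin \<mu>) {W. valid W}" for u v
    using lval_shuffle[OF assms(1)] that unfolding QX1_eq_words_over eventually_at_right_field
    by (intro exI[of _ 1]) auto
  show "words_over (Q_adjoin \<mu>) {W. valid W} \<subseteq> G"
    if "submod (Q_adjoin \<mu>) scale G" "QX0 \<mu> \<subseteq> G"
      "\<And>u. u \<in> G \<Longrightarrow> shuffle u (basis_elt [Ly m]) \<in> G" for G
    using QX1_generated[OF assms(2) that] unfolding QX1_eq_words_over .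
  fix w assume w: "w \<in> QX0 \<mu>"
  from QX0_error[OF assms(1) w assms(2)] obtain c where
    c: "c \<in> Z_mu \<mu>"
      "\<And>j. ((\<lambda>s. (lin_val (lval \<mu> s) w - c) * lval \<mu> s [Ly m] ^ j) \<longlongrightarrow> 0) (at_right 0)"
    by blast
  have "((\<lambda>s. lin_val (lval \<mu> s) w - c) \<longlongrightarrow> 0) (at_right 0)" using c(2)[of 0] by simp
  from zeta_sh_eqI[OF assms(1) w LIM_zero_cancel[OF this]] have "zeta_sh \<mu> w = c" .
  with c show "zeta_sh \<mu> w \<in> Z_mu \<mu>"
    and "((\<lambda>s. (lin_val (lval \<mu> s) w - zeta_sh \<mu> w) * lval \<mu> s [Ly m] ^ j) \<longlongrightarrow> 0) (at_right 0)" for j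
    by auto
next
  have "\<forall>\<^sub>F s in at_right 0. lin_val (lval \<mu> s) (basis_elt []) = 1"
    unfolding eventually_at_right_field using lval_Nil[OF assms(1)] by (intro exI[of _ 1]) auto
  from zeta_sh_eqI[OF assms(1) QX0_base(1) tendsto_eventually[OF this]]
  show "\<exists>w\<in>QX0 \<mu>. zeta_sh \<mu> w = 1" using QX0_base(1) by blast
qed simp

lemma zeta_sh_special:
  assumes "Re \<mu> > 0" "special u m m'"
  shows "zeta_sh \<mu> (basis_elt (yx (u @ [(1, m)])) - basis_elt (yx (u @ [(1, m')]))) = D_mu \<mu> u m m'"
  using QX0_limit(3)[OF assms] by (intro zeta_sh_eqI[OF assms(1) QX0_base(3)[OF assms(2)]]) simp

section \<open>Comparison of the regularisations\<close>

lemma is_reg_zeta_star_reg: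
  assumes "Re \<mu> > 0" "m > 0"
  shows "regularisation.is_reg (Q_adjoin \<mu>) {w. positive w} (QY0 \<mu>) (stuffle \<mu>)
    (zeta_star \<mu>) (Z_mu \<mu>) [(1, m)] (zeta_star_reg \<mu> m)"
proof -
  interpret regularisation "Q_adjoin \<mu>" "{w. positive w}" "QY0 \<mu>" "stuffle \<mu>" "trunc_zeta \<mu>" sequentially
    "zeta_star \<mu>" "Z_mu \<mu>" "[(1, m)]"
    by (rule stuffle_regularisation[OF assms])
  have "zeta_star_reg \<mu> m = (THE F. is_reg F)"
    unfolding zeta_star_reg_def is_reg_def QY_eq_words_over Z_mu_T_def ..
  then show ?thesis using theI'[OF ex1_is_reg] by simp
qed

lemma is_reg_zeta_sh_reg:
  assumes "Re \<mu> > 0" "m > 0"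
  shows "regularisation.is_reg (Q_adjoin \<mu>) {W. valid W} (QX0 \<mu>) shuffle
    (zeta_sh \<mu>) (Z_mu \<mu>) [Ly m] (zeta_sh_reg \<mu> m)"
proof -
  interpret regularisation "Q_adjoin \<mu>" "{W. valid W}" "QX0 \<mu>" shuffle "lval \<mu>" "at_right 0"
    "zeta_sh \<mu>" "Z_mu \<mu>" "[Ly m]"
    by (rule shuffle_regularisation[OF assms])
  have "zeta_sh_reg \<mu> m = (THE F. is_reg F)"
    unfolding zeta_sh_reg_def is_reg_def QX1_eq_words_over Z_mu_T_def ..
  then show ?thesis using theI'[OF ex1_is_reg] by simp
qed

section \<open>Change of the reference letter\<close>

lemma zeta_star_reg_change:
  assumes "Re \<mu> > 0" "m > 0" "m' > 0" "w \<in> QY \<mu>"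
  shows "zeta_star_reg \<mu> m' w = rho_mu \<mu> m m' (zeta_star_reg \<mu> m w)"
proof -
  interpret S: regularisation "Q_adjoin \<mu>" "{w. positive w}" "QY0 \<mu>" "stuffle \<mu>" "trunc_zeta \<mu>" sequentially
    "zeta_star \<mu>" "Z_mu \<mu>" "[(1, m)]"
    by (rule stuffle_regularisation[OF assms(1,2)])
  interpret S': regularisation "Q_adjoin \<mu>" "{w. positive w}" "QY0 \<mu>" "stuffle \<mu>" "trunc_zeta \<mu>" sequentially
    "zeta_star \<mu>" "Z_mu \<mu>" "[(1, m')]"
    by (rule stuffle_regularisation[OF assms(1,3)])
  note F' = S'.is_regD[OF is_reg_zeta_star_reg[OF assms(1,3)]]
  have "basis_elt [(1, m)] - basis_elt [(1, m')] \<in> QY0 \<mu> \<and>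
      zeta_star \<mu> (basis_elt [(1, m)] - basis_elt [(1, m')]) = c_mu \<mu> m m'"
  proof (cases "m = m'")
    \<comment> \<open>Special triples require distinct entries, so m = m' is treated apart: the
      difference of letters and the constant are both 0.\<close>
    case True
    have "0 \<in> QY0 \<mu>"
      unfolding QY0_def using submodD(1)[OF submod_span_over[OF scale.module_axioms scalar_ring_Q_adjoin]] .
    moreover have "zeta_star \<mu> 0 = 0" by (rule zeta_star_eqI) simp
    ultimately show ?thesis using True by (simp add: c_mu_def)
  next
    case False
    then have sp: "special [] m m'" using assms by (simp add: special_def)
    then have "basis_elt ([] @ [(1, m)]) - basis_elt ([] @ [(1, m')]) \<in> QY0 \<mu>"
      unfolding QY0_def
      by (intro span_over_base[OF scale.module_axioms scalar_ringD(5)[OF scalar_ring_Q_adjoin]]) blast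
    then show ?thesis
      using zeta_star_special[OF assms(1) sp] c_mu_eq_D_mu[OF assms(1) sp] by simp
  qed
  then show ?thesis
    using S.reg_change_of_generator[OF is_reg_zeta_star_reg[OF assms(1,2)] F'(1,2,3,4), of w] assms
    by (simp add: rho_mu_eq_pcompose QY_eq_words_over)
qed

lemma zeta_sh_reg_change:
  assumes "Re \<mu> > 0" "m > 0" "m' > 0" "w \<in> QX1 \<mu>"
  shows "zeta_sh_reg \<mu> m' w = rho_mu \<mu> m m' (zeta_sh_reg \<mu> m w)"
proof -
  interpret S: regularisation "Q_adjoin \<mu>" "{W. valid W}" "QX0 \<mu>" shuffle "lval \<mu>" "at_right 0"
    "zeta_sh \<mu>" "Z_mu \<mu>" "[Ly m]"
    by (rule shuffle_regularisation[OF assms(1,2)])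
  interpret S': regularisation "Q_adjoin \<mu>" "{W. valid W}" "QX0 \<mu>" shuffle "lval \<mu>" "at_right 0"
    "zeta_sh \<mu>" "Z_mu \<mu>" "[Ly m']"
    by (rule shuffle_regularisation[OF assms(1,3)])
  note F' = S'.is_regD[OF is_reg_zeta_sh_reg[OF assms(1,3)]]
  have "basis_elt [Ly m] - basis_elt [Ly m'] \<in> QX0 \<mu> \<and>
      zeta_sh \<mu> (basis_elt [Ly m] - basis_elt [Ly m']) = c_mu \<mu> m m'"
  proof (cases "m = m'")
    case True
    have "0 \<in> QX0 \<mu>"
      unfolding QX0_def using submodD(1)[OF submod_span_over[OF scale.module_axioms scalar_ring_Q_adjoin]] .
    moreover from this have "zeta_sh \<mu> 0 = 0" by (rule zeta_sh_eqI[OF assms(1)]) simp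
    ultimately show ?thesis using True by (simp add: c_mu_def)
  next
    case False
    then have sp: "special [] m m'" using assms by (simp add: special_def)
    then show ?thesis
      using zeta_sh_special[OF assms(1) sp] c_mu_eq_D_mu[OF assms(1) sp] QX0_base(3)[OF sp, of \<mu>] by simp
  qed
  then show ?thesis
    using S.reg_change_of_generator[OF is_reg_zeta_sh_reg[OF assms(1,2)] F'(1,2,3,4), of w] assms S'.y
    by (simp add: rho_mu_eq_pcompose QX1_eq_words_over)
qed

lemma zeta_star_reg_ex_power:
  assumes "Re \<mu> > 0" "m > 0"
  shows "\<exists>w\<in>QY \<mu>. zeta_star_reg \<mu> m w = monom 1 j"
  using regularisation.is_reg_ex_power[OF stuffle_regularisation[OF assms] is_reg_zeta_star_reg[OF assms]]
  unfolding QY_eq_words_over .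

lemma zeta_sh_reg_ex_power:
  assumes "Re \<mu> > 0" "m > 0"
  shows "\<exists>w\<in>QX1 \<mu>. zeta_sh_reg \<mu> m w = monom 1 j"
  using regularisation.is_reg_ex_power[OF shuffle_regularisation[OF assms] is_reg_zeta_sh_reg[OF assms]]
  unfolding QX1_eq_words_over .

lemma zeta_star_reg_asym:
  assumes "Re \<mu> > 0" "m > 0" "w \<in> QY \<mu>"
  shows "(\<lambda>N. lin_val (trunc_zeta \<mu> N) w - poly (zeta_star_reg \<mu> m w) (trunc_zeta \<mu> N [(1, m)])) \<longlonglongrightarrow> 0"
proof -
  interpret S: regularisation "Q_adjoin \<mu>" "{w. positive w}" "QY0 \<mu>" "stuffle \<mu>" "trunc_zeta \<mu>" sequentially
    "zeta_star \<mu>" "Z_mu \<mu>" "[(1, m)]"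
    by (rule stuffle_regularisation[OF assms(1,2)])
  show ?thesis
    using S.asymD[OF S.is_reg_asym[OF is_reg_zeta_star_reg[OF assms(1,2)]]] assms(3)
    by (simp add: QY_eq_words_over)
qed

lemma zeta_sh_reg_asym:
  assumes "Re \<mu> > 0" "m > 0" "w \<in> QX1 \<mu>"
  shows "((\<lambda>s. lin_val (lval \<mu> s) w - poly (zeta_sh_reg \<mu> m w) (lval \<mu> s [Ly m])) \<longlongrightarrow> 0) (at_right 0)"
proof -
  interpret S: regularisation "Q_adjoin \<mu>" "{W. valid W}" "QX0 \<mu>" shuffle "lval \<mu>" "at_right 0"
    "zeta_sh \<mu>" "Z_mu \<mu>" "[Ly m]"
    by (rule shuffle_regularisation[OF assms(1,2)])
  show ?thesis
    using S.asymD[OF S.is_reg_asym[OF is_reg_zeta_sh_reg[OF assms(1,2)]]] assms(3)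
    by (simp add: QX1_eq_words_over)
qed

section \<open>Abel means\<close>

lemma phi_in_QX1:
  assumes "w \<in> QY \<mu>"
  shows "phi w \<in> QX1 \<mu>"
proof -
  note R = scalar_ring_Q_adjoin[of \<mu>]
  note sub = submod_words_over[OF R, of "{W. valid W}"]
  show ?thesis
    unfolding phi_def lin_ext_def QX1_eq_words_over using assms
    by (intro submod_sum[OF sub] submodD(3)[OF sub] basis_elt_words_over[OF R])
      (auto simp: QY_def valid_yx)
qed

text \<open>Multiplying a power series by 1/(1 - q) replaces its coefficients by their partial sums,
  here the truncated sums by \<open>li_partial_sum\<close>.\<close>

lemma trunc_zeta_generating_series:
  assumes "Re \<mu> > 0" "positive w" "norm q < 1"
  shows "(\<lambda>N. trunc_zeta \<mu> N w * q ^ N) sums (suminf (\<lambda>n. fps_nth (li \<mu> (yx w)) n * q ^ n) / (1 - q))"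
proof -
  have "summable (\<lambda>n. norm (q ^ n))" using assms(3) by (simp add: norm_power)
  from Cauchy_product_sums[OF summable_li[OF assms(1) valid_yx[OF assms(2)] assms(3)] this]
  have "(\<lambda>N. \<Sum>i\<le>N. (fps_nth (li \<mu> (yx w)) i * q ^ i) * q ^ (N - i)) sums
      (suminf (\<lambda>n. fps_nth (li \<mu> (yx w)) n * q ^ n) * (1 / (1 - q)))"
    using suminf_geometric[OF assms(3)] by simp
  moreover have "(\<Sum>i\<le>N. (fps_nth (li \<mu> (yx w)) i * q ^ i) * q ^ (N - i)) = trunc_zeta \<mu> N w * q ^ N" for N
  proof -
    have "(\<Sum>i\<le>N. (fps_nth (li \<mu> (yx w)) i * q ^ i) * q ^ (N - i)) = (\<Sum>i\<le>N. fps_nth (li \<mu> (yx w)) i * q ^ N)"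
      by (intro sum.cong refl) (simp add: mult.assoc flip: power_add)
    then show ?thesis by (simp add: sum_distrib_right[symmetric] li_partial_sum[OF assms(2)])
  qed
  ultimately show ?thesis by simp
qed

definition abel_mean :: "complex \<Rightarrow> real \<Rightarrow> (nat \<Rightarrow> complex) \<Rightarrow> complex" where
  "abel_mean \<mu> s f = (1 - exp (- (\<mu> * of_real s))) * suminf (\<lambda>N. f N * exp (- (\<mu> * of_real s)) ^ N)"

text \<open>The weights (1 - q) q^N are complex, so what matters is their total absolute mass |1 -
  q|/(1 - |q|). It stays bounded because q approaches 1 inside a sector when Re mu > 0. The finitely
  many terms that are not yet small are suppressed by the factor 1 - q.\<close>

lemma abel_mean_tendsto_0:
  fixes e :: "nat \<Rightarrow> complex"
  assumes "Re \<mu> > 0" "e \<longlonglongrightarrow> 0"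
  shows "((\<lambda>s. abel_mean \<mu> s e) \<longlongrightarrow> 0) (at_right 0)"
  unfolding abel_mean_def
proof (rule tendstoI)
  fix \<epsilon> :: real assume \<epsilon>: "\<epsilon> > 0"
  define \<rho> where "\<rho> = Re \<mu>"
  have \<rho>: "\<rho> > 0" using assms(1) by (simp add: \<rho>_def)
  \<comment> \<open>This bounds the mass: |1 - q| <= |mu| s, while 1 - |q| >= rho s/(1 + rho s) >=
    rho s/(1 + rho) for s <= 1.\<close>
  define C where "C = norm \<mu> * (1 + \<rho>) / \<rho>"
  have mu: "norm \<mu> > 0" using assms(1) by auto
  have C: "C > 0" using \<rho> mu by (simp add: C_def)
  obtain B where B: "B > 0" "\<And>N. norm (e N) \<le> B"
    using convergent_imp_Bseq[OF convergentI[OF assms(2)]] unfolding Bseq_def by blast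
  obtain N0 where N0: "\<And>N. N \<ge> N0 \<Longrightarrow> norm (e N) < \<epsilon> / (2 * C)"
    using LIMSEQ_D[OF assms(2), of "\<epsilon> / (2 * C)"] \<epsilon> C by auto
  have bound: "norm ((1 - exp (- (\<mu> * of_real s))) * suminf (\<lambda>N. e N * exp (- (\<mu> * of_real s)) ^ N)) \<le>
      \<epsilon> / 2 + norm \<mu> * B * real N0 * s" if s: "0 < s" "s \<le> 1" for s
  proof -
    define q where "q = exp (- (\<mu> * of_real s))"
    have q: "norm q < 1" unfolding q_def by (rule norm_exp_mu_less_1[OF assms(1) s(1)])
    have q1: "norm (1 - q) \<le> norm \<mu> * s"
      using norm_exp_minus_1_le[of "- (\<mu> * of_real s)" 0] assms(1) s
      by (simp add: q_def norm_mult norm_minus_commute)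
    have q2: "norm (1 - q) / (1 - norm q) \<le> C"
    proof -
      have "1 + \<rho> * s \<le> exp (\<rho> * s)" by (rule exp_ge_add_one_self)
      then have "exp (- (\<rho> * s)) \<le> 1 / (1 + \<rho> * s)"
        using \<rho> s by (simp add: exp_minus divide_simps add_pos_pos)
      then have "\<rho> * s / (1 + \<rho> * s) \<le> 1 - norm q"
        using \<rho> s by (simp add: q_def \<rho>_def[symmetric] divide_simps add_pos_pos) (simp add: algebra_simps)
      moreover have "\<rho> * s / (1 + \<rho>) \<le> \<rho> * s / (1 + \<rho> * s)"
        using \<rho> s by (intro divide_left_mono) (auto intro!: mult_left_le add_pos_pos mult_pos_pos)
      ultimately have "\<rho> * s / (1 + \<rho>) \<le> 1 - norm q" by linarith
      then have "norm (1 - q) / (1 - norm q) \<le> (norm \<mu> * s) / (\<rho> * s / (1 + \<rho>))"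
        using q1 \<rho> s by (intro frac_le) auto
      also have "\<dots> = C" using \<rho> s by (simp add: C_def)
      finally show ?thesis .
    qed
    \<comment> \<open>A geometric majorant from N0 on, together with the crude bound
      \<open>B\<close> for the first N0 terms.\<close>
    define h where "h = (\<lambda>N. \<epsilon> / (2 * C) * norm q ^ N + (if N < N0 then B else 0))"
    have h: "h sums (\<epsilon> / (2 * C) * (1 / (1 - norm q)) + (\<Sum>N<N0. B))"
      unfolding h_def using q geometric_sums[of "norm q"] sums_If_finite[of "\<lambda>N. N < N0" "\<lambda>_. B"]
      by (intro sums_add sums_mult) (auto simp: lessThan_def)
    have eh: "norm (e N * q ^ N) \<le> h N" for N
    proof (cases "N < N0")
      case True
      have "norm (e N) * norm q ^ N \<le> B * 1"
        using B q by (intro mult_mono power_le_one) auto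
      also have "\<dots> \<le> h N" using True \<epsilon> C by (simp add: h_def)
      finally show ?thesis by (simp add: norm_mult norm_power)
    next
      case False
      then show ?thesis
        using mult_right_mono[OF less_imp_le[OF N0[of N]], of "norm q ^ N"]
        by (simp add: h_def norm_mult norm_power)
    qed
    have "norm ((1 - q) * suminf (\<lambda>N. e N * q ^ N)) \<le> norm (1 - q) * suminf h"
      unfolding norm_mult using h by (intro mult_left_mono norm_suminf_le[OF eh]) (auto simp: sums_iff)
    also have "suminf h = \<epsilon> / (2 * C) * (1 / (1 - norm q)) + real N0 * B"
      using h by (simp add: sums_iff)
    also have "norm (1 - q) * \<dots> = \<epsilon> / (2 * C) * (norm (1 - q) / (1 - norm q)) + norm (1 - q) * (real N0 * B)"
      by (simp add: algebra_simps)
    also have "\<dots> \<le> \<epsilon> / (2 * C) * C + (norm \<mu> * s) * (real N0 * B)"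
      using q1 q2 \<epsilon> C B(1) by (intro add_mono mult_left_mono mult_right_mono) auto
    finally show ?thesis using C by (simp add: q_def mult_ac)
  qed
  have "((\<lambda>s. \<epsilon> / 2 + norm \<mu> * B * real N0 * s) \<longlongrightarrow> \<epsilon> / 2 + norm \<mu> * B * real N0 * 0) (at_right 0)"
    by (intro tendsto_intros)
  then have "\<forall>\<^sub>F s in at_right 0. \<epsilon> / 2 + norm \<mu> * B * real N0 * s < \<epsilon>"
    by (rule order_tendstoD(2)) (use \<epsilon> in simp)
  moreover have "\<forall>\<^sub>F s::real in at_right 0. 0 < s \<and> s \<le> 1"
    unfolding eventually_at_right_field by (intro exI[of _ 1]) auto
  ultimately show "\<forall>\<^sub>F s in at_right 0.
      dist ((1 - exp (- (\<mu> * of_real s))) * suminf (\<lambda>N. e N * exp (- (\<mu> * of_real s)) ^ N)) 0 < \<epsilon>"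
    by eventually_elim (use bound in fastforce)
qed

lemma abel_mean_trunc_zeta:
  assumes "Re \<mu> > 0" "s > 0" "positive w"
  shows "abel_mean \<mu> s (\<lambda>N. trunc_zeta \<mu> N w) = exp (of_rat (total_shift (yx w)) * of_real s) * lval \<mu> s (yx w)"
    and "summable (\<lambda>N. trunc_zeta \<mu> N w * exp (- (\<mu> * of_real s)) ^ N)"
proof -
  let ?q = "exp (- (\<mu> * complex_of_real s))"
  have q: "norm ?q < 1" by (rule norm_exp_mu_less_1[OF assms(1,2)])
  then have "?q \<noteq> 1" by (metis norm_one less_irrefl)
  then have "1 - ?q \<noteq> 0" by simp
  with trunc_zeta_generating_series[OF assms(1,3) q]
  show "summable (\<lambda>N. trunc_zeta \<mu> N w * ?q ^ N)"
    and "abel_mean \<mu> s (\<lambda>N. trunc_zeta \<mu> N w) = exp (of_rat (total_shift (yx w)) * of_real s) * lval \<mu> s (yx w)"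
    by (simp_all add: sums_iff abel_mean_def lval_def mult_exp_exp flip: mult.assoc)
qed

lemma abel_mean_lin_val:
  assumes "Re \<mu> > 0" "s > 0" "w \<in> QY \<mu>"
  shows "abel_mean \<mu> s (\<lambda>N. lin_val (trunc_zeta \<mu> N) w) = lin_val (\<lambda>u. abel_mean \<mu> s (\<lambda>N. trunc_zeta \<mu> N u)) w"
    and "summable (\<lambda>N. lin_val (trunc_zeta \<mu> N) w * exp (- (\<mu> * of_real s)) ^ N)"
proof -
  let ?q = "exp (- (\<mu> * complex_of_real s))"
  have pos: "positive u" if "u \<in> Poly_Mapping.keys w" for u using that assms(3) by (simp add: QY_def)
  have eq: "(\<lambda>N. lin_val (trunc_zeta \<mu> N) w * ?q ^ N) =
      (\<lambda>N. \<Sum>u\<in>Poly_Mapping.keys w. Poly_Mapping.lookup w u * (trunc_zeta \<mu> N u * ?q ^ N))"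
    by (simp add: lin_val_def sum_distrib_right mult.assoc)
  have sm: "summable (\<lambda>N. trunc_zeta \<mu> N u * ?q ^ N)" if "u \<in> Poly_Mapping.keys w" for u
    by (rule abel_mean_trunc_zeta(2)[OF assms(1,2) pos[OF that]])
  show "summable (\<lambda>N. lin_val (trunc_zeta \<mu> N) w * ?q ^ N)"
    unfolding eq by (intro summable_sum summable_mult sm)
  have "suminf (\<lambda>N. lin_val (trunc_zeta \<mu> N) w * ?q ^ N) =
      (\<Sum>u\<in>Poly_Mapping.keys w. suminf (\<lambda>N. Poly_Mapping.lookup w u * (trunc_zeta \<mu> N u * ?q ^ N)))"
    unfolding eq by (intro suminf_sum summable_mult sm)
  also have "\<dots> = (\<Sum>u\<in>Poly_Mapping.keys w. Poly_Mapping.lookup w u * suminf (\<lambda>N. trunc_zeta \<mu> N u * ?q ^ N))"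
    by (intro sum.cong refl suminf_mult sm)
  finally show "abel_mean \<mu> s (\<lambda>N. lin_val (trunc_zeta \<mu> N) w) =
      lin_val (\<lambda>u. abel_mean \<mu> s (\<lambda>N. trunc_zeta \<mu> N u)) w"
    by (simp add: abel_mean_def lin_val_def sum_distrib_left mult_ac)
qed

text \<open>The Abel mean lacks the exponential prefactor of \<open>lval\<close>, so the difference
  is \<open>lval\<close> times a factor of order s. Although \<open>lval\<close> may diverge, it is
  polynomial in the divergent letter up to a vanishing error, and that letter grows more slowly than
  any power of 1/s.\<close>

lemma lval_yx_minus_abel_mean:
  assumes "Re \<mu> > 0" "positive u"
  shows "((\<lambda>s. lval \<mu> s (yx u) - abel_mean \<mu> s (\<lambda>N. trunc_zeta \<mu> N u)) \<longlongrightarrow> 0) (at_right 0)"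
proof -
  define c :: real where "c = of_rat (total_shift (yx u))"
  define E where "E = (\<lambda>s. 1 - exp (complex_of_real (c * s)))"
  have E: "norm (E s) \<le> (exp \<bar>c\<bar> * \<bar>c\<bar>) * s powr (1 / 4)" if s: "0 < s" "s \<le> 1" for s
  proof -
    have cs: "\<bar>c * s\<bar> \<le> \<bar>c\<bar> * 1" unfolding abs_mult using s by (intro mult_left_mono) auto
    have "norm (E s) = norm (exp (complex_of_real (c * s)) - 1)" by (simp add: E_def norm_minus_commute)
    also have "\<dots> \<le> exp \<bar>c\<bar> * norm (complex_of_real (c * s))"
      using cs by (intro norm_exp_minus_1_le) auto
    also have "\<dots> = exp \<bar>c\<bar> * \<bar>c\<bar> * s" using s by (simp add: abs_mult norm_mult)
    also have "\<dots> \<le> exp \<bar>c\<bar> * \<bar>c\<bar> * s powr (1 / 4)"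
      using s powr_mono'[of "1 / 4" 1 s] by (intro mult_left_mono) auto
    finally show ?thesis .
  qed
  let ?t = "\<lambda>s. lval \<mu> s [Ly 1]"
  have Et: "((\<lambda>s. E s * ?t s ^ j) \<longlongrightarrow> 0) (at_right 0)" for j
    by (rule error_tendsto_0[OF E lval_letter_bound[OF assms(1)]]) auto
  define P where "P = zeta_sh_reg \<mu> 1 (basis_elt (yx u))"
  have "basis_elt (yx u) \<in> QX1 \<mu>"
    unfolding QX1_eq_words_over using valid_yx[OF assms(2)] by (intro basis_elt_words_over scalar_ring_Q_adjoin) simp
  from zeta_sh_reg_asym[OF assms(1) _ this, of 1]
  have 1: "((\<lambda>s. lval \<mu> s (yx u) - poly P (?t s)) \<longlongrightarrow> 0) (at_right 0)" by (simp add: P_def)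
  \<comment> \<open>The exponent 0 brings the bare factor \<open>E s\<close> under the same limit
    rule as the products with powers of the letter.\<close>
  have "((\<lambda>s. E s * ?t s ^ 0 * (lval \<mu> s (yx u) - poly P (?t s)) +
      (\<Sum>j\<le>degree P. coeff P j * (E s * ?t s ^ j))) \<longlongrightarrow> 0 * 0 + (\<Sum>j\<le>degree P. coeff P j * 0)) (at_right 0)"
    by (intro tendsto_intros Et 1)
  moreover have "E s * ?t s ^ 0 * (lval \<mu> s (yx u) - poly P (?t s)) +
      (\<Sum>j\<le>degree P. coeff P j * (E s * ?t s ^ j)) = E s * lval \<mu> s (yx u)" for s
    by (simp add: poly_altdef sum_distrib_left algebra_simps)
  ultimately have 2: "((\<lambda>s. E s * lval \<mu> s (yx u)) \<longlongrightarrow> 0) (at_right 0)" by simp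
  have c: "complex_of_real c = of_rat (total_shift (yx u))"
    unfolding c_def by (cases "total_shift (yx u)") (simp add: of_rat_rat)
  have "E s * lval \<mu> s (yx u) = lval \<mu> s (yx u) - abel_mean \<mu> s (\<lambda>N. trunc_zeta \<mu> N u)" if "s > 0" for s
    using abel_mean_trunc_zeta(1)[OF assms(1) that assms(2)]
    by (simp add: E_def c[symmetric] algebra_simps)
  then have "\<forall>\<^sub>F s in at_right 0. E s * lval \<mu> s (yx u) = lval \<mu> s (yx u) - abel_mean \<mu> s (\<lambda>N. trunc_zeta \<mu> N u)"
    unfolding eventually_at_right_field by (intro exI[of _ 1]) auto
  from Lim_transform_eventually[OF 2 this] show ?thesis .
qed

lemma lval_phi_minus_abel_mean:
  assumes "Re \<mu> > 0" "w \<in> QY \<mu>"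
  shows "((\<lambda>s. lin_val (lval \<mu> s) (phi w) - abel_mean \<mu> s (\<lambda>N. lin_val (trunc_zeta \<mu> N) w)) \<longlongrightarrow> 0) (at_right 0)"
proof -
  have "((\<lambda>s. \<Sum>u\<in>Poly_Mapping.keys w. Poly_Mapping.lookup w u *
      (lval \<mu> s (yx u) - abel_mean \<mu> s (\<lambda>N. trunc_zeta \<mu> N u))) \<longlongrightarrow>
      (\<Sum>u\<in>Poly_Mapping.keys w. Poly_Mapping.lookup w u * 0)) (at_right 0)"
    using assms by (intro tendsto_sum tendsto_mult_left lval_yx_minus_abel_mean) (auto simp: QY_def)
  then have 1: "((\<lambda>s. \<Sum>u\<in>Poly_Mapping.keys w. Poly_Mapping.lookup w u *
      (lval \<mu> s (yx u) - abel_mean \<mu> s (\<lambda>N. trunc_zeta \<mu> N u))) \<longlongrightarrow> 0) (at_right 0)" by simp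
  have "(\<Sum>u\<in>Poly_Mapping.keys w. Poly_Mapping.lookup w u *
      (lval \<mu> s (yx u) - abel_mean \<mu> s (\<lambda>N. trunc_zeta \<mu> N u))) =
      lin_val (lval \<mu> s) (phi w) - abel_mean \<mu> s (\<lambda>N. lin_val (trunc_zeta \<mu> N) w)" if "s > 0" for s
    unfolding abel_mean_lin_val(1)[OF assms(1) that assms(2)] phi_def lin_val_lin_ext
    by (simp add: lin_val_def[of _ w] algebra_simps sum_subtractf)
  then have "\<forall>\<^sub>F s in at_right 0. (\<Sum>u\<in>Poly_Mapping.keys w. Poly_Mapping.lookup w u *
      (lval \<mu> s (yx u) - abel_mean \<mu> s (\<lambda>N. trunc_zeta \<mu> N u))) =
      lin_val (lval \<mu> s) (phi w) - abel_mean \<mu> s (\<lambda>N. lin_val (trunc_zeta \<mu> N) w)"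
    unfolding eventually_at_right_field by (intro exI[of _ 1]) auto
  from Lim_transform_eventually[OF 1 this] show ?thesis .
qed

lemma C_linear_sum_coeff:
  fixes R :: "nat \<Rightarrow> complex poly"
  shows "C_linear (\<lambda>p. \<Sum>j\<le>degree p. smult (coeff p j) (R j))"
proof (rule C_linearI)
  \<comment> \<open>The range of summation depends on the degree; padding with zero coefficients
    makes two polynomials comparable.\<close>
  have ext: "(\<Sum>j\<le>degree p. smult (coeff p j) (R j)) = (\<Sum>j\<le>n. smult (coeff p j) (R j))"
    if "degree p \<le> n" for p n
    using that by (intro sum.mono_neutral_left) (auto simp: coeff_eq_0)
  show "(\<Sum>j\<le>degree (p + q). smult (coeff (p + q) j) (R j)) =
      (\<Sum>j\<le>degree p. smult (coeff p j) (R j)) + (\<Sum>j\<le>degree q. smult (coeff q j) (R j))" for p q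
    using ext[of p "max (degree p) (degree q)"] ext[of q "max (degree p) (degree q)"]
      ext[of "p + q" "max (degree p) (degree q)"] degree_add_le_max[of p q]
    by (simp add: smult_add_left sum.distrib)
  have "smult c (sum f A) = (\<Sum>i\<in>A. smult c (f i))" for c and f :: "nat \<Rightarrow> complex poly" and A
    by (induction A rule: infinite_finite_induct) (auto simp: smult_add_right)
  then show "(\<Sum>j\<le>degree (smult c p). smult (coeff (smult c p) j) (R j)) =
      smult c (\<Sum>j\<le>degree p. smult (coeff p j) (R j))" for c p
    using ext[of "smult c p" "degree p"] by (simp add: degree_smult_le)
qed

lemma zeta_sh_reg_phi:
  assumes "Re \<mu> > 0" "m > 0" "m' > 0"
  shows "\<exists>\<rho>. C_linear \<rho> \<and> (\<forall>w\<in>QY \<mu>. zeta_sh_reg \<mu> m' (phi w) = \<rho> (zeta_star_reg \<mu> m w))"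
proof -
  have "\<forall>j. \<exists>w. w \<in> QY \<mu> \<and> zeta_star_reg \<mu> m w = monom 1 j"
    using zeta_star_reg_ex_power[OF assms(1,2)] by blast
  from choice[OF this] obtain v where v: "\<And>j. v j \<in> QY \<mu>" "\<And>j. zeta_star_reg \<mu> m (v j) = monom 1 j"
    by blast
  define \<rho> where "\<rho> = (\<lambda>p. \<Sum>j\<le>degree p. smult (coeff p j) (zeta_sh_reg \<mu> m' (phi (v j))))"
  have "zeta_sh_reg \<mu> m' (phi w) = \<rho> (zeta_star_reg \<mu> m w)" if w: "w \<in> QY \<mu>" for w
  proof -
    define P where "P = zeta_star_reg \<mu> m w"
    let ?t = "\<lambda>N. trunc_zeta \<mu> N [(1, m)]"
    \<comment> \<open>A sequence rather than an element of \<open>QY\<close>: the coefficients of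
      \<open>P\<close> lie in \<open>Z_mu\<close>, and complex sequences admit them as
      scalars.\<close>
    define e where "e = (\<lambda>N. lin_val (trunc_zeta \<mu> N) w - (\<Sum>j\<le>degree P. coeff P j * lin_val (trunc_zeta \<mu> N) (v j)))"
    have "(\<lambda>N. (lin_val (trunc_zeta \<mu> N) w - poly P (?t N)) -
        (\<Sum>j\<le>degree P. coeff P j * (lin_val (trunc_zeta \<mu> N) (v j) - poly (monom 1 j) (?t N)))) \<longlonglongrightarrow>
        0 - (\<Sum>j\<le>degree P. coeff P j * 0)"
      unfolding P_def v(2)[symmetric] by (intro tendsto_intros zeta_star_reg_asym assms w v)
    moreover have "(lin_val (trunc_zeta \<mu> N) w - poly P (?t N)) -
        (\<Sum>j\<le>degree P. coeff P j * (lin_val (trunc_zeta \<mu> N) (v j) - poly (monom 1 j) (?t N))) = e N" for N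
      by (simp add: e_def poly_altdef[of P] poly_monom algebra_simps sum_subtractf)
    ultimately have e: "e \<longlonglongrightarrow> 0" by simp
    let ?A = "\<lambda>s w. abel_mean \<mu> s (\<lambda>N. lin_val (trunc_zeta \<mu> N) w)"
    have abel_e: "abel_mean \<mu> s e = ?A s w - (\<Sum>j\<le>degree P. coeff P j * ?A s (v j))" if s: "s > 0" for s
    proof -
      let ?q = "exp (- (\<mu> * complex_of_real s))"
      let ?S = "\<lambda>w. suminf (\<lambda>N. lin_val (trunc_zeta \<mu> N) w * ?q ^ N)"
      have "(\<lambda>N. lin_val (trunc_zeta \<mu> N) w * ?q ^ N -
          (\<Sum>j\<le>degree P. coeff P j * (lin_val (trunc_zeta \<mu> N) (v j) * ?q ^ N))) sums
          (?S w - (\<Sum>j\<le>degree P. coeff P j * ?S (v j)))"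
        by (intro sums_diff sums_sum sums_mult summable_sums abel_mean_lin_val(2) assms s w v)
      moreover have "lin_val (trunc_zeta \<mu> N) w * ?q ^ N -
          (\<Sum>j\<le>degree P. coeff P j * (lin_val (trunc_zeta \<mu> N) (v j) * ?q ^ N)) = e N * ?q ^ N" for N
        by (simp add: e_def left_diff_distrib sum_distrib_right mult.assoc)
      ultimately have "suminf (\<lambda>N. e N * ?q ^ N) = ?S w - (\<Sum>j\<le>degree P. coeff P j * ?S (v j))"
        by (simp add: sums_iff)
      then show ?thesis
        by (simp add: abel_mean_def right_diff_distrib sum_distrib_left mult.left_commute)
    qed
    have abel_lim: "((\<lambda>s. abel_mean \<mu> s e) \<longlongrightarrow> 0) (at_right 0)"
      by (rule abel_mean_tendsto_0[OF assms(1) e])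
    let ?L = "\<lambda>s w. lin_val (lval \<mu> s) (phi w)"
    let ?u = "\<lambda>s. lval \<mu> s [Ly m']"
    let ?Q = "\<lambda>w. zeta_sh_reg \<mu> m' (phi w)"
    \<comment> \<open>In this sum of null functions the terms \<open>?L\<close> cancel within each
      bracket. By \<open>abel_e\<close> the Abel means cancel too, leaving a polynomial in the
      divergent letter that must vanish identically.\<close>
    have "((\<lambda>s. abel_mean \<mu> s e + ((?L s w - ?A s w) - (?L s w - poly (?Q w) (?u s))) -
        (\<Sum>j\<le>degree P. coeff P j * ((?L s (v j) - ?A s (v j)) - (?L s (v j) - poly (?Q (v j)) (?u s))))) \<longlongrightarrow>
        0 + (0 - 0) - (\<Sum>j\<le>degree P. coeff P j * (0 - 0))) (at_right 0)"
      by (intro tendsto_intros abel_lim lval_phi_minus_abel_mean zeta_sh_reg_asym phi_in_QX1 assms w v)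
    then have lim: "((\<lambda>s. abel_mean \<mu> s e + (poly (?Q w) (?u s) - ?A s w) -
        (\<Sum>j\<le>degree P. coeff P j * (poly (?Q (v j)) (?u s) - ?A s (v j)))) \<longlongrightarrow> 0) (at_right 0)"
      by simp
    have "\<forall>\<^sub>F s in at_right 0. abel_mean \<mu> s e + (poly (?Q w) (?u s) - ?A s w) -
        (\<Sum>j\<le>degree P. coeff P j * (poly (?Q (v j)) (?u s) - ?A s (v j))) = poly (?Q w - \<rho> P) (?u s)"
      unfolding eventually_at_right_field
    proof (intro exI[of _ 1] conjI allI impI)
      fix s :: real assume "0 < s"
      then show "abel_mean \<mu> s e + (poly (?Q w) (?u s) - ?A s w) -
        (\<Sum>j\<le>degree P. coeff P j * (poly (?Q (v j)) (?u s) - ?A s (v j))) = poly (?Q w - \<rho> P) (?u s)"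
        unfolding abel_e[OF \<open>0 < s\<close>] \<rho>_def
        by (simp add: poly_sum right_diff_distrib sum_subtractf)
    qed simp
    from Lim_transform_eventually[OF lim this]
    have "?Q w - \<rho> P = 0"
      by (rule poly_filterlim_at_infinity_eq_0[OF _ lval_letter_infinity[OF assms(1,3)]]) simp
    then show ?thesis by (simp add: P_def)
  qed
  moreover have "C_linear \<rho>" unfolding \<rho>_def by (rule C_linear_sum_coeff)
  ultimately show ?thesis by (intro exI[of _ \<rho>]) simp
qed

theorem theorem1p5:
  fixes \<mu> :: complex and m m' :: rat
  assumes "Re \<mu> > 0" and "m > 0" and "m' > 0"
  shows
    "(C_linear (rho_mu \<mu> m m') \<and>
      (\<forall>s. rho_mu \<mu> m m' (monom 1 s) = [:c_mu \<mu> m m', 1:] ^ s) \<and>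
      (\<forall>w\<in>QY \<mu>. zeta_star_reg \<mu> m' w = rho_mu \<mu> m m' (zeta_star_reg \<mu> m w)) \<and>
      (\<forall>\<rho>. C_linear \<rho> \<longrightarrow> (\<forall>w\<in>QY \<mu>. zeta_star_reg \<mu> m' w = \<rho> (zeta_star_reg \<mu> m w)) \<longrightarrow>
         \<rho> = rho_mu \<mu> m m'))
     \<and>
     ((\<forall>w\<in>QX1 \<mu>. zeta_sh_reg \<mu> m' w = rho_mu \<mu> m m' (zeta_sh_reg \<mu> m w)) \<and>
      (\<forall>\<rho>. C_linear \<rho> \<longrightarrow> (\<forall>w\<in>QX1 \<mu>. zeta_sh_reg \<mu> m' w = \<rho> (zeta_sh_reg \<mu> m w)) \<longrightarrow>
         \<rho> = rho_mu \<mu> m m'))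
     \<and>
     (\<exists>!\<rho>. C_linear \<rho> \<and>
        (\<forall>w\<in>QY \<mu>. zeta_sh_reg \<mu> m' (phi w) = \<rho> (zeta_star_reg \<mu> m w)))"
proof (intro conjI allI impI ballI)
  show "C_linear (rho_mu \<mu> m m')" by (rule C_linear_rho_mu)
  show "rho_mu \<mu> m m' (monom 1 s) = [:c_mu \<mu> m m', 1:] ^ s" for s by (rule rho_mu_monom)
  show star: "zeta_star_reg \<mu> m' w = rho_mu \<mu> m m' (zeta_star_reg \<mu> m w)" if "w \<in> QY \<mu>" for w
    by (rule zeta_star_reg_change[OF assms that])
  show sh: "zeta_sh_reg \<mu> m' w = rho_mu \<mu> m m' (zeta_sh_reg \<mu> m w)" if "w \<in> QX1 \<mu>" for w
    by (rule zeta_sh_reg_change[OF assms that])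
  show "\<rho> = rho_mu \<mu> m m'"
    if \<rho>: "C_linear \<rho>" "\<forall>w\<in>QY \<mu>. zeta_star_reg \<mu> m' w = \<rho> (zeta_star_reg \<mu> m w)" for \<rho>
  \<comment> \<open>The given relation fixes the map on all values of \<open>zeta_star_reg\<close>,
    among which every monomial occurs.\<close>
  proof (rule C_linear_eqI[OF \<rho>(1) C_linear_rho_mu])
    fix j
    obtain w where "w \<in> QY \<mu>" "zeta_star_reg \<mu> m w = monom 1 j"
      using zeta_star_reg_ex_power[OF assms(1,2)] by blast
    then show "\<rho> (monom 1 j) = rho_mu \<mu> m m' (monom 1 j)"
      using \<rho>(2) star by metis
  qed
  show "\<rho> = rho_mu \<mu> m m'"
    if \<rho>: "C_linear \<rho>" "\<forall>w\<in>QX1 \<mu>. zeta_sh_reg \<mu> m' w = \<rho> (zeta_sh_reg \<mu> m w)" for \<rho>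
  proof (rule C_linear_eqI[OF \<rho>(1) C_linear_rho_mu])
    fix j
    obtain w where "w \<in> QX1 \<mu>" "zeta_sh_reg \<mu> m w = monom 1 j"
      using zeta_sh_reg_ex_power[OF assms(1,2)] by blast
    then show "\<rho> (monom 1 j) = rho_mu \<mu> m m' (monom 1 j)"
      using \<rho>(2) sh by metis
  qed
  show "\<exists>!\<rho>. C_linear \<rho> \<and> (\<forall>w\<in>QY \<mu>. zeta_sh_reg \<mu> m' (phi w) = \<rho> (zeta_star_reg \<mu> m w))"
  proof (rule ex_ex1I)
    show "\<exists>\<rho>. C_linear \<rho> \<and> (\<forall>w\<in>QY \<mu>. zeta_sh_reg \<mu> m' (phi w) = \<rho> (zeta_star_reg \<mu> m w))"
      by (rule zeta_sh_reg_phi[OF assms])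
    fix \<rho> \<rho>'
    assume \<rho>: "C_linear \<rho> \<and> (\<forall>w\<in>QY \<mu>. zeta_sh_reg \<mu> m' (phi w) = \<rho> (zeta_star_reg \<mu> m w))"
      and \<rho>': "C_linear \<rho>' \<and> (\<forall>w\<in>QY \<mu>. zeta_sh_reg \<mu> m' (phi w) = \<rho>' (zeta_star_reg \<mu> m w))"
    show "\<rho> = \<rho>'"
    proof (rule C_linear_eqI)
      fix j
      obtain w where "w \<in> QY \<mu>" "zeta_star_reg \<mu> m w = monom 1 j"
        using zeta_star_reg_ex_power[OF assms(1,2)] by blast
      then show "\<rho> (monom 1 j) = \<rho>' (monom 1 j)" using \<rho> \<rho>' by metis
    qed (use \<rho> \<rho>' in auto)
  qed
qed

end
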